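(* Suppose we are given three prequantum systems arising from symplectic manifolds $M,N,P$, with prequantum line bundles $\mathcal{L}_M,\mathcal{L}_N,\mathcal{L}_P$, and elements $\sigma\in\Gamma^*(M\times\overline{N},\mathcal{L}_M\otimes\mathcal{L}_N^* )$ and $\tau\in\Gamma^*(N\times\overline{P},\mathcal{L}_N\otimes\mathcal{L}_P^* )$. Then the composition $\sigma\circ\tau\in\Omega^*(M\times\overline{P},\mathcal{L}_M\otimes\mathcal{L}_P^* )$ lies in $\Gamma^*(M\times\overline{P},\mathcal{L}_M\otimes\mathcal{L}_P^* )$.
   Context: A prequantum system is a quadruple $(M,\omega_M,\mathcal{L}_M,\nabla_M)$ where $(M,\omega_M)$ is a compact connected symplectic manifold and $\mathcal{L}_M\to M$ is a hermitian complex line bundle with unitary connection $\nabla_M$ of curvature $\omega_M$, normalized so that the induced operator on $\Omega^*(M,\mathcal{L}_M)$ satisfies $\nabla_M^2=-i\,\omega_M\wedge$. The dual system is $\overline{M}=(M,-\omega_M,\mathcal{L}_M^*,\nabla_M^+)$, with $\nabla_M^+$ the induced dual connection. The product $M\times\overline{N}$ is the prequantum system with form $\omega_M-\omega_N$, line bundle $\mathcal{L}_M\otimes\mathcal{L}_N^*$ (pullbacks suppressed) and the tensor product connection. For a prequantum system $(X,\omega,\mathcal{L},\nabla)$, $\Gamma^*(X,\mathcal{L})=\ker(\omega\wedge)\subset\Omega^*(X,\mathcal{L})$. Composition: let $i,j,k$ be the projections of $M\times N\times P$ to $M\times N$, $N\times P$, $M\times P$ respectively. For $\xi\in\Omega^*(M\times\overline{N},\mathcal{L}_M\otimes\mathcal{L}_N^*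 )$ and $\eta\in\Omega^*(N\times\overline{P},\mathcal{L}_N\otimes\mathcal{L}_P^* )$, $$\xi\circ\eta=k_*\,\hat c_N(i^*\xi\wedge j^*\eta)\in\Omega^*(M\times\overline{P},\mathcal{L}_M\otimes\mathcal{L}_P^* ),$$ where $\hat c_N:\mathcal{L}_M\otimes\mathcal{L}_N^*\otimes\mathcal{L}_N\otimes\mathcal{L}_P^*\to\mathcal{L}_M\otimes\mathcal{L}_P^*$ is the natural ($\mathbb{C}$-linear) contraction and $k_*$ is fibre integration over $N$ with its symplectic orientation. *)

theory Defs
  imports "HOL-Analysis.Analysis" "HOL-Library.Function_Algebras"
begin

section \<open>Complex vector spaces\<close>

class complex_vector = real_vector +
  fixes scaleC :: "complex \<Rightarrow> 'a \<Rightarrow> 'a" (infixr "*\<^sub>C" 75)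
  assumes scaleC_add_right: "z *\<^sub>C (x + y) = z *\<^sub>C x + z *\<^sub>C y"
    and scaleC_add_left: "(z + w) *\<^sub>C x = z *\<^sub>C x + w *\<^sub>C x"
    and scaleC_scaleC: "z *\<^sub>C w *\<^sub>C x = (z * w) *\<^sub>C x"
    and scaleC_one: "1 *\<^sub>C x = x"
    and scaleR_scaleC: "r *\<^sub>R x = complex_of_real r *\<^sub>C x"

instantiation complex :: complex_vector
begin
definition scaleC_complex_def: "z *\<^sub>C (w::complex) = z * w"
instance
  by standard (simp_all add: scaleC_complex_def algebra_simps scaleR_conv_of_real)
end

instantiation "fun" :: (type, real_vector) real_vector
begin
definition scaleR_fun_def: "r *\<^sub>R f = (\<lambda>x. r *\<^sub>R f x)"
instance
  by standard (auto simp: scaleR_fun_def fun_eq_iff algebra_simps)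
end

instantiation "fun" :: (type, complex_vector) complex_vector
begin
definition scaleC_fun_def: "z *\<^sub>C f = (\<lambda>x. z *\<^sub>C f x)"
instance
  by standard
    (auto simp: scaleC_fun_def scaleR_fun_def fun_eq_iff scaleC_add_right scaleC_add_left
      scaleC_scaleC scaleC_one scaleR_scaleC)
end


section \<open>Smooth manifolds\<close>

primrec Ck_on :: "nat \<Rightarrow> 'a::real_normed_vector set \<Rightarrow> ('a \<Rightarrow> 'b::real_normed_vector) \<Rightarrow> bool" where
  "Ck_on 0 S f \<longleftrightarrow> continuous_on S f"
| "Ck_on (Suc k) S f \<longleftrightarrow>
     (\<forall>x\<in>S. f differentiable at x) \<and> (\<forall>v. Ck_on k S (\<lambda>x. frechet_derivative f (at x) v))"

text \<open>Used for open subsets of finite-dimensional spaces only.\<close>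
definition smooth_on :: "'a::real_normed_vector set \<Rightarrow> ('a \<Rightarrow> 'b::real_normed_vector) \<Rightarrow> bool" where
  "smooth_on S f \<longleftrightarrow> (\<forall>k. Ck_on k S f)"

text \<open>
  A manifold is a type \<^typ>\<open>'m\<close> with a smooth atlas; a chart is an open set together with a map into
  the model space \<^typ>\<open>'e\<close>, of which only the values on that open set matter.  The model space is a
  finite-dimensional inner product space and not an instance of \<^class>\<open>euclidean_space\<close>,
  because the latter excludes dimension 0 and the one-point manifold is a legitimate symplectic
  manifold.
\<close>
type_synonym ('m, 'e) chart = "'m set \<times> ('m \<Rightarrow> 'e)"
type_synonym ('m, 'e) atlas = "('m, 'e) chart set"

definition chart_inv :: "('m, 'e) chart \<Rightarrow> 'e \<Rightarrow> 'm" where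
  "chart_inv c = inv_into (fst c) (snd c)"

definition smooth_atlas :: "('m::topological_space, 'e::real_inner) atlas \<Rightarrow> bool" where
  "smooth_atlas A \<longleftrightarrow>
     (\<exists>B::'e set. finite B \<and> span B = UNIV) \<and>
     \<Union> (fst ` A) = UNIV \<and>
     (\<forall>c\<in>A. open (fst c) \<and> open (snd c ` fst c) \<and>
        homeomorphism (fst c) (snd c ` fst c) (snd c) (chart_inv c)) \<and>
     (\<forall>c\<in>A. \<forall>c'\<in>A. smooth_on (snd c ` (fst c \<inter> fst c')) (snd c' \<circ> chart_inv c))"

definition prod_atlas ::
  "('m, 'e) atlas \<Rightarrow> ('n, 'f) atlas \<Rightarrow> ('m \<times> 'n, 'e \<times> 'f) atlas" where
  "prod_atlas A B = {(U \<times> V, map_prod \<phi> \<psi>) | U \<phi> V \<psi>. (U, \<phi>) \<in> A \<and> (V, \<psi>) \<in> B}"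

definition smooth_near ::
  "('m::topological_space, 'e::real_normed_vector) atlas \<Rightarrow> 'm \<Rightarrow> ('m \<Rightarrow> 'b::real_normed_vector) \<Rightarrow> bool" where
  "smooth_near A x f \<longleftrightarrow>
     (\<exists>c\<in>A. \<exists>V. open V \<and> x \<in> V \<and> V \<subseteq> fst c \<and> smooth_on (snd c ` V) (f \<circ> chart_inv c))"

text \<open>
  Tangent vectors at \<open>x\<close> are the directional derivatives at \<open>x\<close>, acting on real functions that are
  smooth near \<open>x\<close> (and mapping all other functions to 0, so that a tangent vector is determined by
  its action on germs).
\<close>
type_synonym 'm tvec = "('m \<Rightarrow> real) \<Rightarrow> real"

definition chart_vec ::
  "('m::topological_space, 'e::real_normed_vector) atlas \<Rightarrow> ('m, 'e) chart \<Rightarrow> 'm \<Rightarrow> 'e \<Rightarrow> 'm tvec" where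
  "chart_vec A c x w = (\<lambda>f. if smooth_near A x f
      then frechet_derivative (f \<circ> chart_inv c) (at (snd c x)) w else 0)"

definition tangent :: "('m::topological_space, 'e::real_normed_vector) atlas \<Rightarrow> 'm \<Rightarrow> 'm tvec set" where
  "tangent A x = {chart_vec A c x w | c w. c \<in> A \<and> x \<in> fst c}"

text \<open>Differential at \<open>x\<close> of a smooth map into a manifold with atlas \<open>B\<close>.\<close>
definition pushforward ::
  "('n::topological_space, 'f::real_normed_vector) atlas \<Rightarrow> ('m \<Rightarrow> 'n) \<Rightarrow> 'm \<Rightarrow> 'm tvec \<Rightarrow> 'n tvec" where
  "pushforward B F x v = (\<lambda>g. if smooth_near B (F x) g then v (g \<circ> F) else 0)"

definition cderiv :: "'m tvec \<Rightarrow> ('m \<Rightarrow> complex) \<Rightarrow> complex" where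
  "cderiv v f = Complex (v (Re \<circ> f)) (v (Im \<circ> f))"


section \<open>Differential forms\<close>

text \<open>
  An inhomogeneous form assigns to each point a function on lists of tangent vectors; its degree-\<open>k\<close>
  component is the restriction to lists of length \<open>k\<close>.  Values at lists that
  do not consist of tangent vectors at the point are normalised to 0, so that equality of forms is
  equality of functions, and sums and multiples of forms are those of functions.
\<close>
type_synonym ('m, 'v) form = "'m \<Rightarrow> 'm tvec list \<Rightarrow> 'v"

definition alt_form :: "'m tvec set \<Rightarrow> ('m tvec list \<Rightarrow> 'v::real_vector) \<Rightarrow> bool" where
  "alt_form T a \<longleftrightarrow>
     (\<forall>vs. \<not> set vs \<subseteq> T \<longrightarrow> a vs = 0) \<and>
     (\<forall>vs. set vs \<subseteq> T \<and> \<not> distinct vs \<longrightarrow> a vs = 0) \<and>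
     (\<forall>vs i. set vs \<subseteq> T \<and> i < length vs \<longrightarrow>
        (\<forall>u\<in>T. \<forall>v\<in>T. a (vs[i := u + v]) = a (vs[i := u]) + a (vs[i := v])) \<and>
        (\<forall>u\<in>T. \<forall>r. a (vs[i := r *\<^sub>R u]) = r *\<^sub>R a (vs[i := u])))"

definition of_degree :: "nat \<Rightarrow> ('m, 'v::zero) form \<Rightarrow> bool" where
  "of_degree p \<alpha> \<longleftrightarrow> (\<forall>x vs. length vs \<noteq> p \<longrightarrow> \<alpha> x vs = 0)"

definition real_forms :: "('m::topological_space, 'e::real_normed_vector) atlas \<Rightarrow> ('m, real) form set" where
  "real_forms A = {\<alpha>. (\<forall>x. alt_form (tangent A x) (\<alpha> x)) \<and>
     (\<forall>c\<in>A. \<forall>ws. \<forall>x\<in>fst c. smooth_near A x (\<lambda>y. \<alpha> y (map (chart_vec A c y) ws)))}"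

definition pullback ::
  "('m::topological_space, 'e::real_normed_vector) atlas \<Rightarrow>
   ('n::topological_space, 'f::real_normed_vector) atlas \<Rightarrow>
   ('m \<Rightarrow> 'n) \<Rightarrow> ('n, 'v::zero) form \<Rightarrow> ('m, 'v) form" where
  "pullback A B F \<alpha> x vs =
     (if set vs \<subseteq> tangent A x then \<alpha> (F x) (map (pushforward B F x) vs) else 0)"

text \<open>
  The shuffle formula: the sum runs over all ways to split the arguments into two sublists, with the
  sign of the corresponding shuffle.  The bilinear map \<open>m x\<close> multiplies the values at \<open>x\<close>.
\<close>
definition shuffle_inversions :: "nat \<Rightarrow> nat set \<Rightarrow> nat" where
  "shuffle_inversions n S = card {(i, j). i \<in> S \<and> j \<in> {..<n} - S \<and> j < i}"

definition wedge ::
  "('m \<Rightarrow> 'u \<Rightarrow> 'v \<Rightarrow> 'w::real_vector) \<Rightarrow> ('m, 'u) form \<Rightarrow> ('m, 'v) form \<Rightarrow> ('m, 'w) form" where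
  "wedge m \<alpha> \<beta> x vs = (\<Sum>S\<in>Pow {..<length vs}.
     (- 1) ^ shuffle_inversions (length vs) S *\<^sub>R m x (\<alpha> x (nths vs S)) (\<beta> x (nths vs (- S))))"

definition rwedge :: "('m, real) form \<Rightarrow> ('m, 'v::real_vector) form \<Rightarrow> ('m, 'v) form"
    (infixr "\<and>\<^sub>R" 70) where
  "\<alpha> \<and>\<^sub>R \<beta> = wedge (\<lambda>_. scaleR) \<alpha> \<beta>"

primrec wedge_power :: "('m, real) form \<Rightarrow> nat \<Rightarrow> ('m, real) form" where
  "wedge_power \<omega> 0 = (\<lambda>x vs. if vs = [] then 1 else 0)"
| "wedge_power \<omega> (Suc n) = \<omega> \<and>\<^sub>R wedge_power \<omega> n"

text \<open>
  In a chart around \<open>x\<close> the arguments are extended to constant coordinate fields \<open>w\<^sub>i\<close>, whose brackets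
  vanish, so \<open>d\<alpha>(w\<^sub>0, \<dots>, w\<^sub>k) = (\<Sum>i. (-1)^i w\<^sub>i(\<alpha>(w\<^sub>0, \<dots>, w\<^sub>k without w\<^sub>i)))\<close>.
\<close>
definition ext_deriv ::
  "('m::topological_space, 'e::real_normed_vector) atlas \<Rightarrow> ('m, real) form \<Rightarrow> ('m, real) form" where
  "ext_deriv A \<alpha> x vs = (if set vs \<subseteq> tangent A x then
     (let c = (SOME c. c \<in> A \<and> x \<in> fst c);
          ws = map (inv (chart_vec A c x)) vs
      in \<Sum>i<length vs. (- 1) ^ i * (vs ! i) (\<lambda>y. \<alpha> y (map (chart_vec A c y) (nths ws (- {i})))))
     else 0)"

definition symplectic ::
  "('m::topological_space, 'e::real_normed_vector) atlas \<Rightarrow> ('m, real) form \<Rightarrow> bool" where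
  "symplectic A \<omega> \<longleftrightarrow> \<omega> \<in> real_forms A \<and> of_degree 2 \<omega> \<and> ext_deriv A \<omega> = 0 \<and>
     (\<forall>x. \<forall>v\<in>tangent A x. (\<forall>w\<in>tangent A x. \<omega> x [v, w] = 0) \<longrightarrow> v = 0)"


section \<open>Complex lines\<close>

definition complex_line :: "'l::complex_vector set \<Rightarrow> bool" where
  "complex_line V \<longleftrightarrow> (\<exists>e. e \<noteq> 0 \<and> V = range (\<lambda>z. z *\<^sub>C e))"

definition line_coord :: "'l::complex_vector \<Rightarrow> 'l \<Rightarrow> complex" where
  "line_coord e v = (THE z. v = z *\<^sub>C e)"

text \<open>Functionals on \<open>V\<close> are extended by 0 outside \<open>V\<close>.\<close>
definition dual_space :: "'l::complex_vector set \<Rightarrow> ('l \<Rightarrow> complex) set" where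
  "dual_space V = {f. (\<forall>v. v \<notin> V \<longrightarrow> f v = 0) \<and>
     (\<forall>u\<in>V. \<forall>v\<in>V. f (u + v) = f u + f v) \<and> (\<forall>z. \<forall>v\<in>V. f (z *\<^sub>C v) = z * f v)}"

text \<open>
  The tensor product of finite-dimensional spaces \<open>V\<close> and \<open>W\<close>, as the space of bilinear forms on
  \<open>V* \<times> W*\<close>.  If \<open>V\<close> and \<open>W\<close> are lines, every tensor is pure.
\<close>
type_synonym ('l, 'k) tensor = "('l \<Rightarrow> complex) \<Rightarrow> ('k \<Rightarrow> complex) \<Rightarrow> complex"

definition tensor ::
  "'l::complex_vector set \<Rightarrow> 'k::complex_vector set \<Rightarrow> 'l \<Rightarrow> 'k \<Rightarrow> ('l, 'k) tensor" where
  "tensor V W a b = (\<lambda>f g. if f \<in> dual_space V \<and> g \<in> dual_space W then f a * g b else 0)"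

definition tensor_line ::
  "'l::complex_vector set \<Rightarrow> 'k::complex_vector set \<Rightarrow> ('l, 'k) tensor set" where
  "tensor_line V W = {tensor V W a b | a b. a \<in> V \<and> b \<in> W}"

text \<open>
  The contraction \<open>(U \<otimes> V*) \<otimes> (V \<otimes> W*) \<rightarrow> U \<otimes> W*\<close>, \<open>(a \<otimes> f) \<otimes> (b \<otimes> g) \<mapsto> f(b) (a \<otimes> g)\<close>,
  for lines \<open>U\<close>, \<open>V\<close>, \<open>W\<close>.
\<close>
definition contraction ::
  "'u::complex_vector set \<Rightarrow> 'v::complex_vector set \<Rightarrow> 'w::complex_vector set \<Rightarrow>
   (('u, 'v \<Rightarrow> complex) tensor, ('v, 'w \<Rightarrow> complex) tensor) tensor \<Rightarrow> ('u, 'w \<Rightarrow> complex) tensor" where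
  "contraction U V W t = (THE r. \<exists>a\<in>U. \<exists>f\<in>dual_space V. \<exists>b\<in>V. \<exists>g\<in>dual_space W.
     t = tensor (tensor_line U (dual_space V)) (tensor_line V (dual_space W))
           (tensor U (dual_space V) a f) (tensor V (dual_space W) b g) \<and>
     r = f b *\<^sub>C tensor U (dual_space W) a g)"


section \<open>Line bundles\<close>

text \<open>
  The fibres are lines in a complex vector space \<^typ>\<open>'l\<close> (any family of lines embeds into its direct
  sum; fibres over different points may overlap).  The smooth structure is
  given by local trivialisations \<open>(x, z) \<mapsto> z e(x)\<close>, stored as local frames \<open>(U, e)\<close>.
\<close>
record ('m, 'l) line_bundle =
  fibre :: "'m \<Rightarrow> 'l set"
  frames :: "('m set \<times> ('m \<Rightarrow> 'l)) set"

definition is_line_bundle ::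
  "('m::topological_space, 'e::real_normed_vector) atlas \<Rightarrow> ('m, 'l::complex_vector) line_bundle \<Rightarrow> bool" where
  "is_line_bundle A L \<longleftrightarrow>
     (\<forall>x. complex_line (fibre L x)) \<and>
     \<Union> (fst ` frames L) = UNIV \<and>
     (\<forall>(U, e)\<in>frames L. open U \<and> (\<forall>x\<in>U. e x \<in> fibre L x \<and> e x \<noteq> 0)) \<and>
     (\<forall>(U, e)\<in>frames L. \<forall>(V, f)\<in>frames L. \<forall>x\<in>U \<inter> V. smooth_near A x (\<lambda>y. line_coord (e y) (f y)))"

definition dual_bundle ::
  "('m, 'l::complex_vector) line_bundle \<Rightarrow> ('m, 'l \<Rightarrow> complex) line_bundle" where
  "dual_bundle L =
     \<lparr>fibre = \<lambda>x. dual_space (fibre L x),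
      frames = {(U, \<lambda>x v. if v \<in> fibre L x then line_coord (e x) v else 0) | U e. (U, e) \<in> frames L}\<rparr>"

text \<open>The tensor product of the pullbacks of \<open>L\<close> and \<open>K\<close> to the product of their base manifolds.\<close>
definition ext_tensor ::
  "('m, 'l::complex_vector) line_bundle \<Rightarrow> ('n, 'k::complex_vector) line_bundle \<Rightarrow>
   ('m \<times> 'n, ('l, 'k) tensor) line_bundle" where
  "ext_tensor L K =
     \<lparr>fibre = \<lambda>(x, y). tensor_line (fibre L x) (fibre K y),
      frames = {(U \<times> V, \<lambda>(x, y). tensor (fibre L x) (fibre K y) (e x) (f y)) | U e V f.
        (U, e) \<in> frames L \<and> (V, f) \<in> frames K}\<rparr>"

definition Omega ::
  "('m::topological_space, 'e::real_normed_vector) atlas \<Rightarrow> ('m, 'l::complex_vector) line_bundle \<Rightarrow>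
   ('m, 'l) form set" where
  "Omega A L = {\<alpha>.
     (\<forall>x. alt_form (tangent A x) (\<alpha> x) \<and> (\<forall>vs. \<alpha> x vs \<in> fibre L x)) \<and>
     (\<forall>c\<in>A. \<forall>(U, e)\<in>frames L. \<forall>ws. \<forall>x\<in>fst c \<inter> U.
        smooth_near A x (\<lambda>y. line_coord (e y) (\<alpha> y (map (chart_vec A c y) ws))))}"

definition sections ::
  "('m::topological_space, 'e::real_normed_vector) atlas \<Rightarrow> ('m, 'l::complex_vector) line_bundle \<Rightarrow>
   ('m, 'l) form set" where
  "sections A L = {s \<in> Omega A L. of_degree 0 s}"

text \<open>Hermitian metrics are complex linear in the first argument.\<close>
definition hermitian_metric ::
  "('m::topological_space, 'e::real_normed_vector) atlas \<Rightarrow> ('m, 'l::complex_vector) line_bundle \<Rightarrow>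
   ('m \<Rightarrow> 'l \<Rightarrow> 'l \<Rightarrow> complex) \<Rightarrow> bool" where
  "hermitian_metric A L h \<longleftrightarrow>
     (\<forall>x. \<forall>u\<in>fibre L x. \<forall>v\<in>fibre L x.
        (\<forall>w\<in>fibre L x. h x (u + w) v = h x u v + h x w v) \<and>
        (\<forall>z. h x (z *\<^sub>C u) v = z * h x u v) \<and>
        h x v u = cnj (h x u v)) \<and>
     (\<forall>x. \<forall>u\<in>fibre L x. u \<noteq> 0 \<longrightarrow> Re (h x u u) > 0) \<and>
     (\<forall>(U, e)\<in>frames L. \<forall>x\<in>U. smooth_near A x (\<lambda>y. h y (e y) (e y)))"

definition connection ::
  "('m::topological_space, 'e::real_normed_vector) atlas \<Rightarrow> ('m, 'l::complex_vector) line_bundle \<Rightarrow>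
   (('m, 'l) form \<Rightarrow> ('m, 'l) form) \<Rightarrow> bool" where
  "connection A L D \<longleftrightarrow>
     (\<forall>s\<in>sections A L. D s \<in> Omega A L \<and> of_degree 1 (D s)) \<and>
     (\<forall>s\<in>sections A L. \<forall>t\<in>sections A L. D (s + t) = D s + D t) \<and>
     (\<forall>s\<in>sections A L. \<forall>z. D (z *\<^sub>C s) = z *\<^sub>C D s) \<and>
     (\<forall>f\<in>real_forms A. \<forall>s\<in>sections A L. of_degree 0 f \<longrightarrow>
        D (f \<and>\<^sub>R s) = ext_deriv A f \<and>\<^sub>R s + f \<and>\<^sub>R D s)"

definition unitary ::
  "('m::topological_space, 'e::real_normed_vector) atlas \<Rightarrow> ('m, 'l::complex_vector) line_bundle \<Rightarrow>
   ('m \<Rightarrow> 'l \<Rightarrow> 'l \<Rightarrow> complex) \<Rightarrow> (('m, 'l) form \<Rightarrow> ('m, 'l) form) \<Rightarrow> bool" where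
  "unitary A L h D \<longleftrightarrow>
     (\<forall>s\<in>sections A L. \<forall>t\<in>sections A L. \<forall>x. \<forall>v\<in>tangent A x.
        cderiv v (\<lambda>y. h y (s y []) (t y [])) = h x (D s x [v]) (t x []) + h x (s x []) (D t x [v]))"

text \<open>\<open>E\<close> is the operator on \<open>\<Omega>*(X, L)\<close> induced by the connection \<open>D\<close>.\<close>
definition induced_operator ::
  "('m::topological_space, 'e::real_normed_vector) atlas \<Rightarrow> ('m, 'l::complex_vector) line_bundle \<Rightarrow>
   (('m, 'l) form \<Rightarrow> ('m, 'l) form) \<Rightarrow> (('m, 'l) form \<Rightarrow> ('m, 'l) form) \<Rightarrow> bool" where
  "induced_operator A L D E \<longleftrightarrow>
     (\<forall>\<alpha>\<in>Omega A L. E \<alpha> \<in> Omega A L) \<and>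
     (\<forall>s\<in>sections A L. E s = D s) \<and>
     (\<forall>\<alpha>\<in>Omega A L. \<forall>\<beta>\<in>Omega A L. E (\<alpha> + \<beta>) = E \<alpha> + E \<beta>) \<and>
     (\<forall>p. \<forall>\<alpha>\<in>real_forms A. \<forall>s\<in>sections A L. of_degree p \<alpha> \<longrightarrow>
        E (\<alpha> \<and>\<^sub>R s) = ext_deriv A \<alpha> \<and>\<^sub>R s + (- 1) ^ p *\<^sub>R (\<alpha> \<and>\<^sub>R D s))"


section \<open>Prequantum systems\<close>

record ('m, 'e, 'l) prequantum =
  charts :: "('m, 'e) atlas"
  omega :: "('m, real) form"
  line :: "('m, 'l) line_bundle"
  herm :: "'m \<Rightarrow> 'l \<Rightarrow> 'l \<Rightarrow> complex"
  nabla :: "('m, 'l) form \<Rightarrow> ('m, 'l) form"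

definition prequantum_system :: "('m::t2_space, 'e::real_inner, 'l::complex_vector) prequantum \<Rightarrow> bool" where
  "prequantum_system X \<longleftrightarrow>
     compact (UNIV :: 'm set) \<and> connected (UNIV :: 'm set) \<and>
     smooth_atlas (charts X) \<and>
     symplectic (charts X) (omega X) \<and>
     is_line_bundle (charts X) (line X) \<and>
     hermitian_metric (charts X) (line X) (herm X) \<and>
     connection (charts X) (line X) (nabla X) \<and>
     unitary (charts X) (line X) (herm X) (nabla X) \<and>
     (\<exists>E. induced_operator (charts X) (line X) (nabla X) E \<and>
        (\<forall>\<alpha>\<in>Omega (charts X) (line X). E (E \<alpha>) = (- \<i>) *\<^sub>C (omega X \<and>\<^sub>R \<alpha>)))"

definition dual_metric ::
  "('m, 'l::complex_vector) line_bundle \<Rightarrow> ('m \<Rightarrow> 'l \<Rightarrow> 'l \<Rightarrow> complex) \<Rightarrow>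
   'm \<Rightarrow> ('l \<Rightarrow> complex) \<Rightarrow> ('l \<Rightarrow> complex) \<Rightarrow> complex" where
  "dual_metric L h x f g =
     (let e = (SOME e. e \<in> fibre L x \<and> e \<noteq> 0) in f e * cnj (g e) / h x e e)"

definition dual_connection ::
  "('m::topological_space, 'e::real_normed_vector) atlas \<Rightarrow> ('m, 'l::complex_vector) line_bundle \<Rightarrow>
   (('m, 'l) form \<Rightarrow> ('m, 'l) form) \<Rightarrow> (('m, 'l \<Rightarrow> complex) form \<Rightarrow> ('m, 'l \<Rightarrow> complex) form)" where
  "dual_connection A L D = (SOME D'. connection A (dual_bundle L) D' \<and>
     (\<forall>f\<in>sections A (dual_bundle L). \<forall>s\<in>sections A L. \<forall>x. \<forall>v\<in>tangent A x.
        cderiv v (\<lambda>y. f y [] (s y [])) = D' f x [v] (s x []) + f x [] (D s x [v])))"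

definition dual_system ::
  "('m::topological_space, 'e::real_normed_vector, 'l::complex_vector) prequantum \<Rightarrow>
   ('m, 'e, 'l \<Rightarrow> complex) prequantum" where
  "dual_system X =
     \<lparr>charts = charts X, omega = - omega X, line = dual_bundle (line X),
      herm = dual_metric (line X) (herm X),
      nabla = dual_connection (charts X) (line X) (nabla X)\<rparr>"

definition tensor_metric ::
  "('m, 'l::complex_vector) line_bundle \<Rightarrow> ('m \<Rightarrow> 'l \<Rightarrow> 'l \<Rightarrow> complex) \<Rightarrow>
   ('n, 'k::complex_vector) line_bundle \<Rightarrow> ('n \<Rightarrow> 'k \<Rightarrow> 'k \<Rightarrow> complex) \<Rightarrow>
   'm \<times> 'n \<Rightarrow> ('l, 'k) tensor \<Rightarrow> ('l, 'k) tensor \<Rightarrow> complex" where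
  "tensor_metric L h K h' = (\<lambda>(x, y) t t'. THE r.
     \<exists>a\<in>fibre L x. \<exists>b\<in>fibre K y. \<exists>a'\<in>fibre L x. \<exists>b'\<in>fibre K y.
       t = tensor (fibre L x) (fibre K y) a b \<and> t' = tensor (fibre L x) (fibre K y) a' b' \<and>
       r = h x a a' * h' y b b')"

text \<open>The exterior product of the pullbacks of \<open>\<alpha>\<close> and \<open>\<beta>\<close> to the product manifold.\<close>
definition ext_product ::
  "('m::topological_space, 'e::real_normed_vector) atlas \<Rightarrow> ('m, 'l::complex_vector) line_bundle \<Rightarrow>
   ('n::topological_space, 'f::real_normed_vector) atlas \<Rightarrow> ('n, 'k::complex_vector) line_bundle \<Rightarrow>
   ('m, 'l) form \<Rightarrow> ('n, 'k) form \<Rightarrow> ('m \<times> 'n, ('l, 'k) tensor) form" where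
  "ext_product A L B K \<alpha> \<beta> = wedge (\<lambda>(x, y). tensor (fibre L x) (fibre K y))
     (pullback (prod_atlas A B) A fst \<alpha>) (pullback (prod_atlas A B) B snd \<beta>)"

definition tensor_connection ::
  "('m::topological_space, 'e::real_normed_vector) atlas \<Rightarrow> ('m, 'l::complex_vector) line_bundle \<Rightarrow>
   (('m, 'l) form \<Rightarrow> ('m, 'l) form) \<Rightarrow>
   ('n::topological_space, 'f::real_normed_vector) atlas \<Rightarrow> ('n, 'k::complex_vector) line_bundle \<Rightarrow>
   (('n, 'k) form \<Rightarrow> ('n, 'k) form) \<Rightarrow>
   (('m \<times> 'n, ('l, 'k) tensor) form \<Rightarrow> ('m \<times> 'n, ('l, 'k) tensor) form)" where
  "tensor_connection A L D B K D' = (SOME E. connection (prod_atlas A B) (ext_tensor L K) E \<and>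
     (\<forall>s\<in>sections A L. \<forall>t\<in>sections B K.
        E (ext_product A L B K s t) = ext_product A L B K (D s) t + ext_product A L B K s (D' t)))"

definition prod_system ::
  "('m::topological_space, 'e::real_normed_vector, 'l::complex_vector) prequantum \<Rightarrow>
   ('n::topological_space, 'f::real_normed_vector, 'k::complex_vector) prequantum \<Rightarrow>
   ('m \<times> 'n, 'e \<times> 'f, ('l, 'k) tensor) prequantum" where
  "prod_system X Y =
     \<lparr>charts = prod_atlas (charts X) (charts Y),
      omega = pullback (prod_atlas (charts X) (charts Y)) (charts X) fst (omega X)
            + pullback (prod_atlas (charts X) (charts Y)) (charts Y) snd (omega Y),
      line = ext_tensor (line X) (line Y),
      herm = tensor_metric (line X) (herm X) (line Y) (herm Y),
      nabla = tensor_connection (charts X) (line X) (nabla X) (charts Y) (line Y) (nabla Y)\<rparr>"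

definition Gamma_forms ::
  "('m::topological_space, 'e::real_normed_vector, 'l::complex_vector) prequantum \<Rightarrow> ('m, 'l) form set" where
  "Gamma_forms X = {\<alpha> \<in> Omega (charts X) (line X). omega X \<and>\<^sub>R \<alpha> = 0}"


section \<open>Integration and composition\<close>

text \<open>
  A partition of unity subordinate to finitely many charts.  Continuity of the functions suffices for
  integration.
\<close>
definition partition_of_unity ::
  "('m::topological_space, 'e) atlas \<Rightarrow> (('m, 'e) chart \<times> ('m \<Rightarrow> real)) list \<Rightarrow> bool" where
  "partition_of_unity A P \<longleftrightarrow>
     (\<forall>(c, \<rho>)\<in>set P. c \<in> A \<and> continuous_on UNIV \<rho> \<and> (\<forall>x. 0 \<le> \<rho> x) \<and> closure {x. \<rho> x \<noteq> 0} \<subseteq> fst c) \<and>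
     (\<forall>x. (\<Sum>(c, \<rho>)\<leftarrow>P. \<rho> x) = 1)"

definition model_basis :: "'e::real_inner list" where
  "model_basis = (SOME bs. (\<forall>i<length bs. \<forall>j<length bs. bs ! i \<bullet> bs ! j = (if i = j then 1 else 0)) \<and>
     span (set bs) = UNIV)"

text \<open>
  The integral of the top-degree component of \<open>\<mu>\<close> for the symplectic orientation.  The charts need
  not be oriented; instead the integrand is corrected by the sign of the Liouville form, the top
  exterior power of \<open>\<omega>\<close>, on the coordinate basis.
\<close>
definition symplectic_integral ::
  "('m::topological_space, 'e::real_inner) atlas \<Rightarrow> ('m, real) form \<Rightarrow> ('m, complex) form \<Rightarrow> complex" where
  "symplectic_integral A \<omega> \<mu> =
     (let bs = (model_basis :: 'e list); d = length bs; P = (SOME P. partition_of_unity A P) in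
      \<Sum>(c, \<rho>)\<leftarrow>P. \<integral>u.
        (let y = (\<Sum>i<d. u i *\<^sub>R bs ! i); x = chart_inv c y; vs = map (chart_vec A c x) bs in
         if y \<in> snd c ` fst c
         then (\<rho> x * sgn (wedge_power \<omega> (d div 2) x vs)) *\<^sub>R \<mu> x vs
         else 0) \<partial>(\<Pi>\<^sub>M i\<in>{..<d}. (lborel :: real measure)))"

text \<open>
  Integration along the fibres \<open>N\<close> of \<open>M \<times> N \<times> P \<rightarrow> M \<times> P\<close>, of forms with values in the pullback of
  the line bundle \<open>K\<close>.  The arguments along \<open>N\<close> are put first; as \<open>N\<close> has even dimension,
  putting them last would give the same result.
\<close>
definition fibre_integral ::
  "('m::topological_space, 'e::real_inner) atlas \<Rightarrow> ('n::topological_space, 'f::real_inner) atlas \<Rightarrow>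
   ('n, real) form \<Rightarrow> ('p::topological_space, 'g::real_inner) atlas \<Rightarrow>
   ('m \<times> 'p, 'l::complex_vector) line_bundle \<Rightarrow> ('m \<times> 'n \<times> 'p, 'l) form \<Rightarrow> ('m \<times> 'p, 'l) form" where
  "fibre_integral A B \<omega> C K \<beta> = (\<lambda>(x, z) ws.
     if set ws \<subseteq> tangent (prod_atlas A C) (x, z) then
       (let e = (SOME e. e \<in> fibre K (x, z) \<and> e \<noteq> 0);
            ABC = prod_atlas A (prod_atlas B C)
        in symplectic_integral B \<omega> (\<lambda>y vs. line_coord e (\<beta> (x, y, z)
             (map (pushforward ABC (\<lambda>y'. (x, y', z)) y) vs @
              map (pushforward ABC (\<lambda>(x', z'). (x', y, z')) (x, z)) ws))) *\<^sub>C e)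
     else 0)"

definition composition ::
  "('m::topological_space, 'e::real_inner, 'l::complex_vector) prequantum \<Rightarrow>
   ('n::topological_space, 'f::real_inner, 'k::complex_vector) prequantum \<Rightarrow>
   ('p::topological_space, 'g::real_inner, 'j::complex_vector) prequantum \<Rightarrow>
   ('m \<times> 'n, ('l, 'k \<Rightarrow> complex) tensor) form \<Rightarrow> ('n \<times> 'p, ('k, 'j \<Rightarrow> complex) tensor) form \<Rightarrow>
   ('m \<times> 'p, ('l, 'j \<Rightarrow> complex) tensor) form" where
  "composition M N P \<xi> \<eta> =
     (let MN = prod_system M (dual_system N); NP = prod_system N (dual_system P);
          MP = prod_system M (dual_system P);
          MNP = prod_atlas (charts M) (prod_atlas (charts N) (charts P));
          \<zeta> = wedge (\<lambda>(x, y, z). tensor (fibre (line MN) (x, y)) (fibre (line NP) (y, z)))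
                (pullback MNP (charts MN) (\<lambda>(x, y, z). (x, y)) \<xi>)
                (pullback MNP (charts NP) (\<lambda>(x, y, z). (y, z)) \<eta>)
      in fibre_integral (charts M) (charts N) (omega N) (charts P) (line MP)
           (\<lambda>(x, y, z) vs. contraction (fibre (line M) x) (fibre (line N) y) (fibre (line P) z)
              (\<zeta> (x, y, z) vs)))"

end

theory Submission
  imports Defs
begin

text \<open>
  Write \<open>\<zeta>\<close> for the contraction of \<open>i\<^sup>*\<sigma> \<and> j\<^sup>*\<tau>\<close> on \<open>M \<times> N \<times> P\<close>.  Since 2-forms are central,
  \<open>(\<omega>\<^sub>M - \<omega>\<^sub>P) \<and> i\<^sup>*\<sigma> \<and> j\<^sup>*\<tau> = i\<^sup>*((\<omega>\<^sub>M - \<omega>\<^sub>N) \<and> \<sigma>) \<and> j\<^sup>*\<tau> + i\<^sup>*\<sigma> \<and> j\<^sup>*((\<omega>\<^sub>N - \<omega>\<^sub>P) \<and> \<tau>) = 0\<close>,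
  and the projection formula \<open>(\<omega>\<^sub>M - \<omega>\<^sub>P) \<and> k\<^sub>*\<zeta> = k\<^sub>*((\<omega>\<^sub>M - \<omega>\<^sub>P) \<and> \<zeta>)\<close> holds because
  \<open>\<omega>\<^sub>M - \<omega>\<^sub>P\<close> vanishes on vectors tangent to \<open>N\<close> and has even degree.  That \<open>k\<^sub>*\<zeta>\<close> is a smooth form
  follows by differentiation under the integral sign: the sign of the Liouville form that
  orients \<open>N\<close> does not depend on the parameters, so it only needs to be measurable and bounded.
\<close>


text \<open>Forms are inhomogeneous functions on lists of derivations, with values in lines that
  vary with the point, and integration involves arbitrary choices (a vector in each fibre, a
  partition of unity). All arguments therefore pass to coefficients: a chart and nonzero vectors in
  the fibres turn a form at a point into a complex function on lists of model vectors, where the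
  exterior product is an associative product and parity replaces degree. The obstacle is the bundle
  over N: the integral runs over whole charts of N, and a chart domain need not carry a frame of the
  bundle. Contraction resolves this. A basis of the fibre over a point of N enters one factor
  directly and the other through its dual, so it cancels, and the coefficient of the integrand is
  defined without it. Smoothness and the kernel identity may then be checked with a different frame
  near each point of N. The integral itself enters only as a finite sum of weighted integrals with
  compact supports inside charts. Its weights do not depend on the integrand, so the kernel identity
  has to be checked only pointwise under the integral.\<close>

section \<open>Shuffle products\<close>

text \<open>
  The first argument goes either to the left factor or to the right one; in the second case it is
  moved past all arguments of the left factor.  This recursive form of the shuffle formula makes
  the algebra of exterior products accessible to induction on the list of arguments.
\<close>
primrec shuffle_sum :: "'a list \<Rightarrow> ('a list \<Rightarrow> 'a list \<Rightarrow> 'v::real_vector) \<Rightarrow> 'v" where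
  "shuffle_sum [] f = f [] []"
| "shuffle_sum (v # vs) f = shuffle_sum vs (\<lambda>a b. f (v # a) b)
     + shuffle_sum vs (\<lambda>a b. (- 1) ^ length a *\<^sub>R f a (v # b))"

text \<open>Index 0 joins the left part and all other indices shift by one. Being the smallest, 0
  stands behind no index of the right part and creates no inversion.\<close>

lemma shuffle_inversions_insert:
  assumes "S \<subseteq> {..<n}"
  shows "shuffle_inversions (Suc n) (insert 0 (Suc ` S)) = shuffle_inversions n S"
proof -
  have "{(i, j). i \<in> insert 0 (Suc ` S) \<and> j \<in> {..<Suc n} - insert 0 (Suc ` S) \<and> j < i}
      = map_prod Suc Suc ` {(i, j). i \<in> S \<and> j \<in> {..<n} - S \<and> j < i}"
    by (auto simp: image_iff less_Suc_eq_0_disj)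
  moreover have "inj_on (map_prod Suc Suc) X" for X
    by (auto simp: inj_on_def)
  ultimately show ?thesis
    unfolding shuffle_inversions_def by (simp add: card_image)
qed

text \<open>Here index 0 belongs to the right part and precedes all of S, so it adds one inversion
  per element of S. This is the sign \<open>(- 1) ^ length a\<close> of the recursion.\<close>

lemma shuffle_inversions_Suc:
  assumes "S \<subseteq> {..<n}"
  shows "shuffle_inversions (Suc n) (Suc ` S) = card S + shuffle_inversions n S"
proof -
  let ?X = "{(i, j). i \<in> S \<and> j \<in> {..<n} - S \<and> j < i}"
  have fin: "finite S"
    using assms finite_subset by auto
  have "?X \<subseteq> S \<times> {..<n}" by auto
  then have finX: "finite ?X"
    using fin by (meson finite_SigmaI finite_lessThan finite_subset)
  have "{(i, j). i \<in> Suc ` S \<and> j \<in> {..<Suc n} - Suc ` S \<and> j < i}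
      = (\<lambda>i. (Suc i, 0)) ` S \<union> map_prod Suc Suc ` ?X"
    by (auto simp: image_iff less_Suc_eq_0_disj)
  moreover have "card ((\<lambda>i. (Suc i, 0)) ` S \<union> map_prod Suc Suc ` ?X)
      = card ((\<lambda>i. (Suc i, 0::nat)) ` S) + card (map_prod Suc Suc ` ?X)"
    using fin finX by (intro card_Un_disjoint) auto
  moreover have "card ((\<lambda>i. (Suc i, 0::nat)) ` S) = card S"
    by (rule card_image) (auto simp: inj_on_def)
  moreover have "card (map_prod Suc Suc ` ?X) = card ?X"
    by (rule card_image) (auto simp: inj_on_def)
  ultimately show ?thesis
    unfolding shuffle_inversions_def by simp
qed

lemma Pow_lessThan_Suc:
  "Pow {..<Suc n} = (\<lambda>S. insert 0 (Suc ` S)) ` Pow {..<n} \<union> (`) Suc ` Pow {..<n}"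
proof (intro set_eqI iffI)
  fix S assume S: "S \<in> Pow {..<Suc n}"
  define T where "T = {j. Suc j \<in> S}"
  have T: "T \<in> Pow {..<n}" using S by (auto simp: T_def)
  show "S \<in> (\<lambda>S. insert 0 (Suc ` S)) ` Pow {..<n} \<union> (`) Suc ` Pow {..<n}"
  proof (cases "0 \<in> S")
    case True
    then have "S = insert 0 (Suc ` T)"
      by (auto simp: T_def image_iff) (metis not0_implies_Suc)
    then show ?thesis using T by blast
  next
    case False
    then have "S = Suc ` T"
      by (auto simp: T_def image_iff) (metis not0_implies_Suc)
    then show ?thesis using T by blast
  qed
next
  fix S assume "S \<in> (\<lambda>S. insert 0 (Suc ` S)) ` Pow {..<n} \<union> (`) Suc ` Pow {..<n}"
  then show "S \<in> Pow {..<Suc n}" by fastforce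
qed

lemma shuffle_sum_eq:
  "shuffle_sum vs f = (\<Sum>S\<in>Pow {..<length vs}.
     (- 1) ^ shuffle_inversions (length vs) S *\<^sub>R f (nths vs S) (nths vs (- S)))"
proof (induction vs arbitrary: f)
  case Nil
  then show ?case by (simp add: shuffle_inversions_def)
next
  case (Cons v vs)
  let ?n = "length vs"
  let ?t = "\<lambda>S. (- 1) ^ shuffle_inversions (Suc ?n) S *\<^sub>R f (nths (v # vs) S) (nths (v # vs) (- S))"
  have "sum ?t (Pow {..<Suc ?n}) = sum ?t ((\<lambda>S. insert 0 (Suc ` S)) ` Pow {..<?n})
      + sum ?t ((`) Suc ` Pow {..<?n})"
    unfolding Pow_lessThan_Suc by (rule sum.union_disjoint) auto
  also have "sum ?t ((\<lambda>S. insert 0 (Suc ` S)) ` Pow {..<?n})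
      = (\<Sum>S\<in>Pow {..<?n}. ?t (insert 0 (Suc ` S)))"
    by (rule sum.reindex[unfolded o_def]) (auto simp: inj_on_def)
  also have "\<dots> = shuffle_sum vs (\<lambda>a b. f (v # a) b)"
    unfolding Cons.IH
  proof (intro sum.cong refl, goal_cases)
    case (1 S)
    have "{j. Suc j \<in> insert 0 (Suc ` S)} = S" "{j. Suc j \<in> - insert 0 (Suc ` S)} = - S" by auto
    then show ?case using 1 by (simp add: nths_Cons shuffle_inversions_insert)
  qed
  also have "sum ?t ((`) Suc ` Pow {..<?n}) = (\<Sum>S\<in>Pow {..<?n}. ?t (Suc ` S))"
    by (rule sum.reindex[unfolded o_def]) (auto simp: inj_on_def inj_image_eq_iff)
  also have "\<dots> = shuffle_sum vs (\<lambda>a b. (- 1) ^ length a *\<^sub>R f a (v # b))"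
    unfolding Cons.IH
  proof (intro sum.cong refl, goal_cases)
    case (1 S)
    have "{j. Suc j \<in> Suc ` S} = S" "{j. Suc j \<in> - Suc ` S} = - S" by auto
    moreover have "{i. i < ?n \<and> i \<in> S} = S" using 1 by auto
    ultimately show ?case using 1
      by (simp add: nths_Cons shuffle_inversions_Suc length_nths power_add mult.commute)
  qed
  finally show ?case by simp
qed

lemma wedge_eq_shuffle_sum: "wedge m \<alpha> \<beta> x vs = shuffle_sum vs (\<lambda>a b. m x (\<alpha> x a) (\<beta> x b))"
  unfolding wedge_def shuffle_sum_eq ..

text \<open>The condition on sets serves argument lists with a non-tangent entry: in every shuffle
  that entry lands in one of the two parts.\<close>

lemma shuffle_sum_cong:
  assumes "\<And>a b. set a \<union> set b = set vs \<Longrightarrow> f a b = g a b"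
  shows "shuffle_sum vs f = shuffle_sum vs g"
  using assms
proof (induction vs arbitrary: f g)
  case (Cons v vs)
  have "shuffle_sum vs (\<lambda>a b. f (v # a) b) = shuffle_sum vs (\<lambda>a b. g (v # a) b)"
    by (rule Cons.IH) (rule Cons.prems, auto)
  moreover have "shuffle_sum vs (\<lambda>a b. (- 1) ^ length a *\<^sub>R f a (v # b))
      = shuffle_sum vs (\<lambda>a b. (- 1) ^ length a *\<^sub>R g a (v # b))"
    by (rule Cons.IH, rule arg_cong[where f = "scaleR _"], rule Cons.prems) auto
  ultimately show ?case by simp
qed auto

lemma shuffle_sum_zero: "shuffle_sum vs (\<lambda>a b. 0) = 0"
  by (induction vs) auto

lemma linear_shuffle_sum:
  assumes "linear T"
  shows "T (shuffle_sum vs f) = shuffle_sum vs (\<lambda>a b. T (f a b))"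
  by (induction vs arbitrary: f) (simp_all add: linear_add[OF assms] linear_scale[OF assms])

lemma shuffle_sum_add: "shuffle_sum vs (\<lambda>a b. f a b + g a b) = shuffle_sum vs f + shuffle_sum vs g"
  by (induction vs arbitrary: f g) (simp_all add: scaleR_add_right)

lemma shuffle_sum_map: "shuffle_sum (map F vs) f = shuffle_sum vs (\<lambda>a b. f (map F a) (map F b))"
  by (induction vs arbitrary: f) auto

section \<open>The complex shuffle algebra and its parity\<close>

definition shuffle_prod :: "('a list \<Rightarrow> complex) \<Rightarrow> ('a list \<Rightarrow> complex) \<Rightarrow> 'a list \<Rightarrow> complex"
  where "shuffle_prod a b vs = shuffle_sum vs (\<lambda>l r. a l * b r)"

text \<open>The parity involution. Forms are not homogeneous, so evenness and oddness are expressed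
  as \<open>grade a = a\<close> and \<open>grade a = - a\<close> instead of by a degree.\<close>

definition grade :: "('a list \<Rightarrow> complex) \<Rightarrow> 'a list \<Rightarrow> complex"
  where "grade a vs = (- 1) ^ length vs * a vs"

lemma grade_grade [simp]: "grade (grade a) = a"
  by (rule ext) (simp add: grade_def flip: mult.assoc power_add mult_2)

lemma grade_Cons: "(\<lambda>l. grade a (v # l)) = - grade (\<lambda>l. a (v # l))"
  by (rule ext) (simp add: grade_def)

lemma scaleR_minus_one_power: "(- 1) ^ n *\<^sub>R (z::complex) = (- 1) ^ n * z"
  by (simp add: scaleR_conv_of_real)

lemma shuffle_prod_Nil [simp]: "shuffle_prod a b [] = a [] * b []"
  by (simp add: shuffle_prod_def)

text \<open>With \<open>\<lambda>l. a (v # l)\<close> as the interior product with v, this is the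
  antiderivation rule; \<open>grade a\<close> carries the sign of moving v past the left factor. The
  inductions on argument lists of \<open>shuffle_prod\<close> rest on it.\<close>

lemma shuffle_prod_Cons:
  "shuffle_prod a b (v # vs) = shuffle_prod (\<lambda>l. a (v # l)) b vs + shuffle_prod (grade a) (\<lambda>l. b (v # l)) vs"
  by (simp add: shuffle_prod_def grade_def scaleR_minus_one_power mult.assoc)

lemma shuffle_prod_add_left: "shuffle_prod (a + a') b vs = shuffle_prod a b vs + shuffle_prod a' b vs"
  by (simp add: shuffle_prod_def distrib_right shuffle_sum_add)

lemma shuffle_prod_add_right: "shuffle_prod a (b + b') vs = shuffle_prod a b vs + shuffle_prod a b' vs"
  by (simp add: shuffle_prod_def distrib_left shuffle_sum_add)

lemma linear_mult_complex: "linear ((*) (z::complex))"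
  by (rule linearI) (simp_all add: distrib_left)

lemma shuffle_prod_mult_left: "shuffle_prod (\<lambda>l. z * a l) b vs = z * shuffle_prod a b vs"
  by (simp add: shuffle_prod_def linear_shuffle_sum[OF linear_mult_complex] mult.assoc)

lemma shuffle_prod_mult_right: "shuffle_prod a (\<lambda>l. z * b l) vs = z * shuffle_prod a b vs"
  by (simp add: shuffle_prod_def linear_shuffle_sum[OF linear_mult_complex] mult.left_commute)

lemma shuffle_prod_uminus_left: "shuffle_prod (- a) b vs = - shuffle_prod a b vs"
  using shuffle_prod_mult_left[of "-1" a b vs] by (simp add: fun_Compl_def)

lemma shuffle_prod_uminus_right: "shuffle_prod a (- b) vs = - shuffle_prod a b vs"
  using shuffle_prod_mult_right[of a "-1" b vs] by (simp add: fun_Compl_def)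

lemma shuffle_prod_zero_left: "shuffle_prod (\<lambda>l. 0) b vs = 0"
  by (simp add: shuffle_prod_def shuffle_sum_zero)

lemma shuffle_prod_zero_right: "shuffle_prod a (\<lambda>l. 0) vs = 0"
  by (simp add: shuffle_prod_def shuffle_sum_zero)

lemma shuffle_prod_map:
  "shuffle_prod a b (map F vs) = shuffle_prod (\<lambda>l. a (map F l)) (\<lambda>l. b (map F l)) vs"
  by (simp add: shuffle_prod_def shuffle_sum_map)

lemma grade_shuffle_prod: "grade (shuffle_prod a b) = shuffle_prod (grade a) (grade b)"
proof
  fix vs
  show "grade (shuffle_prod a b) vs = shuffle_prod (grade a) (grade b) vs"
  proof (induction vs arbitrary: a b)
    case (Cons v vs)
    have "grade (shuffle_prod a b) (v # vs) = - grade (shuffle_prod (\<lambda>l. a (v # l)) b) vs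
        - grade (shuffle_prod (grade a) (\<lambda>l. b (v # l))) vs"
      by (simp add: grade_def shuffle_prod_Cons algebra_simps)
    also have "\<dots> = shuffle_prod (grade a) (grade b) (v # vs)"
      by (simp add: Cons.IH shuffle_prod_Cons grade_Cons shuffle_prod_uminus_left
          shuffle_prod_uminus_right)
    finally show ?case .
  qed (simp add: grade_def)
qed

lemma shuffle_prod_Cons_fun:
  "(\<lambda>l. shuffle_prod a b (v # l))
     = shuffle_prod (\<lambda>l. a (v # l)) b + shuffle_prod (grade a) (\<lambda>l. b (v # l))"
  by (rule ext) (simp add: shuffle_prod_Cons)

text \<open>By the antiderivation rule both sides become the same three terms, with v inserted into
  a, b or c. The signs agree because \<open>grade\<close> is multiplicative.\<close>

lemma shuffle_prod_assoc:
  "shuffle_prod (shuffle_prod a b) c vs = shuffle_prod a (shuffle_prod b c) vs"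
proof (induction vs arbitrary: a b c)
  case (Cons v vs)
  have "shuffle_prod (shuffle_prod a b) c (v # vs)
      = shuffle_prod (shuffle_prod (\<lambda>l. a (v # l)) b + shuffle_prod (grade a) (\<lambda>l. b (v # l))) c vs
        + shuffle_prod (shuffle_prod (grade a) (grade b)) (\<lambda>l. c (v # l)) vs"
    unfolding shuffle_prod_Cons[of "shuffle_prod a b"] shuffle_prod_Cons_fun grade_shuffle_prod ..
  moreover have "shuffle_prod a (shuffle_prod b c) (v # vs)
      = shuffle_prod (\<lambda>l. a (v # l)) (shuffle_prod b c) vs
        + shuffle_prod (grade a) (shuffle_prod (\<lambda>l. b (v # l)) c + shuffle_prod (grade b) (\<lambda>l. c (v # l))) vs"
    unfolding shuffle_prod_Cons[of a] shuffle_prod_Cons_fun ..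
  ultimately show ?case
    by (simp only: shuffle_prod_add_left shuffle_prod_add_right Cons.IH add.assoc)
qed simp

text \<open>Inserting a vector changes the parity, so the even and the odd case need each other.\<close>
lemma shuffle_prod_commute_aux:
  "(grade a = a \<longrightarrow> shuffle_prod a b vs = shuffle_prod b a vs) \<and>
   (grade a = - a \<longrightarrow> shuffle_prod a b vs = shuffle_prod (grade b) a vs)"
proof (induction vs arbitrary: a b)
  case Nil
  then show ?case by (simp add: grade_def)
next
  case (Cons v vs)
  let ?a = "\<lambda>l. a (v # l)" and ?b = "\<lambda>l. b (v # l)"
  show ?case
  proof (intro conjI impI)
    assume a: "grade a = a"
    then have "grade ?a = - ?a"
      using grade_Cons[of a v] by (metis minus_minus)
    then have "shuffle_prod ?a b vs = shuffle_prod (grade b) ?a vs"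
      using Cons.IH by blast
    moreover have "shuffle_prod a ?b vs = shuffle_prod ?b a vs"
      using Cons.IH a by blast
    ultimately show "shuffle_prod a b (v # vs) = shuffle_prod b a (v # vs)"
      by (simp only: shuffle_prod_Cons a add.commute)
  next
    assume a: "grade a = - a"
    have "- ?a = - grade ?a"
      using grade_Cons[of a v] unfolding a by (simp add: fun_Compl_def)
    then have "grade ?a = ?a"
      by (metis minus_minus)
    then have "shuffle_prod ?a b vs = shuffle_prod b ?a vs"
      using Cons.IH by blast
    moreover have "shuffle_prod a ?b vs = shuffle_prod (grade ?b) a vs"
      using Cons.IH a by blast
    ultimately show "shuffle_prod a b (v # vs) = shuffle_prod (grade b) a (v # vs)"
      by (simp add: shuffle_prod_Cons grade_Cons a shuffle_prod_uminus_left)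
  qed
qed

lemma shuffle_prod_commute: "grade a = a \<Longrightarrow> shuffle_prod a b = shuffle_prod b a"
  using shuffle_prod_commute_aux by blast

section \<open>Multilinear and alternating functions on lists\<close>

definition multilinear_form :: "('a::real_vector list \<Rightarrow> complex) \<Rightarrow> bool" where
  "multilinear_form a \<longleftrightarrow> (\<forall>l r. linear (\<lambda>v. a (l @ v # r)))"

text \<open>Vanishing is demanded only for adjacent equal arguments, since this is what peeling off
  list heads can verify; \<open>alternating_not_distinct\<close> recovers the usual
  condition.\<close>

definition alternating :: "('a::real_vector list \<Rightarrow> complex) \<Rightarrow> bool" where
  "alternating a \<longleftrightarrow> multilinear_form a \<and> (\<forall>l v r. a (l @ v # v # r) = 0)"

lemma multilinear_form_Cons: "multilinear_form a \<Longrightarrow> multilinear_form (\<lambda>l. a (v # l))"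
  unfolding multilinear_form_def
proof (intro allI)
  fix l r assume "\<forall>l r. linear (\<lambda>v. a (l @ v # r))"
  from this[THEN spec, of "v # l"] show "linear (\<lambda>w. a (v # l @ w # r))" by simp
qed

lemma linear_mult_fun: "linear f \<Longrightarrow> linear (\<lambda>x. (z::complex) * f x)"
  using linear_compose[OF _ linear_mult_complex, of f z] by (simp add: o_def)

lemma multilinear_form_grade: "multilinear_form a \<Longrightarrow> multilinear_form (grade a)"
  unfolding multilinear_form_def grade_def length_append list.size
  by (intro allI linear_mult_fun) blast

text \<open>The arguments before the varying slot are absorbed into the factors one by one, until
  the varying vector is itself the head; there the antiderivation rule is visibly linear in
  it.\<close>

lemma multilinear_form_shuffle_prod:
  assumes "multilinear_form a" "multilinear_form b"
  shows "multilinear_form (shuffle_prod a b)"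
proof -
  have "linear (\<lambda>v. shuffle_prod a b (l @ v # r))" for l r
    using assms
  proof (induction l arbitrary: a b)
    case Nil
    have a: "linear (\<lambda>v. a (v # l))" and b: "linear (\<lambda>v. b (v # l))" for l
      using Nil[unfolded multilinear_form_def, THEN spec, of "[]"] by simp_all
    have a1: "(\<lambda>l. a ((u + v) # l)) = (\<lambda>l. a (u # l)) + (\<lambda>l. a (v # l))" for u v
      by (rule ext) (simp add: linear_add[OF a])
    have b1: "(\<lambda>l. b ((u + v) # l)) = (\<lambda>l. b (u # l)) + (\<lambda>l. b (v # l))" for u v
      by (rule ext) (simp add: linear_add[OF b])
    have a2: "(\<lambda>l. a ((c *\<^sub>R v) # l)) = (\<lambda>l. complex_of_real c * a (v # l))" for c v
      by (rule ext) (simp add: linear_scale[OF a] scaleR_conv_of_real)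
    have b2: "(\<lambda>l. b ((c *\<^sub>R v) # l)) = (\<lambda>l. complex_of_real c * b (v # l))" for c v
      by (rule ext) (simp add: linear_scale[OF b] scaleR_conv_of_real)
    show ?case
      unfolding append_Nil shuffle_prod_Cons
      by (rule linearI)
        (simp_all only: a1 b1 a2 b2 shuffle_prod_add_left shuffle_prod_add_right
          shuffle_prod_mult_left shuffle_prod_mult_right scaleR_conv_of_real distrib_left ac_simps)
  next
    case (Cons w l)
    then show ?case
      by (auto simp: shuffle_prod_Cons
          intro!: linear_compose_add Cons.IH multilinear_form_Cons multilinear_form_grade)
  qed
  then show ?thesis by (simp add: multilinear_form_def)
qed

lemma alternating_Cons: "alternating a \<Longrightarrow> alternating (\<lambda>l. a (v # l))"
  unfolding alternating_def
proof (intro conjI allI, goal_cases)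
  case (2 l w r)
  from 2[THEN conjunct2, THEN spec, of "v # l"] show ?case by simp
qed (blast intro: multilinear_form_Cons)

lemma alternating_grade: "alternating a \<Longrightarrow> alternating (grade a)"
  unfolding alternating_def by (simp add: multilinear_form_grade) (simp add: grade_def)

text \<open>In the base case v is inserted twice. The terms with both copies in one factor vanish,
  and the two mixed terms cancel because inserting a vector anticommutes with
  \<open>grade\<close>.\<close>

lemma alternating_shuffle_prod:
  assumes "alternating a" "alternating b"
  shows "alternating (shuffle_prod a b)"
proof -
  have "shuffle_prod a b (l @ v # v # r) = 0" for l v r
    using assms
  proof (induction l arbitrary: a b)
    case Nil
    have "(\<lambda>l. a (v # v # l)) = (\<lambda>l. 0)" "(\<lambda>l. b (v # v # l)) = (\<lambda>l. 0)"
      using Nil[unfolded alternating_def, THEN conjunct2, THEN spec, of "[]"] by simp_all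
    then show ?case
      by (simp add: shuffle_prod_Cons grade_Cons shuffle_prod_zero_left shuffle_prod_zero_right
          shuffle_prod_uminus_left)
  next
    case (Cons w l)
    then show ?case
      by (simp add: shuffle_prod_Cons alternating_Cons alternating_grade)
  qed
  then show ?thesis
    using assms multilinear_form_shuffle_prod by (auto simp: alternating_def)
qed

text \<open>Polarisation: expand the vanishing value at the repeated argument
  \<open>u + v\<close>.\<close>

lemma alternating_swap:
  assumes "alternating a"
  shows "a (l @ u # v # r) = - a (l @ v # u # r)"
proof -
  have lin1: "linear (\<lambda>w. a (l @ w # t))" for t
    using assms by (simp add: alternating_def multilinear_form_def)
  have lin2: "linear (\<lambda>w. a (l @ t # w # r))" for t
    using assms[unfolded alternating_def multilinear_form_def, THEN conjunct1, THEN spec, of "l @ [t]"]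
    by simp
  have z: "a (l @ w # w # r) = 0" for w
    using assms by (simp add: alternating_def)
  have "a (l @ u # v # r) + a (l @ v # u # r) = 0"
    using z[of "u + v"] z[of u] z[of v] by (simp only: linear_add[OF lin1] linear_add[OF lin2]) (simp add: add.commute)
  then show ?thesis
    by (simp add: eq_neg_iff_add_eq_0)
qed

text \<open>The first copy of the repeated vector is swapped to the right until it meets the second
  one; only the sign changes on the way.\<close>

lemma alternating_not_distinct:
  assumes "alternating a" "\<not> distinct vs"
  shows "a vs = 0"
proof -
  have *: "a (l @ v # m @ v # r) = 0" for l v m r
  proof (induction m arbitrary: l)
    case Nil
    then show ?case using assms(1) by (simp add: alternating_def)
  next
    case (Cons w m)
    have "a (l @ v # (w # m) @ v # r) = - a ((l @ [w]) @ v # m @ v # r)"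
      using alternating_swap[OF assms(1), of l v w "m @ v # r"] by simp
    then show ?case using Cons[of "l @ [w]"] by simp
  qed
  obtain xs y ys zs where "vs = xs @ [y] @ ys @ [y] @ zs"
    using not_distinct_decomp[OF assms(2)] by blast
  then show ?thesis using *[of xs y ys zs] by simp
qed

lemma alternating_map:
  assumes "linear F" "alternating a"
  shows "alternating (\<lambda>l. a (map F l))"
proof -
  have "linear (\<lambda>v. a (l @ F v # r))" for l r
    using linear_compose[OF assms(1), of "\<lambda>v. a (l @ v # r)"] assms(2)
    by (simp add: o_def alternating_def multilinear_form_def)
  then show ?thesis
    using assms(2) by (auto simp: alternating_def multilinear_form_def)
qed

lemma alternating_append: "alternating a \<Longrightarrow> alternating (\<lambda>l. a (us @ l))"
proof (induction us arbitrary: a)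
  case (Cons u us)
  from Cons.IH[OF alternating_Cons[OF Cons.prems, of u]] show ?case by simp
qed simp

text \<open>The algebraic part of the projection formula.\<close>
lemma shuffle_prod_interior_zero:
  assumes "grade a = a" "\<And>v l. v \<in> set us \<Longrightarrow> a (v # l) = 0"
  shows "shuffle_prod a b (us @ vs) = shuffle_prod a (\<lambda>l. b (us @ l)) vs"
  using assms(2)
  by (induction us arbitrary: b) (simp_all add: shuffle_prod_Cons assms(1) shuffle_prod_zero_left)


section \<open>Smooth maps between open sets\<close>

text \<open>Model spaces may have dimension 0 and come without a distinguished basis. A finite
  orthonormal set takes its place and at the same time witnesses finite dimension.\<close>

definition orthonormal_basis :: "'a::real_inner set \<Rightarrow> bool" where
  "orthonormal_basis C \<longleftrightarrow> finite C \<and> (\<forall>b\<in>C. \<forall>c\<in>C. b \<bullet> c = (if b = c then 1 else 0)) \<and> span C = UNIV"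

text \<open>Gram-Schmidt yields an orthogonal set that may contain 0, which is removed before
  normalising.\<close>

lemma orthonormal_basis_exists:
  assumes "finite B" "span B = (UNIV :: 'a::real_inner set)"
  shows "\<exists>C::'a set. orthonormal_basis C"
proof -
  obtain D where D: "finite D" "span D = span B" "pairwise orthogonal D"
    using basis_orthogonal[OF assms(1)] by blast
  let ?C = "(\<lambda>b. b /\<^sub>R norm b) ` (D - {0})"
  have "b \<in> span ?C" if "b \<in> D" for b
  proof (cases "b = 0")
    case False
    then have "norm b *\<^sub>R (b /\<^sub>R norm b) \<in> span ?C"
      using that by (intro span_scale span_base) auto
    then show ?thesis using False by simp
  qed (simp add: span_zero)
  then have "span D \<subseteq> span ?C"
    by (intro span_minimal) auto
  then have "span ?C = UNIV"
    using D(2) assms(2) by auto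
  moreover have "(b /\<^sub>R norm b) \<bullet> (c /\<^sub>R norm c) = (if b /\<^sub>R norm b = c /\<^sub>R norm c then 1 else 0)"
    if "b \<in> D - {0}" "c \<in> D - {0}" for b c
  proof (cases "b = c")
    case True
    then show ?thesis using that
      by (simp add: power2_norm_eq_inner[symmetric] power2_eq_square field_simps)
  next
    case False
    then have "b \<bullet> c = 0"
      using D(3) that by (auto simp: pairwise_def orthogonal_def)
    moreover from this have "b /\<^sub>R norm b \<noteq> c /\<^sub>R norm c"
      using that
      by (metis DiffD2 inner_eq_zero_iff inner_scaleR_left inner_scaleR_right mult_zero_right
          divideR_right norm_eq_zero scaleR_zero_right singletonI)
    ultimately show ?thesis by simp
  qed
  ultimately show ?thesis
    unfolding orthonormal_basis_def using D(1) by (intro exI[of _ ?C]) auto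
qed

lemma orthonormal_basis_expand:
  assumes "orthonormal_basis C"
  shows "(\<Sum>b\<in>C. (x \<bullet> b) *\<^sub>R b) = x"
proof -
  have "(\<Sum>b\<in>C. (c \<bullet> b) *\<^sub>R b) = c" if "c \<in> C" for c
  proof -
    have "(\<Sum>b\<in>C. (c \<bullet> b) *\<^sub>R b) = (\<Sum>b\<in>C. if b = c then c else 0)"
      using assms that by (intro sum.cong) (auto simp: orthonormal_basis_def)
    then show ?thesis using assms that by (simp add: orthonormal_basis_def)
  qed
  moreover have "linear (\<lambda>x. \<Sum>b\<in>C. (x \<bullet> b) *\<^sub>R b)"
    by (rule linearI) (simp_all add: inner_add_left scaleR_left_distrib sum.distrib scaleR_sum_right)
  ultimately show ?thesis
    using linear_eq_on_span[of "\<lambda>x. \<Sum>b\<in>C. (x \<bullet> b) *\<^sub>R b" "\<lambda>x. x" C x] assms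
    by (simp add: orthonormal_basis_def linear_id[unfolded id_def])
qed

lemma orthonormal_basis_norm: "orthonormal_basis C \<Longrightarrow> b \<in> C \<Longrightarrow> norm b = 1"
  by (simp add: orthonormal_basis_def norm_eq_sqrt_inner)

lemma linear_orthonormal_expand:
  assumes "orthonormal_basis C" "linear f"
  shows "f x = (\<Sum>b\<in>C. (x \<bullet> b) *\<^sub>R f b)"
  by (subst orthonormal_basis_expand[OF assms(1), of x, symmetric])
    (simp add: linear_sum[OF assms(2)] linear_scale[OF assms(2)])

lemma linear_imp_bounded_linear:
  fixes f :: "'a::real_inner \<Rightarrow> 'b::real_normed_vector"
  assumes "orthonormal_basis (C :: 'a set)" "linear f"
  shows "bounded_linear f"
proof -
  have "bounded_linear (\<lambda>x. \<Sum>b\<in>C. (x \<bullet> b) *\<^sub>R f b)"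
    by (intro bounded_linear_sum bounded_linear_scaleR_left bounded_linear_compose[OF bounded_linear_scaleR_left]
        bounded_linear_inner_left)
  moreover have "(\<lambda>x. \<Sum>b\<in>C. (x \<bullet> b) *\<^sub>R f b) = f"
    by (rule ext) (rule linear_orthonormal_expand[OF assms, symmetric])
  ultimately show ?thesis by (rule back_subst)
qed

section \<open>Closure properties of maps of class k on open sets\<close>

lemma Ck_on_cong:
  assumes "open S" "\<And>x. x \<in> S \<Longrightarrow> f x = g x" "Ck_on k S f"
  shows "Ck_on k S g"
  using assms(2,3)
proof (induction k arbitrary: f g)
  case 0
  then show ?case by (simp cong: continuous_on_cong)
next
  case (Suc k)
  have d: "f differentiable at x" if "x \<in> S" for x
    using Suc.prems that by simp
  have eq: "frechet_derivative f (at x) = frechet_derivative g (at x)" if "x \<in> S" for x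
    using frechet_derivative_transform_within_open[OF d[OF that] assms(1) that] Suc.prems by blast
  have "g differentiable at x" if "x \<in> S" for x
    using d[OF that] Suc.prems(1) assms(1) that has_derivative_transform_within_open
    unfolding differentiable_def by blast
  moreover have "Ck_on k S (\<lambda>x. frechet_derivative g (at x) v)" for v
    by (rule Suc.IH[of "\<lambda>x. frechet_derivative f (at x) v"]) (use Suc.prems eq in auto)
  ultimately show ?case by simp
qed

text \<open>Derivatives are unique, so an explicit formula f' may stand for the chosen
  \<open>frechet_derivative\<close>. The closure properties below obtain their inductive steps from
  this rule.\<close>

lemma Ck_on_SucI:
  assumes "open S" "\<And>x. x \<in> S \<Longrightarrow> (f has_derivative f' x) (at x)" "\<And>v. Ck_on k S (\<lambda>x. f' x v)"
  shows "Ck_on (Suc k) S f"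
proof -
  have "f' x = frechet_derivative f (at x)" if "x \<in> S" for x
    using frechet_derivative_at[OF assms(2)[OF that]] .
  then have "Ck_on k S (\<lambda>x. frechet_derivative f (at x) v)" for v
    by (intro Ck_on_cong[OF assms(1) _ assms(3)[of v]]) simp
  then show ?thesis using assms(2) by (auto simp: differentiable_def)
qed

lemma Ck_on_has_derivative:
  "Ck_on (Suc k) S f \<Longrightarrow> x \<in> S \<Longrightarrow> (f has_derivative frechet_derivative f (at x)) (at x)"
  by (simp add: frechet_derivative_works[symmetric])

lemma Ck_on_deriv: "Ck_on (Suc k) S f \<Longrightarrow> Ck_on k S (\<lambda>x. frechet_derivative f (at x) v)"
  by simp

text \<open>\<open>Ck_on\<close> takes its derivatives in the whole space, so they do not change
  when the set shrinks.\<close>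

lemma Ck_on_subset: "Ck_on k S f \<Longrightarrow> T \<subseteq> S \<Longrightarrow> Ck_on k T f"
  by (induction k arbitrary: f) (auto intro: continuous_on_subset)

lemma Ck_on_SucD: "Ck_on (Suc k) S f \<Longrightarrow> Ck_on k S f"
proof (induction k arbitrary: f)
  case 0
  then have "f differentiable_on S"
    by (simp add: differentiable_at_imp_differentiable_on)
  then show ?case using differentiable_imp_continuous_on by simp
next
  case (Suc k)
  from Suc.prems have "Ck_on k S (\<lambda>x. frechet_derivative f (at x) v)" for v
    using Suc.IH[OF Ck_on_deriv[OF Suc.prems]] by blast
  then show ?case using Suc.prems by simp
qed

lemma Ck_on_const: "open S \<Longrightarrow> Ck_on k S (\<lambda>x. c)"
proof (induction k arbitrary: c)
  case (Suc k)
  show ?case by (rule Ck_on_SucI[OF Suc.prems has_derivative_const]) (rule Suc.IH[OF Suc.prems])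
qed simp

lemma Ck_on_linear:
  assumes "open S" "bounded_linear f"
  shows "Ck_on k S f"
proof (cases k)
  case 0
  then show ?thesis using assms(2) by (simp add: linear_continuous_on)
next
  case (Suc m)
  show ?thesis
    unfolding Suc
    by (rule Ck_on_SucI[OF assms(1) bounded_linear_imp_has_derivative[OF assms(2)]])
      (rule Ck_on_const[OF assms(1)])
qed

lemma Ck_on_bounded_linear:
  assumes "open S" "bounded_linear T" "Ck_on k S f"
  shows "Ck_on k S (\<lambda>x. T (f x))"
  using assms(3)
proof (induction k arbitrary: f)
  case 0
  then show ?case
    using bounded_linear.continuous_on[OF assms(2)] by simp
next
  case (Suc k)
  show ?case
    by (rule Ck_on_SucI[OF assms(1) bounded_linear.has_derivative[OF assms(2) Ck_on_has_derivative[OF Suc.prems]]])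
      (use Suc in auto)
qed

lemma Ck_on_add:
  assumes "open S" "Ck_on k S f" "Ck_on k S g"
  shows "Ck_on k S (\<lambda>x. f x + g x)"
  using assms(2,3)
proof (induction k arbitrary: f g)
  case 0
  then show ?case by (simp add: continuous_on_add)
next
  case (Suc k)
  show ?case
    by (rule Ck_on_SucI[OF assms(1) has_derivative_add[OF Ck_on_has_derivative[OF Suc.prems(1)] Ck_on_has_derivative[OF Suc.prems(2)]]])
      (use Suc in auto)
qed

lemma Ck_on_sum:
  assumes "open S" "\<And>i. i \<in> I \<Longrightarrow> Ck_on k S (f i)"
  shows "Ck_on k S (\<lambda>x. \<Sum>i\<in>I. f i x)"
  using assms(2)
  by (induction I rule: infinite_finite_induct)
    (simp_all add: Ck_on_const[OF assms(1)] Ck_on_add[OF assms(1)])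

text \<open>The Leibniz rule gives two products, each of a map with a directional derivative; both
  factors are of class k, so the induction hypothesis for arbitrary f and g applies.\<close>

lemma (in bounded_bilinear) Ck_on:
  assumes "open S" "Ck_on k S f" "Ck_on k S g"
  shows "Ck_on k S (\<lambda>x. prod (f x) (g x))"
  using assms(2,3)
proof (induction k arbitrary: f g)
  case 0
  then show ?case by (simp add: continuous_on)
next
  case (Suc k)
  note F = Ck_on_has_derivative[OF Suc.prems(1)] Ck_on_has_derivative[OF Suc.prems(2)]
  show ?case
    by (rule Ck_on_SucI[OF assms(1) FDERIV[OF F]], assumption, assumption)
      (intro Ck_on_add[OF assms(1)] Suc.IH Ck_on_SucD[OF Suc.prems(1)] Ck_on_SucD[OF Suc.prems(2)]
        Ck_on_deriv[OF Suc.prems(1)] Ck_on_deriv[OF Suc.prems(2)])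
qed

text \<open>\<open>Ck_on\<close> controls derivatives only in constant directions, whereas the chain
  rule differentiates g in a direction that moves with x. Expanding that direction in the basis C
  leaves constant directions with coefficients of class k.\<close>

lemma Ck_on_compose:
  fixes f :: "'a::real_normed_vector \<Rightarrow> 'b::real_inner"
  assumes C: "orthonormal_basis (C :: 'b set)" and S: "open S" and T: "open T" "f ` S \<subseteq> T"
    and "Ck_on k S f" "Ck_on k T g"
  shows "Ck_on k S (\<lambda>x. g (f x))"
  using assms(5,6)
proof (induction k arbitrary: g)
  case 0
  then show ?case using T(2) by (auto intro: continuous_on_compose2)
next
  case (Suc k)
  note F = Ck_on_has_derivative[OF Suc.prems(1)]
  have G: "(g has_derivative frechet_derivative g (at (f x))) (at (f x))" if "x \<in> S" for x
    using Ck_on_has_derivative[OF Suc.prems(2), of "f x"] T(2) that by blast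
  have D: "((\<lambda>x. g (f x)) has_derivative
      (\<lambda>v. \<Sum>b\<in>C. (frechet_derivative f (at x) v \<bullet> b) *\<^sub>R frechet_derivative g (at (f x)) b)) (at x)"
    if "x \<in> S" for x
    using has_derivative_compose[OF F[OF that] G[OF that]]
    by (simp only: linear_orthonormal_expand[OF C has_derivative_linear[OF G[OF that]], symmetric])
  have "Ck_on k S (\<lambda>x. frechet_derivative g (at (f x)) b)" for b
    by (rule Suc.IH[OF Ck_on_SucD[OF Suc.prems(1)] Ck_on_deriv[OF Suc.prems(2)]])
  moreover have "Ck_on k S (\<lambda>x. frechet_derivative f (at x) v \<bullet> b)" for v b
    by (rule Ck_on_bounded_linear[OF S bounded_linear_inner_left]) (use Suc.prems in auto)
  ultimately have "Ck_on k S (\<lambda>x. \<Sum>b\<in>C. (frechet_derivative f (at x) v \<bullet> b) *\<^sub>R frechet_derivative g (at (f x)) b)" for v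
    by (intro Ck_on_sum[OF S] bounded_bilinear.Ck_on[OF bounded_bilinear_scaleR S])
  from Ck_on_SucI[OF S D this] show ?case .
qed

lemma Ck_on_local:
  assumes "\<And>x. x \<in> S \<Longrightarrow> \<exists>V. open V \<and> x \<in> V \<and> Ck_on k V f"
  shows "Ck_on k S f"
  using assms
proof (induction k arbitrary: f)
  case 0
  show ?case
    unfolding Ck_on.simps continuous_on_eq_continuous_within
  proof
    fix x assume "x \<in> S"
    then obtain V where "open V" "x \<in> V" "continuous_on V f" using 0 by auto
    then have "continuous (at x) f" using continuous_on_eq_continuous_at by blast
    then show "continuous (at x within S) f" by (rule continuous_at_imp_continuous_at_within)
  qed
next
  case (Suc k)
  then have "Ck_on k S (\<lambda>x. frechet_derivative f (at x) v)" for v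
    by (intro Suc.IH) (metis Ck_on_deriv)
  moreover have "f differentiable at x" if "x \<in> S" for x
    using Suc.prems[OF that] by auto
  ultimately show ?case by simp
qed

lemma smooth_on_continuous_on: "smooth_on S f \<Longrightarrow> continuous_on S f"
  unfolding smooth_on_def by (metis Ck_on.simps(1))

lemma smooth_on_has_derivative:
  "smooth_on S f \<Longrightarrow> x \<in> S \<Longrightarrow> (f has_derivative frechet_derivative f (at x)) (at x)"
  unfolding smooth_on_def using Ck_on_has_derivative[of 0 S f x] by blast

lemma smooth_on_deriv: "smooth_on S f \<Longrightarrow> smooth_on S (\<lambda>x. frechet_derivative f (at x) v)"
  unfolding smooth_on_def by (intro allI, rule Ck_on_deriv) auto

lemma smooth_on_cong: "open S \<Longrightarrow> (\<And>x. x \<in> S \<Longrightarrow> f x = g x) \<Longrightarrow> smooth_on S f \<Longrightarrow> smooth_on S g"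
  unfolding smooth_on_def by (intro allI, rule Ck_on_cong[of S f g]) auto

lemma smooth_on_subset: "smooth_on S f \<Longrightarrow> T \<subseteq> S \<Longrightarrow> smooth_on T f"
  unfolding smooth_on_def by (auto intro: Ck_on_subset)

lemma smooth_on_local:
  "(\<And>x. x \<in> S \<Longrightarrow> \<exists>V. open V \<and> x \<in> V \<and> smooth_on V f) \<Longrightarrow> smooth_on S f"
  unfolding smooth_on_def by (intro allI Ck_on_local) blast

lemma smooth_on_linear: "open S \<Longrightarrow> bounded_linear f \<Longrightarrow> smooth_on S f"
  unfolding smooth_on_def by (intro allI Ck_on_linear)

lemma smooth_on_const: "open S \<Longrightarrow> smooth_on S (\<lambda>x. c)"
  unfolding smooth_on_def by (intro allI Ck_on_const)

lemma smooth_on_bounded_linear: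
  "open S \<Longrightarrow> bounded_linear T \<Longrightarrow> smooth_on S f \<Longrightarrow> smooth_on S (\<lambda>x. T (f x))"
  unfolding smooth_on_def by (intro allI, rule Ck_on_bounded_linear) auto

lemma smooth_on_add: "open S \<Longrightarrow> smooth_on S f \<Longrightarrow> smooth_on S g \<Longrightarrow> smooth_on S (\<lambda>x. f x + g x)"
  unfolding smooth_on_def by (intro allI, rule Ck_on_add) auto

lemma smooth_on_mult:
  fixes f g :: "'a::real_normed_vector \<Rightarrow> 'b::real_normed_algebra"
  shows "open S \<Longrightarrow> smooth_on S f \<Longrightarrow> smooth_on S g \<Longrightarrow> smooth_on S (\<lambda>x. f x * g x)"
  unfolding smooth_on_def by (intro allI, rule bounded_bilinear.Ck_on[OF bounded_bilinear_mult]) auto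

lemma smooth_on_compose:
  fixes f :: "'a::real_normed_vector \<Rightarrow> 'b::real_inner"
  assumes "orthonormal_basis (C :: 'b set)" "open S" "open T" "f ` S \<subseteq> T" "smooth_on S f" "smooth_on T g"
  shows "smooth_on S (\<lambda>x. g (f x))"
  unfolding smooth_on_def
proof
  fix k
  show "Ck_on k S (\<lambda>x. g (f x))"
    by (rule Ck_on_compose[OF assms(1-4)])
      (use assms(5,6) in \<open>auto simp: smooth_on_def\<close>)
qed

lemma Ck_on_Pair:
  assumes "open S" "Ck_on k S f" "Ck_on k S g"
  shows "Ck_on k S (\<lambda>x. (f x, g x))"
  using assms(2,3)
proof (induction k arbitrary: f g)
  case 0
  then show ?case by (simp add: continuous_on_Pair)
next
  case (Suc k)
  show ?case
    by (rule Ck_on_SucI[OF assms(1) has_derivative_Pair[OF Ck_on_has_derivative[OF Suc.prems(1)] Ck_on_has_derivative[OF Suc.prems(2)]]], assumption, assumption)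
      (rule Suc.IH, rule Ck_on_deriv[OF Suc.prems(1)], rule Ck_on_deriv[OF Suc.prems(2)])
qed

lemma smooth_on_Pair: "open S \<Longrightarrow> smooth_on S f \<Longrightarrow> smooth_on S g \<Longrightarrow> smooth_on S (\<lambda>x. (f x, g x))"
  unfolding smooth_on_def by (intro allI, rule Ck_on_Pair) auto

lemma smooth_on_shuffle_sum:
  assumes "open S" "\<And>l r. smooth_on S (\<lambda>x. f x l r)"
  shows "smooth_on S (\<lambda>x. shuffle_sum vs (f x))"
  using assms(2)
proof (induction vs arbitrary: f)
  case (Cons v vs)
  show ?case
    unfolding shuffle_sum.simps
    by (rule smooth_on_add[OF assms(1)], rule Cons.IH, rule Cons.prems, rule Cons.IH,
        rule smooth_on_bounded_linear[OF assms(1) bounded_linear_scaleR_right], rule Cons.prems)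
qed simp


section \<open>Integrals depending on a parameter\<close>

text \<open>Nothing is known about h outside K. Since the weight vanishes there, h may be replaced
  by its product with the indicator of K, which is Borel because K is closed and bounded because K
  is compact.\<close>

lemma integrable_supported:
  fixes h :: "'b::t2_space \<Rightarrow> complex"
  assumes K: "compact K" "continuous_on K h"
    and \<theta>: "integrable N (\<theta> :: 'u \<Rightarrow> real)" and Y: "Y \<in> measurable N borel"
    and supp: "\<forall>u\<in>space N. \<theta> u \<noteq> 0 \<longrightarrow> Y u \<in> K"
  shows "integrable N (\<lambda>u. \<theta> u *\<^sub>R h (Y u))"
proof -
  obtain c where c: "\<And>y. y \<in> K \<Longrightarrow> norm (h y) \<le> c"
    using compact_imp_bounded[OF compact_continuous_image[OF K(2,1)]]
    unfolding bounded_iff by blast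
  have "(\<lambda>y. indicator K y *\<^sub>R h y) \<in> borel_measurable borel"
    using K by (intro borel_measurable_continuous_on_indicator borel_closed compact_imp_closed)
  then have "(\<lambda>u. \<theta> u *\<^sub>R (indicator K (Y u) *\<^sub>R h (Y u))) \<in> borel_measurable N"
    by (rule borel_measurable_scaleR[OF borel_measurable_integrable[OF \<theta>] measurable_compose[OF Y]])
  then have m: "(\<lambda>u. \<theta> u *\<^sub>R h (Y u)) \<in> borel_measurable N"
    by (rule iffD1[OF measurable_cong, rotated]) (use supp in \<open>auto simp: indicator_def\<close>)
  show ?thesis
  proof (rule Bochner_Integration.integrable_bound)
    show "integrable N (\<lambda>u. c * \<theta> u)" using \<theta> by simp
    show "AE u in N. norm (\<theta> u *\<^sub>R h (Y u)) \<le> norm (c * \<theta> u)"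
    proof (rule AE_I2)
      fix u assume u: "u \<in> space N"
      show "norm (\<theta> u *\<^sub>R h (Y u)) \<le> norm (c * \<theta> u)"
      proof (cases "\<theta> u = 0")
        case False
        then have "norm (h (Y u)) \<le> \<bar>c\<bar>"
          using c[of "Y u"] supp u by fastforce
        then show ?thesis
          using mult_left_mono[of "norm (h (Y u))" "\<bar>c\<bar>" "\<bar>\<theta> u\<bar>"]
          by (simp add: abs_mult mult.commute)
      qed simp
    qed
  qed (rule m)
qed

text \<open>
  The mean value theorem bounds the remainder of the linear approximation in the parameter, and
  this bound is uniform on the compact set \<open>K\<close>.
\<close>
lemma has_derivative_integral:
  fixes g :: "'p::real_inner \<times> 'b::real_inner \<Rightarrow> complex"
  assumes C: "orthonormal_basis (C :: 'p set)" and A: "open A" "open Q"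
    and K: "compact K" "K \<subseteq> Q"
    and \<theta>: "integrable N \<theta>" and Y: "Y \<in> measurable N borel"
    and supp: "\<forall>u\<in>space N. \<theta> u \<noteq> 0 \<longrightarrow> Y u \<in> K"
    and g: "smooth_on (A \<times> Q) g" and p: "p \<in> A"
  shows "((\<lambda>p. \<integral>u. \<theta> u *\<^sub>R g (p, Y u) \<partial>N) has_derivative
     (\<lambda>v. \<integral>u. \<theta> u *\<^sub>R frechet_derivative g (at (p, Y u)) (v, 0) \<partial>N)) (at p)"
proof -
  define G where "G q y v = frechet_derivative g (at (q, y)) (v, 0)" for q y v
  have cont: "continuous_on (A \<times> Q) (\<lambda>x. G (fst x) (snd x) v)" for v
    unfolding G_def using smooth_on_continuous_on[OF smooth_on_deriv[OF g]] by simp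
  have pairc: "continuous_on Z (\<lambda>y. (q :: 'p, y))" for Z :: "'b set" and q
    by (intro continuous_on_Pair continuous_on_const continuous_on_id)
  have pairK: "(\<lambda>y. (q, y)) ` K \<subseteq> A \<times> Q" if "q \<in> A" for q
    using that K by auto
  have cont1: "continuous_on K (\<lambda>y. G q y v)" if "q \<in> A" for q v
    using continuous_on_compose2[OF cont pairc pairK[OF that]] by simp
  have cont0: "continuous_on K (\<lambda>y. g (q, y))" if "q \<in> A" for q
    using continuous_on_compose2[OF smooth_on_continuous_on[OF g] pairc pairK[OF that]] by simp
  note int = integrable_supported[OF K(1) _ \<theta> Y supp]
  note int1 = int[OF cont1] and int0 = int[OF cont0]
  have DG: "((\<lambda>q. g (q, y)) has_derivative G q y) (at q)" if "q \<in> A" "y \<in> Q" for q y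
  proof -
    have "((\<lambda>q. (q, y)) has_derivative (\<lambda>v. (v, 0))) (at q)"
      by (auto intro!: derivative_eq_intros)
    from has_derivative_compose[OF this smooth_on_has_derivative[OF g]] that
    show ?thesis unfolding G_def by auto
  qed
  have linG: "linear (G q y)" if "q \<in> A" "y \<in> Q" for q y
    using DG[OF that] by (rule has_derivative_linear)
  let ?L = "\<lambda>v. \<integral>u. \<theta> u *\<^sub>R G p (Y u) v \<partial>N"
  \<comment> \<open>Where \<open>Y u\<close> lies outside Q the derivative is not known to be
    linear; the weight is 0 there, so the weighted identities hold at every u of the space.\<close>
  have Leq: "\<theta> u *\<^sub>R G p (Y u) (v + w) = \<theta> u *\<^sub>R G p (Y u) v + \<theta> u *\<^sub>R G p (Y u) w"
    "\<theta> u *\<^sub>R G p (Y u) (r *\<^sub>R v) = r *\<^sub>R (\<theta> u *\<^sub>R G p (Y u) v)" if "u \<in> space N" for u v w r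
  proof -
    have "\<theta> u = 0 \<or> linear (G p (Y u))"
      using supp that K(2) linG[OF p] by blast
    then show "\<theta> u *\<^sub>R G p (Y u) (v + w) = \<theta> u *\<^sub>R G p (Y u) v + \<theta> u *\<^sub>R G p (Y u) w"
      "\<theta> u *\<^sub>R G p (Y u) (r *\<^sub>R v) = r *\<^sub>R (\<theta> u *\<^sub>R G p (Y u) v)"
      by (auto simp: linear_add linear_scale scaleR_add_right)
  qed
  have "linear ?L"
  proof (rule linearI)
    show "?L (v + w) = ?L v + ?L w" for v w
      unfolding Bochner_Integration.integral_add[OF int1[OF p] int1[OF p], symmetric]
      by (rule Bochner_Integration.integral_cong[OF refl Leq(1)])
    show "?L (r *\<^sub>R v) = r *\<^sub>R ?L v" for r v
      unfolding integral_scaleR_right[symmetric]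
      by (rule Bochner_Integration.integral_cong[OF refl Leq(2)])
  qed
  then have bl: "bounded_linear ?L"
    by (rule linear_imp_bounded_linear[OF C])
  define I where "I = (\<integral>u. \<bar>\<theta> u\<bar> \<partial>N)"
  have I: "I \<ge> 0" by (simp add: I_def)
  have "\<exists>d>0. \<forall>q. norm (q - p) < d \<longrightarrow>
      norm ((\<integral>u. \<theta> u *\<^sub>R g (q, Y u) \<partial>N) - (\<integral>u. \<theta> u *\<^sub>R g (p, Y u) \<partial>N) - ?L (q - p)) \<le> e * norm (q - p)"
    if e: "e > 0" for e
  proof -
    define n where "n = real (card C)"
    \<comment> \<open>The factor n arises when a linear map is bounded through its values on the
      basis C, and I when the weight is integrated. Adding 1 to each keeps the denominator
      positive.\<close>
    define e' where "e' = e / ((I + 1) * (n + 1))"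
    have n: "n \<ge> 0" by (simp add: n_def)
    have e': "e' > 0" using e I n by (simp add: e'_def)
    \<comment> \<open>The tube lemma over the compact set K, for one direction b at a time; as C is
      finite, the neighbourhoods for its members can be intersected.\<close>
    have "\<exists>X. p \<in> X \<and> open X \<and> (\<forall>q\<in>X \<inter> A. \<forall>y\<in>K. norm (G q y b - G p y b) \<le> e')" for b
    proof -
      have "continuous_on (A \<times> K) (\<lambda>x. G (fst x) (snd x) b)"
        using K by (intro continuous_on_subset[OF cont]) auto
      from continuous_on_prod_compactE[OF this K(1) p e'] show ?thesis
        unfolding fst_conv snd_conv dist_norm by metis
    qed
    then obtain X where X: "\<And>b. p \<in> X b" "\<And>b. open (X b)"
      "\<And>b q y. q \<in> X b \<Longrightarrow> q \<in> A \<Longrightarrow> y \<in> K \<Longrightarrow> norm (G q y b - G p y b) \<le> e'"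
      by (metis IntI)
    have fin: "finite C" using C by (simp add: orthonormal_basis_def)
    have "open ((\<Inter>b\<in>C. X b) \<inter> A)" "p \<in> (\<Inter>b\<in>C. X b) \<inter> A"
      using X A(1) p fin by auto
    then obtain d where d: "d > 0" "ball p d \<subseteq> (\<Inter>b\<in>C. X b) \<inter> A"
      by (meson open_contains_ball)
    have bound: "norm (g (q, y) - g (p, y) - G p y (q - p)) \<le> (n * e') * norm (q - p)"
      if q: "q \<in> ball p d" and y: "y \<in> K" for q y
    proof -
      have yQ: "y \<in> Q" using y K by auto
      \<comment> \<open>Subtracting the linear part makes the remainder an increment of
        \<open>?f\<close>, whose derivative is small on the whole ball.\<close>
      let ?f = "\<lambda>q. g (q, y) - G p y q"
      have "(?f has_derivative (\<lambda>v. G r y v - G p y v)) (at r within ball p d)"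
        if "r \<in> ball p d" for r
        using that d(2) yQ p
        by (intro has_derivative_diff has_derivative_at_withinI[OF DG]
            bounded_linear_imp_has_derivative has_derivative_bounded_linear[OF DG]) auto
      moreover have "onorm (\<lambda>v. G r y v - G p y v) \<le> n * e'" if r: "r \<in> ball p d" for r
      proof (rule onorm_bound)
        show "0 \<le> n * e'" using n e' by simp
        fix v
        have rA: "r \<in> A" using r d(2) by auto
        have "G r y v - G p y v = (\<Sum>b\<in>C. (v \<bullet> b) *\<^sub>R (G r y b - G p y b))"
          by (subst linear_orthonormal_expand[OF C linG[OF rA yQ]],
              subst linear_orthonormal_expand[OF C linG[OF p yQ]])
            (simp add: sum_subtractf scaleR_diff_right)
        also have "norm \<dots> \<le> (\<Sum>b\<in>C. norm v * e')"
        proof (rule sum_norm_le)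
          fix b assume b: "b \<in> C"
          have "\<bar>v \<bullet> b\<bar> \<le> norm v"
            using Cauchy_Schwarz_ineq2[of v b] orthonormal_basis_norm[OF C b] by simp
          moreover have "norm (G r y b - G p y b) \<le> e'"
            using X(3)[of r b y] r d(2) b y rA by auto
          ultimately show "norm ((v \<bullet> b) *\<^sub>R (G r y b - G p y b)) \<le> norm v * e'"
            by (simp add: mult_mono)
        qed
        finally show "norm (G r y v - G p y v) \<le> n * e' * norm v"
          by (simp add: n_def mult_ac)
      qed
      ultimately have "norm (?f q - ?f p) \<le> (n * e') * norm (q - p)"
        using q d(1) by (intro differentiable_bound[OF convex_ball]) auto
      moreover have "?f q - ?f p = g (q, y) - g (p, y) - G p y (q - p)"
        using linear_diff[OF linG[OF p yQ], of q p] by simp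
      ultimately show ?thesis by simp
    qed
    have "norm ((\<integral>u. \<theta> u *\<^sub>R g (q, Y u) \<partial>N) - (\<integral>u. \<theta> u *\<^sub>R g (p, Y u) \<partial>N) - ?L (q - p)) \<le> e * norm (q - p)"
      if "norm (q - p) < d" for q
    proof -
      have q: "q \<in> ball p d" using that by (simp add: dist_norm norm_minus_commute)
      then have qA: "q \<in> A" using d(2) by auto
      have "(\<integral>u. \<theta> u *\<^sub>R g (q, Y u) \<partial>N) - (\<integral>u. \<theta> u *\<^sub>R g (p, Y u) \<partial>N) - ?L (q - p)
          = (\<integral>u. \<theta> u *\<^sub>R g (q, Y u) - \<theta> u *\<^sub>R g (p, Y u) - \<theta> u *\<^sub>R G p (Y u) (q - p) \<partial>N)"
        using int0[OF qA] int0[OF p] int1[OF p] by simp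
      also have "norm \<dots> \<le> (\<integral>u. (n * e' * norm (q - p)) * \<bar>\<theta> u\<bar> \<partial>N)"
      proof (rule order_trans[OF Bochner_Integration.integral_norm_bound Bochner_Integration.integral_mono])
        show "integrable N (\<lambda>u. norm (\<theta> u *\<^sub>R g (q, Y u) - \<theta> u *\<^sub>R g (p, Y u) - \<theta> u *\<^sub>R G p (Y u) (q - p)))"
          using int0[OF qA] int0[OF p] int1[OF p] by simp
        show "integrable N (\<lambda>u. (n * e' * norm (q - p)) * \<bar>\<theta> u\<bar>)"
          using \<theta> by simp
        fix u assume u: "u \<in> space N"
        have "norm (\<theta> u *\<^sub>R (g (q, Y u) - g (p, Y u) - G p (Y u) (q - p)))
            \<le> (n * e' * norm (q - p)) * \<bar>\<theta> u\<bar>"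
        proof (cases "\<theta> u = 0")
          case False
          then have "Y u \<in> K" using supp u by blast
          from mult_left_mono[OF bound[OF q this] abs_ge_zero[of "\<theta> u"]] show ?thesis
            by (simp add: mult_ac)
        qed simp
        then show "norm (\<theta> u *\<^sub>R g (q, Y u) - \<theta> u *\<^sub>R g (p, Y u) - \<theta> u *\<^sub>R G p (Y u) (q - p))
            \<le> (n * e' * norm (q - p)) * \<bar>\<theta> u\<bar>"
          by (simp add: scaleR_diff_right)
      qed
      also have "\<dots> = (n * e' * I) * norm (q - p)"
        by (simp add: I_def)
      also have "\<dots> \<le> e * norm (q - p)"
      proof (rule mult_right_mono)
        have "n * I \<le> (I + 1) * (n + 1)" using n I by (simp add: algebra_simps)
        from mult_right_mono[OF this less_imp_le[OF e']] have "n * e' * I \<le> (I + 1) * (n + 1) * e'"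
          by (simp add: mult_ac)
        also have "\<dots> = e" using n I by (simp add: e'_def)
        finally show "n * e' * I \<le> e" .
      qed simp
      finally show ?thesis .
    qed
    then show ?thesis using d(1) by blast
  qed
  with bl show ?thesis
    unfolding has_derivative_at_alt G_def by blast
qed

text \<open>A directional derivative of the integral is an integral of the same kind, with g
  replaced by its derivative along (v, 0) and the weight unchanged. Hence the induction on the order
  runs over all smooth g.\<close>

lemma smooth_on_integral:
  fixes g :: "'p::real_inner \<times> 'b::real_inner \<Rightarrow> complex"
  assumes C: "orthonormal_basis (C :: 'p set)" and A: "open A" "open Q"
    and K: "compact K" "K \<subseteq> Q"
    and \<theta>: "integrable N \<theta>" and Y: "Y \<in> measurable N borel"
    and supp: "\<forall>u\<in>space N. \<theta> u \<noteq> 0 \<longrightarrow> Y u \<in> K"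
    and g: "smooth_on (A \<times> Q) g"
  shows "smooth_on A (\<lambda>p. \<integral>u. \<theta> u *\<^sub>R g (p, Y u) \<partial>N)"
proof -
  note D = has_derivative_integral[OF C A K \<theta> Y supp]
  have "Ck_on k A (\<lambda>p. \<integral>u. \<theta> u *\<^sub>R g (p, Y u) \<partial>N)" for k
    using g
  proof (induction k arbitrary: g)
    case 0
    have "continuous (at p) (\<lambda>p. \<integral>u. \<theta> u *\<^sub>R g (p, Y u) \<partial>N)" if "p \<in> A" for p
      by (rule has_derivative_continuous[OF D[OF 0 that]])
    then show ?case
      by (auto intro: continuous_at_imp_continuous_on)
  next
    case (Suc k)
    show ?case
      by (rule Ck_on_SucI[OF A(1) D[OF Suc.prems]], assumption)
        (rule Suc.IH[OF smooth_on_deriv[OF Suc.prems]])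
  qed
  then show ?thesis by (simp add: smooth_on_def)
qed


section \<open>Charts and tangent vectors\<close>

lemma atlas_orthonormal_basis:
  "smooth_atlas (A :: ('m::topological_space, 'e::real_inner) atlas) \<Longrightarrow> \<exists>C::'e set. orthonormal_basis C"
  unfolding smooth_atlas_def using orthonormal_basis_exists by blast

context
  fixes A :: "('m::topological_space, 'e::real_inner) atlas"
  assumes A: "smooth_atlas A"
begin

lemma chart_homeomorphism:
  "c \<in> A \<Longrightarrow> homeomorphism (fst c) (snd c ` fst c) (snd c) (chart_inv c)"
  using A unfolding smooth_atlas_def by blast

lemma open_chart_domain: "c \<in> A \<Longrightarrow> open (fst c)"
  using A unfolding smooth_atlas_def by blast

lemma open_chart_image: "c \<in> A \<Longrightarrow> open (snd c ` fst c)"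
  using A unfolding smooth_atlas_def by blast

lemma chart_exists: "\<exists>c\<in>A. x \<in> fst c"
  using A unfolding smooth_atlas_def by blast

lemma smooth_transition:
  "c \<in> A \<Longrightarrow> c' \<in> A \<Longrightarrow> smooth_on (snd c ` (fst c \<inter> fst c')) (\<lambda>p. snd c' (chart_inv c p))"
  using A unfolding smooth_atlas_def o_def by blast

lemma chart_inv_left: "c \<in> A \<Longrightarrow> x \<in> fst c \<Longrightarrow> chart_inv c (snd c x) = x"
  using chart_homeomorphism[of c] unfolding homeomorphism_def by blast

lemma chart_inv_right: "c \<in> A \<Longrightarrow> p \<in> snd c ` fst c \<Longrightarrow> snd c (chart_inv c p) = p"
  using chart_homeomorphism[of c] unfolding homeomorphism_def by blast

lemma chart_inv_in: "c \<in> A \<Longrightarrow> p \<in> snd c ` fst c \<Longrightarrow> chart_inv c p \<in> fst c"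
  using chart_homeomorphism[of c] unfolding homeomorphism_def by blast

lemma open_chart_image_subset:
  assumes c: "c \<in> A" and V: "open V" "V \<subseteq> fst c"
  shows "open (snd c ` V)"
proof -
  have "continuous_on (snd c ` fst c) (chart_inv c)"
    using chart_homeomorphism[OF c] unfolding homeomorphism_def by blast
  then have "open (chart_inv c -` V \<inter> snd c ` fst c)"
    using continuous_on_open_vimage[OF open_chart_image[OF c]] V(1) by blast
  moreover have "chart_inv c -` V \<inter> snd c ` fst c = snd c ` V"
    using V(2) chart_inv_left[OF c] chart_inv_right[OF c] chart_inv_in[OF c] by force
  ultimately show ?thesis by simp
qed

lemma open_chart_preimage:
  assumes c: "c \<in> A" and W: "open W"
  shows "open {x \<in> fst c. snd c x \<in> W}"
proof -
  have "continuous_on (fst c) (snd c)"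
    using chart_homeomorphism[OF c] unfolding homeomorphism_def by blast
  then have "open (snd c -` W \<inter> fst c)"
    using continuous_on_open_vimage[OF open_chart_domain[OF c]] W by blast
  moreover have "snd c -` W \<inter> fst c = {x \<in> fst c. snd c x \<in> W}" by auto
  ultimately show ?thesis by simp
qed

text \<open>\<open>smooth_near\<close> asserts smoothness in some chart; composing with the
  transition map moves it to any prescribed chart around x.\<close>

lemma smooth_near_chart:
  assumes c: "c \<in> A" and x: "x \<in> fst c"
  shows "smooth_near A x f \<longleftrightarrow> (\<exists>W. open W \<and> snd c x \<in> W \<and> W \<subseteq> snd c ` fst c
      \<and> smooth_on W (\<lambda>p. f (chart_inv c p)))" (is "?l \<longleftrightarrow> ?r")
proof
  assume ?l
  then obtain c' V where V: "c' \<in> A" "open V" "x \<in> V" "V \<subseteq> fst c'"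
      "smooth_on (snd c' ` V) (\<lambda>p. f (chart_inv c' p))"
    unfolding smooth_near_def o_def by blast
  obtain C :: "'e set" where C: "orthonormal_basis C"
    using atlas_orthonormal_basis[OF A] by blast
  let ?W = "snd c ` (V \<inter> fst c)"
  have W: "open ?W" "snd c x \<in> ?W" "?W \<subseteq> snd c ` fst c"
    using open_chart_image_subset[OF c] V(2,3) open_chart_domain[OF c] x by auto
  have "smooth_on ?W (\<lambda>p. f (chart_inv c' (snd c' (chart_inv c p))))"
  proof (rule smooth_on_compose[OF C W(1)])
    show "open (snd c' ` V)" by (rule open_chart_image_subset[OF V(1,2,4)])
    show "(\<lambda>p. snd c' (chart_inv c p)) ` ?W \<subseteq> snd c' ` V"
      using chart_inv_left[OF c] by auto
    show "smooth_on ?W (\<lambda>p. snd c' (chart_inv c p))"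
      by (rule smooth_on_subset[OF smooth_transition[OF c V(1)]]) (use V(4) in auto)
  qed (rule V(5))
  then have "smooth_on ?W (\<lambda>p. f (chart_inv c p))"
    by (rule smooth_on_cong[OF W(1), rotated])
      (use chart_inv_left[OF c] chart_inv_left[OF V(1)] V(4) in \<open>auto dest!: subsetD\<close>)
  then show ?r using W by blast
next
  assume ?r
  then obtain W where W: "open W" "snd c x \<in> W" "W \<subseteq> snd c ` fst c"
      "smooth_on W (\<lambda>p. f (chart_inv c p))" by blast
  let ?V = "{y \<in> fst c. snd c y \<in> W}"
  have "snd c ` ?V = W" using W(3) by auto
  then show ?l
    unfolding smooth_near_def o_def using c x W open_chart_preimage[OF c W(1)]
    by (intro bexI[of _ c] exI[of _ ?V]) auto
qed

lemma smooth_nearI: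
  assumes "c \<in> A" "x \<in> fst c" "open W" "snd c x \<in> W" "W \<subseteq> snd c ` fst c"
    "smooth_on W (\<lambda>p. f (chart_inv c p))"
  shows "smooth_near A x f"
  using smooth_near_chart[OF assms(1,2)] assms by blast

lemma smooth_near_smooth_on:
  assumes c: "c \<in> A" and V: "V \<subseteq> fst c" and f: "\<And>x. x \<in> V \<Longrightarrow> smooth_near A x f"
  shows "smooth_on (snd c ` V) (\<lambda>p. f (chart_inv c p))"
proof (rule smooth_on_local)
  fix p assume "p \<in> snd c ` V"
  then obtain x where x: "x \<in> V" "p = snd c x" by blast
  then show "\<exists>W. open W \<and> p \<in> W \<and> smooth_on W (\<lambda>p. f (chart_inv c p))"
    using smooth_near_chart[OF c, of x f] f[OF x(1)] V by blast
qed

lemma smooth_near_has_derivative: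
  assumes "c \<in> A" "x \<in> fst c" "smooth_near A x f"
  shows "((\<lambda>p. f (chart_inv c p)) has_derivative (\<lambda>w. frechet_derivative (\<lambda>p. f (chart_inv c p)) (at (snd c x)) w))
    (at (snd c x))"
  using smooth_near_chart[OF assms(1,2), of f] assms(3) smooth_on_has_derivative by blast

lemma linear_chart_vec:
  fixes x :: 'm
  assumes "c \<in> A" "x \<in> fst c"
  shows "linear (chart_vec A c x)"
proof (rule linearI)
  fix v w :: 'e and r :: real
  have lin: "linear (frechet_derivative (\<lambda>p. f (chart_inv c p)) (at (snd c x)))" if "smooth_near A x f"
    for f :: "'m \<Rightarrow> real"
    using smooth_near_has_derivative[OF assms that] has_derivative_linear by blast
  show "chart_vec A c x (v + w) = chart_vec A c x v + chart_vec A c x w"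
    by (rule ext) (simp add: chart_vec_def o_def linear_add[OF lin])
  show "chart_vec A c x (r *\<^sub>R v) = r *\<^sub>R chart_vec A c x v"
    by (rule ext) (simp add: chart_vec_def o_def scaleR_fun_def linear_scale[OF lin])
qed

lemma inj_chart_vec:
  fixes x :: 'm
  assumes "c \<in> A" "x \<in> fst c"
  shows "inj (chart_vec A c x)"
proof (rule injI)
  fix v w :: 'e assume eq: "chart_vec A c x v = chart_vec A c x w"
  \<comment> \<open>A test function separating v from w: its derivative along h is
    \<open>h \<bullet> (v - w)\<close>, so equal tangent vectors force \<open>v - w\<close> to be
    orthogonal to itself.\<close>
  let ?f = "\<lambda>y. snd c y \<bullet> (v - w)"
  have op: "open (snd c ` fst c)" by (rule open_chart_image[OF assms(1)])
  have eqf: "?f (chart_inv c p) = p \<bullet> (v - w)" if "p \<in> snd c ` fst c" for p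
    using chart_inv_right[OF assms(1) that] by simp
  have "smooth_on (snd c ` fst c) (\<lambda>p. p \<bullet> (v - w))"
    by (rule smooth_on_linear[OF op bounded_linear_inner_left])
  then have "smooth_on (snd c ` fst c) (\<lambda>p. ?f (chart_inv c p))"
    by (rule smooth_on_cong[OF op, rotated]) (simp add: eqf)
  then have sm: "smooth_near A x ?f"
    using assms op by (intro smooth_nearI[OF assms, of "snd c ` fst c"]) auto
  have "((\<lambda>p. p \<bullet> (v - w)) has_derivative (\<lambda>h. h \<bullet> (v - w))) (at (snd c x))"
    by (rule bounded_linear_imp_has_derivative[OF bounded_linear_inner_left])
  then have "((\<lambda>p. ?f (chart_inv c p)) has_derivative (\<lambda>h. h \<bullet> (v - w))) (at (snd c x))"
    by (rule has_derivative_transform_within_open[OF _ op]) (use assms eqf in auto)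
  then have "frechet_derivative (\<lambda>p. ?f (chart_inv c p)) (at (snd c x)) = (\<lambda>h. h \<bullet> (v - w))"
    by (rule frechet_derivative_at[symmetric])
  then have "chart_vec A c x h ?f = h \<bullet> (v - w)" for h
    using sm by (simp add: chart_vec_def o_def)
  then have "v \<bullet> (v - w) = w \<bullet> (v - w)"
    using eq by metis
  then have "(v - w) \<bullet> (v - w) = 0" by (simp add: inner_diff_left)
  then show "v = w" by simp
qed

end

text \<open>The chain rule, with T as the coordinate expression of F. T has to be smooth on a
  neighbourhood and not just differentiable at the point, since a tangent vector returns 0 unless
  \<open>g \<circ> F\<close> is smooth near x.\<close>

lemma pushforward_chart_vec:
  fixes A :: "('m::topological_space, 'e::real_inner) atlas"
    and B :: "('n::topological_space, 'f::real_inner) atlas"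
  assumes A: "smooth_atlas A" and B: "smooth_atlas B"
    and c: "c \<in> A" "x \<in> fst c" and c': "c' \<in> B"
    and W: "open W" "snd c x \<in> W" "W \<subseteq> snd c ` fst c"
    and F: "\<And>p. p \<in> W \<Longrightarrow> F (chart_inv c p) \<in> fst c'"
    and T: "\<And>p. p \<in> W \<Longrightarrow> snd c' (F (chart_inv c p)) = T p" "smooth_on W T"
    and T': "(T has_derivative T') (at (snd c x))"
  shows "pushforward B F x (chart_vec A c x w) = chart_vec B c' (F x) (T' w)"
proof (rule ext)
  fix g
  have inv: "chart_inv c (snd c x) = x" by (rule chart_inv_left[OF A c])
  have Fx: "F x \<in> fst c'" and Tx: "snd c' (F x) = T (snd c x)"
    using F[OF W(2)] T(1)[OF W(2)] inv by simp_all
  obtain C :: "'f set" where C: "orthonormal_basis C"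
    using atlas_orthonormal_basis[OF B] by blast
  show "pushforward B F x (chart_vec A c x w) g = chart_vec B c' (F x) (T' w) g"
  proof (cases "smooth_near B (F x) g")
    case True
    then obtain Q where Q: "open Q" "snd c' (F x) \<in> Q" "Q \<subseteq> snd c' ` fst c'"
        "smooth_on Q (\<lambda>p. g (chart_inv c' p))"
      using smooth_near_chart[OF B c' Fx, of g] by blast
    have Wop: "open (T -` Q \<inter> W)"
      using continuous_on_open_vimage[OF W(1)] smooth_on_continuous_on[OF T(2)] Q(1) by blast
    have eq: "g (chart_inv c' (T p)) = g (F (chart_inv c p))" if "p \<in> T -` Q \<inter> W" for p
      using T(1)[of p] F[of p] chart_inv_left[OF B c', of "F (chart_inv c p)"] that by simp
    have "smooth_on (T -` Q \<inter> W) (\<lambda>p. g (chart_inv c' (T p)))"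
      by (rule smooth_on_compose[OF C Wop Q(1) _ smooth_on_subset[OF T(2)] Q(4)]) auto
    then have "smooth_on (T -` Q \<inter> W) (\<lambda>p. (g \<circ> F) (chart_inv c p))"
      by (rule smooth_on_cong[OF Wop, rotated]) (simp add: eq)
    moreover have xW: "snd c x \<in> T -` Q \<inter> W" using W(2) Q(2) Tx by simp
    ultimately have sm: "smooth_near A x (g \<circ> F)"
      using W(3) by (intro smooth_nearI[OF A c Wop]) auto
    let ?G = "frechet_derivative (\<lambda>p. g (chart_inv c' p)) (at (T (snd c x)))"
    have "((\<lambda>p. g (chart_inv c' p)) has_derivative ?G) (at (T (snd c x)))"
      using smooth_on_has_derivative[OF Q(4,2)] Tx by simp
    from has_derivative_compose[OF T' this]
    have "((\<lambda>p. g (chart_inv c' (T p))) has_derivative (\<lambda>w. ?G (T' w))) (at (snd c x))" .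
    then have "((\<lambda>p. g (F (chart_inv c p))) has_derivative (\<lambda>w. ?G (T' w))) (at (snd c x))"
      by (rule has_derivative_transform_within_open[OF _ Wop xW]) (rule eq)
    then have "frechet_derivative (\<lambda>p. g (F (chart_inv c p))) (at (snd c x)) = (\<lambda>w. ?G (T' w))"
      by (rule frechet_derivative_at[symmetric])
    then show ?thesis using True sm
      by (simp add: pushforward_def chart_vec_def o_def Tx)
  qed (simp add: pushforward_def chart_vec_def)
qed

text \<open>A vector coming from another chart is its own pushforward under the identity, because
  \<open>chart_vec\<close> already vanishes on functions that are not smooth near x. In coordinates
  that pushforward is the derivative of the transition map.\<close>

lemma tangent_eq_range:
  assumes A: "smooth_atlas A" and c: "c \<in> A" "x \<in> fst c"
  shows "tangent A x = range (chart_vec A c x)"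
proof -
  have "chart_vec A c' x w \<in> range (chart_vec A c x)" if c': "c' \<in> A" "x \<in> fst c'" for c' w
  proof -
    let ?W = "snd c' ` (fst c' \<inter> fst c)" and ?T = "\<lambda>p. snd c (chart_inv c' p)"
    have W: "open ?W" "snd c' x \<in> ?W" "?W \<subseteq> snd c' ` fst c'"
      using open_chart_image_subset[OF A c'(1) open_Int[OF open_chart_domain[OF A c'(1)] open_chart_domain[OF A c(1)]]]
        c c' by auto
    note T = smooth_transition[OF A c'(1) c(1)]
    have "pushforward A (\<lambda>y. y) x (chart_vec A c' x w)
        = chart_vec A c x (frechet_derivative ?T (at (snd c' x)) w)"
      by (rule pushforward_chart_vec[OF A A c' c(1) W _ refl T smooth_on_has_derivative[OF T W(2)]])
        (use chart_inv_left[OF A c'(1)] in auto)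
    moreover have "pushforward A (\<lambda>y. y) x (chart_vec A c' x w) = chart_vec A c' x w"
      by (auto simp: pushforward_def chart_vec_def o_def)
    ultimately show ?thesis by simp
  qed
  then show ?thesis
    unfolding tangent_def using c by blast
qed

section \<open>Product charts and product atlases\<close>

definition prod_chart :: "('m, 'e) chart \<Rightarrow> ('n, 'f) chart \<Rightarrow> ('m \<times> 'n, 'e \<times> 'f) chart" where
  "prod_chart c d = (fst c \<times> fst d, map_prod (snd c) (snd d))"

lemma fst_prod_chart [simp]: "fst (prod_chart c d) = fst c \<times> fst d"
  and snd_prod_chart [simp]: "snd (prod_chart c d) (x, y) = (snd c x, snd d y)"
  by (simp_all add: prod_chart_def)

lemma prod_chart_image [simp]: "snd (prod_chart c d) ` (U \<times> V) = snd c ` U \<times> snd d ` V"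
  by (force simp: prod_chart_def)

lemma prod_atlas_eq: "prod_atlas A B = {prod_chart c d | c d. c \<in> A \<and> d \<in> B}"
  unfolding prod_atlas_def prod_chart_def by auto

lemma prod_chart_in [intro]: "c \<in> A \<Longrightarrow> d \<in> B \<Longrightarrow> prod_chart c d \<in> prod_atlas A B"
  unfolding prod_atlas_eq by blast

text \<open>\<open>chart_inv\<close> is an \<open>inv_into\<close>, so it is identified through
  injectivity, and only over the images of the charts.\<close>

lemma chart_inv_prod:
  assumes A: "smooth_atlas A" and B: "smooth_atlas B" and c: "c \<in> A" "d \<in> B"
    and p: "p \<in> snd c ` fst c" "q \<in> snd d ` fst d"
  shows "chart_inv (prod_chart c d) (p, q) = (chart_inv c p, chart_inv d q)"
proof -
  have inj: "inj_on (snd (prod_chart c d)) (fst (prod_chart c d))"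
    by (auto simp: inj_on_def) (metis chart_inv_left A c(1), metis chart_inv_left B c(2))
  have "(chart_inv c p, chart_inv d q) \<in> fst (prod_chart c d)"
    "snd (prod_chart c d) (chart_inv c p, chart_inv d q) = (p, q)"
    using chart_inv_in[OF A c(1) p(1)] chart_inv_in[OF B c(2) p(2)]
      chart_inv_right[OF A c(1) p(1)] chart_inv_right[OF B c(2) p(2)] by simp_all
  then show ?thesis
    unfolding chart_inv_def[of "prod_chart c d"] using inv_into_f_eq[OF inj] by metis
qed

lemma span_prod_finite:
  assumes "finite (B :: 'a::real_vector set)" "span B = UNIV" "finite (B' :: 'b::real_vector set)" "span B' = UNIV"
  shows "\<exists>D::('a \<times> 'b) set. finite D \<and> span D = UNIV"
proof -
  let ?i = "\<lambda>a::'a. (a, 0::'b)" and ?j = "\<lambda>b::'b. (0::'a, b)"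
  have lin: "linear ?i" "linear ?j" by (auto intro!: linearI)
  have "(a, b) \<in> span (?i ` B \<union> ?j ` B')" for a b
  proof -
    have "?i a \<in> span (?i ` B)" "?j b \<in> span (?j ` B')"
      unfolding linear_span_image[OF lin(1)] linear_span_image[OF lin(2)] assms by auto
    then have "?i a + ?j b \<in> span (?i ` B \<union> ?j ` B')"
      by (intro span_add) (meson span_mono sup_ge1 sup_ge2 subsetD)+
    then show ?thesis by simp
  qed
  then have "span (?i ` B \<union> ?j ` B') = UNIV" by auto
  then show ?thesis
    using assms(1,3) by (intro exI[of _ "?i ` B \<union> ?j ` B'"]) simp
qed

text \<open>A transition map of the product is a pair of transition maps of the factors, each
  precomposed with a linear projection.\<close>

lemma smooth_atlas_prod:
  fixes A :: "('m::topological_space, 'e::real_inner) atlas"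
    and B :: "('n::topological_space, 'f::real_inner) atlas"
  assumes A: "smooth_atlas A" and B: "smooth_atlas B"
  shows "smooth_atlas (prod_atlas A B)"
  unfolding smooth_atlas_def
proof (intro conjI ballI)
  show "\<exists>D::('e \<times> 'f) set. finite D \<and> span D = UNIV"
  proof -
    obtain D :: "'e set" and D' :: "'f set" where "finite D" "span D = UNIV" "finite D'" "span D' = UNIV"
      using A B unfolding smooth_atlas_def by auto
    then show ?thesis by (rule span_prod_finite)
  qed
  show "\<Union> (fst ` prod_atlas A B) = UNIV"
  proof -
    have "z \<in> \<Union> (fst ` prod_atlas A B)" for z
    proof -
      obtain c d where "c \<in> A" "fst z \<in> fst c" "d \<in> B" "snd z \<in> fst d"
        using chart_exists[OF A] chart_exists[OF B] by blast
      then have "z \<in> fst (prod_chart c d)" "prod_chart c d \<in> prod_atlas A B"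
        by (auto simp: mem_Times_iff)
      then show ?thesis by blast
    qed
    then show ?thesis by blast
  qed
next
  fix k assume "k \<in> prod_atlas A B"
  then obtain c d where k: "k = prod_chart c d" "c \<in> A" "d \<in> B" by (auto simp: prod_atlas_eq)
  show "open (fst k)"
    using k open_chart_domain[OF A k(2)] open_chart_domain[OF B k(3)] by (simp add: open_Times)
  show op: "open (snd k ` fst k)"
    using k open_chart_image[OF A k(2)] open_chart_image[OF B k(3)] by (simp add: open_Times)
  have hc: "homeomorphism (fst c) (snd c ` fst c) (snd c) (chart_inv c)"
    and hd: "homeomorphism (fst d) (snd d ` fst d) (snd d) (chart_inv d)"
    using chart_homeomorphism[OF A k(2)] chart_homeomorphism[OF B k(3)] .
  have inv: "chart_inv k z = (chart_inv c (fst z), chart_inv d (snd z))" if "z \<in> snd k ` fst k" for z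
  proof -
    have "fst z \<in> snd c ` fst c" "snd z \<in> snd d ` fst d"
      using that unfolding k(1) fst_prod_chart prod_chart_image by auto
    from chart_inv_prod[OF A B k(2,3) this] show ?thesis by (simp add: k(1))
  qed
  show "homeomorphism (fst k) (snd k ` fst k) (snd k) (chart_inv k)"
  proof (rule homeomorphismI)
    have "continuous_on (fst k) (\<lambda>z. (snd c (fst z), snd d (snd z)))"
      unfolding k(1) fst_prod_chart
      by (intro continuous_on_Pair continuous_on_compose2[OF homeomorphism_cont1[OF hc]]
          continuous_on_compose2[OF homeomorphism_cont1[OF hd]] continuous_on_fst continuous_on_snd continuous_on_id)
        auto
    then show "continuous_on (fst k) (snd k)"
      by (simp add: k(1) prod_chart_def map_prod_def case_prod_beta)
    have "continuous_on (snd k ` fst k) (\<lambda>z. (chart_inv c (fst z), chart_inv d (snd z)))"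
      unfolding k(1) fst_prod_chart prod_chart_image
      by (intro continuous_on_Pair continuous_on_compose2[OF homeomorphism_cont2[OF hc]]
          continuous_on_compose2[OF homeomorphism_cont2[OF hd]] continuous_on_fst continuous_on_snd continuous_on_id)
        auto
    then show "continuous_on (snd k ` fst k) (chart_inv k)"
      by (rule continuous_on_eq) (simp add: inv)
    show "snd k ` fst k \<subseteq> snd k ` fst k" by simp
    show "chart_inv k ` (snd k ` fst k) \<subseteq> fst k"
      using inv chart_inv_in[OF A k(2)] chart_inv_in[OF B k(3)] by (auto simp: k(1))
    show "chart_inv k (snd k z) = z" if "z \<in> fst k" for z
      using that inv[of "snd k z"] chart_inv_left[OF A k(2)] chart_inv_left[OF B k(3)]
      by (auto simp: k(1))
    show "snd k (chart_inv k z) = z" if "z \<in> snd k ` fst k" for z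
      using that inv[of z] chart_inv_right[OF A k(2)] chart_inv_right[OF B k(3)]
      by (auto simp: k(1))
  qed
  fix k' assume "k' \<in> prod_atlas A B"
  then obtain c' d' where k': "k' = prod_chart c' d'" "c' \<in> A" "d' \<in> B" by (auto simp: prod_atlas_eq)
  obtain C :: "'e set" and C' :: "'f set" where C: "orthonormal_basis C" "orthonormal_basis C'"
    using atlas_orthonormal_basis[OF A] atlas_orthonormal_basis[OF B] by blast
  let ?W = "snd c ` (fst c \<inter> fst c')" and ?W' = "snd d ` (fst d \<inter> fst d')"
  have Weq: "snd k ` (fst k \<inter> fst k') = ?W \<times> ?W'"
    by (simp add: k(1) k'(1) Times_Int_Times)
  have W: "open ?W" "open ?W'"
    using open_chart_image_subset[OF A k(2) open_Int[OF open_chart_domain[OF A k(2)] open_chart_domain[OF A k'(2)]]]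
      open_chart_image_subset[OF B k(3) open_Int[OF open_chart_domain[OF B k(3)] open_chart_domain[OF B k'(3)]]]
    by simp_all
  note WW = open_Times[OF W]
  have "smooth_on (?W \<times> ?W') (\<lambda>z. snd c' (chart_inv c (fst z)))"
    by (rule smooth_on_compose[OF C(1) WW W(1) _ smooth_on_linear[OF WW bounded_linear_fst]
        smooth_transition[OF A k(2) k'(2)]]) auto
  moreover have "smooth_on (?W \<times> ?W') (\<lambda>z. snd d' (chart_inv d (snd z)))"
    by (rule smooth_on_compose[OF C(2) WW W(2) _ smooth_on_linear[OF WW bounded_linear_snd]
        smooth_transition[OF B k(3) k'(3)]]) auto
  ultimately have "smooth_on (?W \<times> ?W') (\<lambda>z. (snd c' (chart_inv c (fst z)), snd d' (chart_inv d (snd z))))"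
    by (rule smooth_on_Pair[OF WW])
  then show "smooth_on (snd k ` (fst k \<inter> fst k')) (snd k' \<circ> chart_inv k)"
    unfolding Weq
  proof (rule smooth_on_cong[OF WW, rotated])
    fix z assume z: "z \<in> ?W \<times> ?W'"
    then have "z \<in> snd k ` fst k" unfolding k(1) fst_prod_chart prod_chart_image by auto
    from inv[OF this] show "(snd c' (chart_inv c (fst z)), snd d' (chart_inv d (snd z)))
        = (snd k' \<circ> chart_inv k) z"
      by (simp add: k'(1))
  qed
qed


section \<open>Complex lines and contraction\<close>

lemma scaleC_zero_left [simp]: "0 *\<^sub>C (x::'a::complex_vector) = 0"
  using scaleR_scaleC[of 0 x] by simp

lemma scaleC_zero_right [simp]: "z *\<^sub>C (0::'a::complex_vector) = 0"
  using scaleC_scaleC[of z 0 "0::'a"] by simp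

lemma linear_scaleC_left: "linear (\<lambda>z. z *\<^sub>C (x::'a::complex_vector))"
  by (rule linearI) (simp_all add: scaleC_add_left scaleR_scaleC scaleC_scaleC scaleC_complex_def)

lemma scaleC_minus_left: "(- z) *\<^sub>C (x::'a::complex_vector) = - (z *\<^sub>C x)"
  by (rule linear_neg[OF linear_scaleC_left])

lemma scaleC_eq_0_iff [simp]: "z *\<^sub>C x = 0 \<longleftrightarrow> z = 0 \<or> (x::'a::complex_vector) = 0"
proof
  assume z: "z *\<^sub>C x = 0"
  show "z = 0 \<or> x = 0"
  proof (rule ccontr)
    assume nz: "\<not> (z = 0 \<or> x = 0)"
    have "x = (inverse z * z) *\<^sub>C x" using nz by (simp add: scaleC_one)
    also have "\<dots> = inverse z *\<^sub>C z *\<^sub>C x" by (simp only: scaleC_scaleC)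
    finally show False using z nz by simp
  qed
qed auto

lemma scaleC_cancel_right: "e \<noteq> 0 \<Longrightarrow> z *\<^sub>C e = w *\<^sub>C e \<longleftrightarrow> z = (w::complex)" for e :: "'a::complex_vector"
proof
  assume e: "e \<noteq> 0" "z *\<^sub>C e = w *\<^sub>C e"
  have "(z + - w) *\<^sub>C e = z *\<^sub>C e + (- w) *\<^sub>C e" by (rule scaleC_add_left)
  then have "(z - w) *\<^sub>C e = 0" using e(2) by (simp add: scaleC_minus_left)
  then show "z = w" using e(1) by simp
qed simp

definition line_basis :: "'a::complex_vector \<Rightarrow> 'a set \<Rightarrow> bool" where
  "line_basis e V \<longleftrightarrow> e \<noteq> 0 \<and> V = range (\<lambda>z. z *\<^sub>C e)"

lemma line_basis_self: "line_basis e V \<Longrightarrow> e \<in> V"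
  unfolding line_basis_def using scaleC_one by (metis rangeI)

lemma line_basisI:
  assumes "complex_line V" "e \<in> V" "e \<noteq> 0"
  shows "line_basis e V"
proof -
  obtain f where f: "f \<noteq> 0" "V = range (\<lambda>z. z *\<^sub>C f)"
    using assms(1) unfolding complex_line_def by blast
  obtain w where w: "e = w *\<^sub>C f" using assms(2) f(2) by blast
  have w0: "w \<noteq> 0" using w assms(3) by auto
  have "z *\<^sub>C f \<in> range (\<lambda>z. z *\<^sub>C e)" for z
  proof -
    have "z *\<^sub>C f = (z / w) *\<^sub>C e" unfolding w scaleC_scaleC using w0 by simp
    then show ?thesis by blast
  qed
  moreover have "z *\<^sub>C e \<in> V" for z unfolding w scaleC_scaleC f(2) by blast
  ultimately have "V = range (\<lambda>z. z *\<^sub>C e)" using f(2) by blast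
  then show ?thesis using assms(3) by (simp add: line_basis_def)
qed

text \<open>Justifies the reference vector that \<open>fibre_integral\<close> picks by
  \<open>SOME\<close> in each fibre.\<close>

lemma line_basis_some:
  assumes "complex_line V"
  shows "line_basis (SOME e. e \<in> V \<and> e \<noteq> 0) V"
proof -
  obtain f where f: "f \<noteq> 0" "V = range (\<lambda>z. z *\<^sub>C f)"
    using assms unfolding complex_line_def by blast
  then have "f \<in> V \<and> f \<noteq> 0" using line_basis_self[of f V] by (simp add: line_basis_def)
  then have "(SOME e. e \<in> V \<and> e \<noteq> 0) \<in> V \<and> (SOME e. e \<in> V \<and> e \<noteq> 0) \<noteq> 0" by (rule someI)
  then show ?thesis using line_basisI[OF assms] by blast
qed

lemma line_basis_complex_line: "line_basis e V \<Longrightarrow> complex_line V"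
  unfolding line_basis_def complex_line_def by blast

lemma line_coord_scaleC: "e \<noteq> 0 \<Longrightarrow> line_coord e (z *\<^sub>C e) = z"
  unfolding line_coord_def by (simp add: scaleC_cancel_right)

lemma scaleC_line_coord:
  assumes "line_basis e V" "v \<in> V"
  shows "line_coord e v *\<^sub>C e = v"
proof -
  obtain z where "v = z *\<^sub>C e" using assms by (auto simp: line_basis_def)
  then show ?thesis using assms(1) by (simp add: line_coord_scaleC line_basis_def)
qed

lemma line_basis_scaleC_in: "line_basis e V \<Longrightarrow> z *\<^sub>C e \<in> V"
  by (simp add: line_basis_def)

text \<open>For a local frame e of a bundle, the functional \<open>dual_vec (e x)\<close> on the
  fibre at x is the frame that \<open>dual_bundle\<close> derives from e.\<close>

definition dual_vec :: "'a::complex_vector \<Rightarrow> 'a set \<Rightarrow> 'a \<Rightarrow> complex" where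
  "dual_vec e V = (\<lambda>v. if v \<in> V then line_coord e v else 0)"

lemma dual_vec_self: "line_basis e V \<Longrightarrow> dual_vec e V e = 1"
  using line_coord_scaleC[of e 1] line_basis_self[of e V]
  by (simp add: dual_vec_def line_basis_def scaleC_one)

lemma dual_vec_scaleC: "line_basis e V \<Longrightarrow> dual_vec e V (z *\<^sub>C e) = z"
  using line_coord_scaleC[of e z] line_basis_scaleC_in[of e V]
  by (simp add: dual_vec_def line_basis_def)

lemma dual_space_scaleC: "f \<in> dual_space V \<Longrightarrow> v \<in> V \<Longrightarrow> f (z *\<^sub>C v) = z * f v"
  by (simp add: dual_space_def)

lemma dual_vec_in_dual_space:
  assumes "line_basis e V"
  shows "dual_vec e V \<in> dual_space V"
proof -
  have V: "V = range (\<lambda>z. z *\<^sub>C e)" using assms by (simp add: line_basis_def)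
  have "dual_vec e V (u + v) = dual_vec e V u + dual_vec e V v" if uv: "u \<in> V" "v \<in> V" for u v
  proof -
    obtain a b where "u = a *\<^sub>C e" "v = b *\<^sub>C e" using uv V by auto
    then show ?thesis
      by (simp add: dual_vec_scaleC[OF assms] scaleC_add_left[symmetric])
  qed
  moreover have "dual_vec e V (z *\<^sub>C v) = z * dual_vec e V v" if v: "v \<in> V" for z v
  proof -
    obtain a where "v = a *\<^sub>C e" using v V by auto
    then show ?thesis
      by (simp add: dual_vec_scaleC[OF assms] scaleC_scaleC)
  qed
  ultimately show ?thesis by (simp add: dual_space_def) (simp add: dual_vec_def)
qed

lemma line_basis_dual:
  assumes "line_basis e V"
  shows "line_basis (dual_vec e V) (dual_space V)"
proof -
  let ?d = "dual_vec e V"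
  have d: "?d \<in> dual_space V" by (rule dual_vec_in_dual_space[OF assms])
  have "?d \<noteq> 0"
    using dual_vec_self[OF assms] by (metis zero_fun_apply zero_neq_one)
  moreover have "f = f e *\<^sub>C ?d" if f: "f \<in> dual_space V" for f
  proof (rule ext)
    fix v show "f v = (f e *\<^sub>C ?d) v"
    proof (cases "v \<in> V")
      case True
      then obtain a where "v = a *\<^sub>C e" using assms by (auto simp: line_basis_def)
      then show ?thesis
        using dual_space_scaleC[OF f line_basis_self[OF assms]] dual_vec_scaleC[OF assms]
        by (simp add: scaleC_fun_def scaleC_complex_def)
    next
      case False
      then show ?thesis using f by (simp add: scaleC_fun_def scaleC_complex_def dual_vec_def dual_space_def)
    qed
  qed
  moreover have "z *\<^sub>C ?d \<in> dual_space V" for z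
    using d by (auto simp: dual_space_def scaleC_fun_def scaleC_complex_def algebra_simps)
  ultimately show ?thesis unfolding line_basis_def by blast
qed

lemma tensor_scaleC:
  assumes "line_basis e V" "line_basis f W"
  shows "tensor V W (z *\<^sub>C e) (w *\<^sub>C f) = (z * w) *\<^sub>C tensor V W e f"
proof (intro ext)
  fix \<phi> \<psi>
  show "tensor V W (z *\<^sub>C e) (w *\<^sub>C f) \<phi> \<psi> = ((z * w) *\<^sub>C tensor V W e f) \<phi> \<psi>"
  proof (cases "\<phi> \<in> dual_space V \<and> \<psi> \<in> dual_space W")
    case True
    then have "\<phi> (z *\<^sub>C e) = z * \<phi> e" "\<psi> (w *\<^sub>C f) = w * \<psi> f"
      using dual_space_scaleC[OF _ line_basis_self[OF assms(1)]] dual_space_scaleC[OF _ line_basis_self[OF assms(2)]]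
      by blast+
    with True show ?thesis
      by (simp only: tensor_def scaleC_fun_def scaleC_complex_def if_True) simp
  qed (auto simp: tensor_def scaleC_fun_def scaleC_complex_def)
qed

text \<open>The generator is nonzero because it takes the value 1 on the pair of dual vectors, and
  every pure tensor is a multiple of it by bilinearity.\<close>

lemma line_basis_tensor:
  assumes e: "line_basis e V" and f: "line_basis f W"
  shows "line_basis (tensor V W e f) (tensor_line V W)"
proof -
  have "tensor V W e f (dual_vec e V) (dual_vec f W) = 1"
    by (simp add: tensor_def dual_vec_in_dual_space[OF e] dual_vec_in_dual_space[OF f]
        dual_vec_self[OF e] dual_vec_self[OF f])
  then have "tensor V W e f \<noteq> 0" by (metis zero_fun_apply zero_neq_one)
  moreover have "tensor_line V W = range (\<lambda>z. z *\<^sub>C tensor V W e f)"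
  proof (intro set_eqI iffI)
    fix t assume "t \<in> tensor_line V W"
    then obtain a b where "a \<in> V" "b \<in> W" "t = tensor V W a b" by (auto simp: tensor_line_def)
    moreover from this obtain z w where "a = z *\<^sub>C e" "b = w *\<^sub>C f"
      using e f by (auto simp: line_basis_def)
    ultimately show "t \<in> range (\<lambda>z. z *\<^sub>C tensor V W e f)"
      using tensor_scaleC[OF e f] by auto
  next
    fix t assume "t \<in> range (\<lambda>z. z *\<^sub>C tensor V W e f)"
    then obtain z where "t = z *\<^sub>C tensor V W e f" by blast
    then have "t = tensor V W (z *\<^sub>C e) (1 *\<^sub>C f)" using tensor_scaleC[OF e f, of z 1] by simp
    then show "t \<in> tensor_line V W"
      using line_basis_scaleC_in[OF e] line_basis_scaleC_in[OF f] unfolding tensor_line_def by blast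
  qed
  ultimately show ?thesis by (simp add: line_basis_def)
qed

text \<open>The \<open>THE\<close> in \<open>contraction\<close> ranges over all ways to split a
  tensor into four factors. In coordinates the tensor fixes only the product of the four scalars,
  and the contracted value depends on that product alone. The scalar z makes the lemma serve as
  linearity as well.\<close>

lemma contraction_scaleC:
  assumes e: "line_basis e U" and f: "line_basis f V" and g: "line_basis g W"
  shows "contraction U V W (z *\<^sub>C tensor (tensor_line U (dual_space V)) (tensor_line V (dual_space W))
      (tensor U (dual_space V) e (dual_vec f V)) (tensor V (dual_space W) f (dual_vec g W)))
    = z *\<^sub>C tensor U (dual_space W) e (dual_vec g W)"
proof -
  note f' = line_basis_dual[OF f] and g' = line_basis_dual[OF g]
  note ef = line_basis_tensor[OF e f'] and fg = line_basis_tensor[OF f g']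
  let ?T = "tensor (tensor_line U (dual_space V)) (tensor_line V (dual_space W))"
  let ?t = "?T (tensor U (dual_space V) e (dual_vec f V)) (tensor V (dual_space W) f (dual_vec g W))"
  let ?r = "tensor U (dual_space W) e (dual_vec g W)"
  have T: "?T (tensor U (dual_space V) (a *\<^sub>C e) (b *\<^sub>C dual_vec f V))
      (tensor V (dual_space W) (c *\<^sub>C f) (d *\<^sub>C dual_vec g W)) = (a * b * (c * d)) *\<^sub>C ?t" for a b c d
    by (simp only: tensor_scaleC[OF e f'] tensor_scaleC[OF f g'] tensor_scaleC[OF ef fg])
  have R: "(b *\<^sub>C dual_vec f V) (c *\<^sub>C f) *\<^sub>C tensor U (dual_space W) (a *\<^sub>C e) (d *\<^sub>C dual_vec g W)
      = (a * b * (c * d)) *\<^sub>C ?r" for a b c d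
    by (simp add: tensor_scaleC[OF e g'] scaleC_scaleC dual_vec_scaleC[OF f] scaleC_fun_def[of b "dual_vec f V"]
        scaleC_complex_def mult_ac)
  have t0: "?t \<noteq> 0" using line_basis_tensor[OF ef fg] by (simp add: line_basis_def)
  show ?thesis
    unfolding contraction_def
  proof (rule the_equality)
    have "z *\<^sub>C ?t = ?T (tensor U (dual_space V) (z *\<^sub>C e) (1 *\<^sub>C dual_vec f V))
      (tensor V (dual_space W) (1 *\<^sub>C f) (1 *\<^sub>C dual_vec g W))"
      unfolding T by simp
    moreover have "z *\<^sub>C ?r = (1 *\<^sub>C dual_vec f V) (1 *\<^sub>C f) *\<^sub>C tensor U (dual_space W) (z *\<^sub>C e) (1 *\<^sub>C dual_vec g W)"
      unfolding R by simp
    ultimately show "\<exists>a\<in>U. \<exists>\<phi>\<in>dual_space V. \<exists>b\<in>V. \<exists>\<psi>\<in>dual_space W.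
       z *\<^sub>C ?t = ?T (tensor U (dual_space V) a \<phi>) (tensor V (dual_space W) b \<psi>) \<and>
       z *\<^sub>C ?r = \<phi> b *\<^sub>C tensor U (dual_space W) a \<psi>"
      using line_basis_scaleC_in[OF e] line_basis_scaleC_in[OF f'] line_basis_scaleC_in[OF f]
        line_basis_scaleC_in[OF g'] by blast
  next
    fix r assume "\<exists>a\<in>U. \<exists>\<phi>\<in>dual_space V. \<exists>b\<in>V. \<exists>\<psi>\<in>dual_space W.
       z *\<^sub>C ?t = ?T (tensor U (dual_space V) a \<phi>) (tensor V (dual_space W) b \<psi>) \<and>
       r = \<phi> b *\<^sub>C tensor U (dual_space W) a \<psi>"
    then obtain a \<phi> b \<psi> where abcd: "a \<in> U" "\<phi> \<in> dual_space V" "b \<in> V" "\<psi> \<in> dual_space W"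
      and zt: "z *\<^sub>C ?t = ?T (tensor U (dual_space V) a \<phi>) (tensor V (dual_space W) b \<psi>)"
      and r: "r = \<phi> b *\<^sub>C tensor U (dual_space W) a \<psi>"
      by blast
    obtain a' where a: "a = a' *\<^sub>C e" using abcd(1) e by (auto simp: line_basis_def)
    obtain b' where b: "\<phi> = b' *\<^sub>C dual_vec f V" using abcd(2) f' by (auto simp: line_basis_def)
    obtain c' where c: "b = c' *\<^sub>C f" using abcd(3) f by (auto simp: line_basis_def)
    obtain d' where d: "\<psi> = d' *\<^sub>C dual_vec g W" using abcd(4) g' by (auto simp: line_basis_def)
    have "z *\<^sub>C ?t = (a' * b' * (c' * d')) *\<^sub>C ?t"
      using zt unfolding a b c d T .
    then have "z = a' * b' * (c' * d')"
      using scaleC_cancel_right[OF t0] by blast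
    then show "r = z *\<^sub>C ?r" unfolding r a b c d R by simp
  qed
qed


section \<open>Integration over a compact symplectic manifold\<close>

text \<open>A compact Hausdorff space is normal. Open sets V and V' first separate x from the
  complement of Q, and the Urysohn function vanishes off V; the closure of its support then avoids
  V' and stays inside Q.\<close>

lemma bump_function_exists:
  fixes x :: "'n::t2_space"
  assumes cpt: "compact (UNIV :: 'n set)" and Q: "open Q" "x \<in> Q"
  shows "\<exists>\<rho>. continuous_on UNIV \<rho> \<and> (\<forall>y. 0 \<le> \<rho> y) \<and> \<rho> x = (1::real) \<and> closure {y. \<rho> y \<noteq> 0} \<subseteq> Q"
proof -
  have "\<exists>U V. open U \<and> open V \<and> a \<in> U \<and> b \<in> V \<and> disjnt U V" if "a \<noteq> b" for a b :: 'n
    using hausdorff[OF that] by (auto simp: disjnt_def)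
  then have "Hausdorff_space (euclidean :: 'n topology)"
    unfolding Hausdorff_space_def by (simp flip: open_openin)
  then have nrm: "normal_space (euclidean :: 'n topology)"
    using cpt by (intro compact_Hausdorff_or_regular_imp_normal_space) (simp_all add: compact_space_def)
  have cl: "closedin euclidean {x}" "closedin euclidean (- Q)" "disjnt {x} (- Q)"
    using Q unfolding closed_closedin[symmetric] by (auto simp: disjnt_def)
  have "\<exists>V V'. openin euclidean V \<and> openin euclidean V' \<and> {x} \<subseteq> V \<and> - Q \<subseteq> V' \<and> disjnt V V'"
    by (rule nrm[unfolded normal_space_def, rule_format]) (intro conjI cl)
  then obtain V V' where V: "openin euclidean V" "openin euclidean V'" "{x} \<subseteq> V" "- Q \<subseteq> V'" "disjnt V V'"
    by (elim exE conjE) (rule that)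
  have opV: "open V" "open V'"
    using V(1,2) by (simp_all only: open_openin)
  have "closedin euclidean (- V)" "disjnt (- V) {x}"
    using V(3) opV unfolding closed_closedin[symmetric] by (auto simp: disjnt_def)
  then obtain f :: "'n \<Rightarrow> real" where f: "continuous_map euclidean (top_of_set {0..1}) f"
      "f ` (- V) \<subseteq> {0}" "f ` {x} \<subseteq> {1}"
    using Urysohn_lemma[OF nrm _ \<open>closedin euclidean {x}\<close>, of "- V" 0 1] by auto
  have "continuous_on UNIV f" "\<And>y. 0 \<le> f y"
    using f(1) by (auto simp: continuous_map_in_subtopology image_subset_iff)
  moreover have "closure {y. f y \<noteq> 0} \<subseteq> - V'"
    by (rule closure_minimal) (use f(2) V(5) opV in \<open>auto simp: disjnt_def\<close>)
  ultimately show ?thesis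
    using f(3) V(4) by (intro exI[of _ f]) auto
qed

text \<open>Compactness selects finitely many bump functions whose sum is positive everywhere, and
  dividing by this continuous sum leaves their supports unchanged.\<close>

lemma partition_of_unity_exists:
  fixes A :: "('n::t2_space, 'f::real_inner) atlas"
  assumes A: "smooth_atlas A" and cpt: "compact (UNIV :: 'n set)"
  shows "\<exists>P. partition_of_unity A P"
proof -
  have "\<forall>x. \<exists>c \<rho>. c \<in> A \<and> continuous_on UNIV \<rho> \<and> (\<forall>y. 0 \<le> \<rho> y) \<and> \<rho> x = (1::real)
      \<and> closure {y. \<rho> y \<noteq> 0} \<subseteq> fst c"
    using chart_exists[OF A] bump_function_exists[OF cpt open_chart_domain[OF A]] by meson
  then obtain c \<rho> where c: "\<And>x. c x \<in> A" "\<And>x. continuous_on UNIV (\<rho> x)" "\<And>x y. 0 \<le> \<rho> x y"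
      "\<And>x. \<rho> x x = (1::real)" "\<And>x. closure {y. \<rho> x y \<noteq> 0} \<subseteq> fst (c x)"
    by metis
  have op: "open {y. \<rho> x y > 0}" for x
    using open_Collect_less[OF continuous_on_const c(2)] .
  obtain D where D: "finite D" "UNIV \<subseteq> (\<Union>x\<in>D. {y. \<rho> x y > 0})"
  proof -
    have "UNIV \<subseteq> (\<Union>x\<in>UNIV. {y. \<rho> x y > 0})" using c(4) by (metis (mono_tags) UN_I UNIV_I mem_Collect_eq subsetI zero_less_one)
    from compactE_image[OF cpt op this] show ?thesis using that by metis
  qed
  obtain xs where xs: "set xs = D" "distinct xs" using finite_distinct_list[OF D(1)] by blast
  define s where "s y = (\<Sum>x\<in>D. \<rho> x y)" for y
  have s: "s y > 0" for y
  proof -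
    obtain x where "x \<in> D" "\<rho> x y > 0" using D(2) by blast
    then show ?thesis unfolding s_def using c(3) D(1) by (intro sum_pos2[of D x]) auto
  qed
  have cs: "continuous_on UNIV s" unfolding s_def using c(2) by (intro continuous_on_sum) auto
  let ?P = "map (\<lambda>x. (c x, \<lambda>y. \<rho> x y / s y)) xs"
  have "(\<Sum>(c, \<rho>)\<leftarrow>?P. \<rho> y) = 1" for y
  proof -
    have "(\<Sum>(c, \<rho>)\<leftarrow>?P. \<rho> y) = (\<Sum>x\<in>D. \<rho> x y / s y)"
      using xs by (simp add: o_def sum_list_distinct_conv_sum_set)
    also have "\<dots> = 1" using s[of y] by (simp add: s_def sum_divide_distrib[symmetric])
    finally show ?thesis .
  qed
  moreover have "continuous_on UNIV (\<lambda>y. \<rho> x y / s y)" for x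
    using c(2) cs s by (intro continuous_on_divide) (auto simp: less_imp_neq[symmetric])
  moreover have "0 \<le> \<rho> x y / s y" for x y
    using c(3) s by (simp add: less_imp_le)
  moreover have "{y. \<rho> x y / s y \<noteq> 0} = {y. \<rho> x y \<noteq> 0}" for x
    using s by (auto simp: less_imp_neq[symmetric])
  ultimately have "partition_of_unity A ?P"
    using c unfolding partition_of_unity_def by auto
  then show ?thesis by blast
qed

lemma model_basis_props:
  fixes C :: "'f::real_inner set"
  assumes "orthonormal_basis C"
  defines "bs \<equiv> model_basis :: 'f list"
  shows "\<And>i j. i < length bs \<Longrightarrow> j < length bs \<Longrightarrow> bs ! i \<bullet> bs ! j = (if i = j then 1 else 0)"
    and "span (set bs) = UNIV"
proof -
  let ?p = "\<lambda>bs :: 'f list. (\<forall>i<length bs. \<forall>j<length bs. bs ! i \<bullet> bs ! j = (if i = j then 1 else 0)) \<and>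
     span (set bs) = UNIV"
  obtain cs where cs: "set cs = C" "distinct cs"
    using finite_distinct_list[of C] assms(1)[unfolded orthonormal_basis_def] by blast
  have "cs ! i \<bullet> cs ! j = (if i = j then 1 else 0)" if "i < length cs" "j < length cs" for i j
  proof -
    have "cs ! i \<in> C" "cs ! j \<in> C" using that cs(1) by auto
    then have "cs ! i \<bullet> cs ! j = (if cs ! i = cs ! j then 1 else 0)"
      using assms(1) unfolding orthonormal_basis_def by blast
    then show ?thesis using nth_eq_iff_index_eq[OF cs(2) that] by simp
  qed
  moreover have "span (set cs) = UNIV" using assms(1) cs(1) by (simp add: orthonormal_basis_def)
  ultimately have "?p cs" by blast
  then have "?p bs"
    unfolding bs_def model_basis_def by (rule someI[of ?p])
  then show "\<And>i j. i < length bs \<Longrightarrow> j < length bs \<Longrightarrow> bs ! i \<bullet> bs ! j = (if i = j then 1 else 0)"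
    "span (set bs) = UNIV" by blast+
qed

text \<open>Adding measurable functions termwise would ask for second countability of the target,
  which \<open>real_inner\<close> does not include. Extending u by 0 maps it into the countable
  power of the reals, where product and Borel measurable sets agree, and there the sum is a
  continuous function.\<close>

lemma measurable_coordinates:
  fixes b :: "nat \<Rightarrow> 'f::real_inner"
  shows "(\<lambda>u. \<Sum>i<d. u i *\<^sub>R b i) \<in> measurable (\<Pi>\<^sub>M i\<in>{..<d}. (lborel :: real measure)) borel"
proof -
  let ?M = "\<Pi>\<^sub>M i\<in>{..<d}. (lborel :: real measure)"
  have "(\<lambda>u i. if i < d then u i else 0) \<in> measurable ?M (\<Pi>\<^sub>M i\<in>(UNIV::nat set). (borel :: real measure))"
  proof (rule measurable_PiM_single')
    fix i :: nat
    show "(\<lambda>u. if i < d then u i else 0) \<in> measurable ?M (borel :: real measure)"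
    proof (cases "i < d")
      case True
      then have "(\<lambda>u. u i) \<in> measurable ?M lborel"
        by (intro measurable_component_singleton) auto
      then show ?thesis using True by simp
    qed simp
  qed auto
  then have E: "(\<lambda>u i. if i < d then u i else 0) \<in> measurable ?M (borel :: (nat \<Rightarrow> real) measure)"
    using measurable_cong_sets[OF refl sets_PiM_equal_borel] by blast
  have "continuous_on UNIV (\<lambda>v :: nat \<Rightarrow> real. \<Sum>i<d. v i *\<^sub>R b i)"
    by (intro continuous_on_sum continuous_on_scaleR continuous_on_product_coordinates continuous_on_const)
  then have "(\<lambda>v :: nat \<Rightarrow> real. \<Sum>i<d. v i *\<^sub>R b i) \<in> borel_measurable borel"
    by (rule borel_measurable_continuous_onI)
  from measurable_compose[OF E this] show ?thesis
    by (rule iffD1[OF measurable_cong, rotated]) simp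
qed

text \<open>Such boxes will dominate the weights, whose supports are bounded in coordinates.\<close>

lemma emeasure_box_finite:
  fixes d :: nat
  shows "(\<Pi>\<^sub>E i\<in>{..<d}. {-r..r}) \<in> sets (\<Pi>\<^sub>M i\<in>{..<d}. (lborel :: real measure))"
  "emeasure (\<Pi>\<^sub>M i\<in>{..<d}. (lborel :: real measure)) (\<Pi>\<^sub>E i\<in>{..<d}. {-r..r}) < \<infinity>"
proof -
  interpret product_sigma_finite "\<lambda>i::nat. lborel :: real measure"
    by unfold_locales
  show "(\<Pi>\<^sub>E i\<in>{..<d}. {-r..r}) \<in> sets (\<Pi>\<^sub>M i\<in>{..<d}. (lborel :: real measure))"
    by (rule sets_PiM_I_finite) auto
  show "emeasure (\<Pi>\<^sub>M i\<in>{..<d}. (lborel :: real measure)) (\<Pi>\<^sub>E i\<in>{..<d}. {-r..r}) < \<infinity>"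
    by (subst emeasure_PiM) (auto simp: power_eq_top_ennreal less_top[symmetric] emeasure_lborel_Icc_eq)
qed

lemma continuous_on_shuffle_sum:
  assumes "\<And>l r. continuous_on S (\<lambda>x. f x l r)"
  shows "continuous_on S (\<lambda>x. shuffle_sum vs (f x) :: 'v::real_normed_vector)"
  using assms
proof (induction vs arbitrary: f)
  case (Cons v vs)
  show ?case
    unfolding shuffle_sum.simps
    by (rule continuous_on_add, rule Cons.IH, rule Cons.prems, rule Cons.IH,
        rule continuous_on_scaleR, rule continuous_on_const, rule Cons.prems)
qed simp

lemma real_forms_continuous:
  assumes A: "smooth_atlas A" and c: "c \<in> A" and \<omega>: "\<omega> \<in> real_forms A"
  shows "continuous_on (snd c ` fst c) (\<lambda>p. \<omega> (chart_inv c p) (map (chart_vec A c (chart_inv c p)) ws))"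
  using \<omega> c unfolding real_forms_def
  by (intro smooth_on_continuous_on smooth_near_smooth_on[OF A c order_refl,
        of "\<lambda>x. \<omega> x (map (chart_vec A c x) ws)"]) auto

text \<open>This makes the sign of the Liouville form a measurable function in each chart.\<close>

lemma wedge_power_continuous:
  assumes A: "smooth_atlas A" and c: "c \<in> A" and \<omega>: "\<omega> \<in> real_forms A"
  shows "continuous_on (snd c ` fst c) (\<lambda>p. wedge_power \<omega> n (chart_inv c p) (map (chart_vec A c (chart_inv c p)) ws))"
proof (induction n arbitrary: ws)
  case 0
  then show ?case by simp
next
  case (Suc n)
  show ?case
    unfolding wedge_power.simps rwedge_def wedge_eq_shuffle_sum shuffle_sum_map
    by (intro continuous_on_shuffle_sum continuous_on_scaleR real_forms_continuous[OF A c \<omega>] Suc.IH)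
qed

text \<open>
  The weights \<open>\<theta>\<close> collect the partition of unity and the sign of the Liouville form, and \<open>K\<close>
  is the support of the partition function in the chart.
\<close>
lemma symplectic_integral_expand:
  fixes A :: "('n::t2_space, 'f::real_inner) atlas"
  assumes A: "smooth_atlas A" and cpt: "compact (UNIV :: 'n set)" and \<omega>: "\<omega> \<in> real_forms A"
  shows "\<exists>(P :: (('n, 'f) chart \<times> ((nat \<Rightarrow> real) \<Rightarrow> real) \<times> 'f set) list) (N :: (nat \<Rightarrow> real) measure) Y bs.
    Y \<in> measurable N borel \<and>
    (\<forall>(c, \<theta>, K)\<in>set P. c \<in> A \<and> compact K \<and> K \<subseteq> snd c ` fst c \<and> integrable N \<theta> \<and>
       (\<forall>u\<in>space N. \<theta> u \<noteq> 0 \<longrightarrow> Y u \<in> K)) \<and>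
    (\<forall>\<mu>. symplectic_integral A \<omega> \<mu> = (\<Sum>(c, \<theta>, K)\<leftarrow>P.
       \<integral>u. \<theta> u *\<^sub>R \<mu> (chart_inv c (Y u)) (map (chart_vec A c (chart_inv c (Y u))) bs) \<partial>N))"
proof -
  define bs where "bs = (model_basis :: 'f list)"
  define d where "d = length bs"
  define P where "P = (SOME P. partition_of_unity A P)"
  have P: "partition_of_unity A P"
    unfolding P_def using partition_of_unity_exists[OF A cpt] by (rule someI_ex)
  obtain C :: "'f set" where C: "orthonormal_basis C"
    using atlas_orthonormal_basis[OF A] by blast
  note bs = model_basis_props[OF C, folded bs_def]
  define N where "N = (\<Pi>\<^sub>M i\<in>{..<d}. (lborel :: real measure))"
  define Y where "Y u = (\<Sum>i<d. u i *\<^sub>R bs ! i)" for u :: "nat \<Rightarrow> real"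
  have Y: "Y \<in> measurable N borel"
    unfolding Y_def[abs_def] N_def by (rule measurable_coordinates)
  define W where "W c y = wedge_power \<omega> (d div 2) (chart_inv c y) (map (chart_vec A c (chart_inv c y)) bs)" for c y
  define wt where "wt c \<rho> u = (if Y u \<in> snd c ` fst c then \<rho> (chart_inv c (Y u)) * sgn (W c (Y u)) else 0)"
    for c :: "('n, 'f) chart" and \<rho> :: "'n \<Rightarrow> real" and u
  define Kp where "Kp c \<rho> = snd c ` closure {x. \<rho> x \<noteq> 0}" for c :: "('n, 'f) chart" and \<rho> :: "'n \<Rightarrow> real"
  have P1: "c \<in> A" "continuous_on UNIV \<rho>" "0 \<le> \<rho> x" "closure {x. \<rho> x \<noteq> 0} \<subseteq> fst c" "\<rho> x \<le> 1"
    if "(c, \<rho>) \<in> set P" for c \<rho> x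
  proof -
    show "c \<in> A" "continuous_on UNIV \<rho>" "0 \<le> \<rho> x" "closure {x. \<rho> x \<noteq> 0} \<subseteq> fst c"
      using P that unfolding partition_of_unity_def by auto
    have "(\<lambda>(c, \<rho>). \<rho> x) (c, \<rho>) \<le> (\<Sum>(c, \<rho>)\<leftarrow>P. \<rho> x)"
      using P that unfolding partition_of_unity_def by (intro member_le_sum_list) auto
    then show "\<rho> x \<le> 1" using P unfolding partition_of_unity_def by simp
  qed
  have K: "compact (Kp c \<rho>)" "Kp c \<rho> \<subseteq> snd c ` fst c" if c: "(c, \<rho>) \<in> set P" for c \<rho>
  proof -
    have "compact (closure {x. \<rho> x \<noteq> 0})"
      using compact_Int_closed[OF cpt closed_closure[of "{x. \<rho> x \<noteq> 0}"]] by simp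
    then show "compact (Kp c \<rho>)"
      unfolding Kp_def using chart_homeomorphism[OF A P1(1)[OF c]] P1(4)[OF c]
      by (intro compact_continuous_image) (auto simp: homeomorphism_def intro: continuous_on_subset)
    show "Kp c \<rho> \<subseteq> snd c ` fst c" unfolding Kp_def using P1(4)[OF c] by blast
  qed
  have supp: "Y u \<in> Kp c \<rho>" if c: "(c, \<rho>) \<in> set P" and u: "wt c \<rho> u \<noteq> 0" for c \<rho> u
  proof -
    have Yu: "Y u \<in> snd c ` fst c" "\<rho> (chart_inv c (Y u)) \<noteq> 0"
      using u by (auto simp: wt_def split: if_splits)
    then have "chart_inv c (Y u) \<in> closure {x. \<rho> x \<noteq> 0}"
      using closure_subset by fastforce
    then show ?thesis
      unfolding Kp_def using chart_inv_right[OF A P1(1)[OF c] Yu(1)] by (metis imageI)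
  qed
  have int: "integrable N (wt c \<rho>)" if c: "(c, \<rho>) \<in> set P" for c \<rho>
  proof -
    note cA = P1(1)[OF c]
    obtain r where r: "\<And>y. y \<in> Kp c \<rho> \<Longrightarrow> norm y \<le> r"
      using compact_imp_bounded[OF K(1)[OF c]] unfolding bounded_iff by blast
    have Kb: "Kp c \<rho> \<in> sets borel" using K(1)[OF c] by (intro borel_closed compact_imp_closed)
    have "continuous_on (Kp c \<rho>) (\<lambda>y. \<rho> (chart_inv c y))"
      by (rule continuous_on_compose2[OF P1(2)[OF c] continuous_on_subset[OF
            homeomorphism_cont2[OF chart_homeomorphism[OF A cA]] K(2)[OF c]]]) simp
    then have m1: "(\<lambda>y. indicator (Kp c \<rho>) y *\<^sub>R \<rho> (chart_inv c y)) \<in> borel_measurable borel"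
      by (rule borel_measurable_continuous_on_indicator[OF Kb])
    have "continuous_on (Kp c \<rho>) (W c)"
      unfolding W_def by (rule continuous_on_subset[OF wedge_power_continuous[OF A cA \<omega>] K(2)[OF c]])
    then have m2: "(\<lambda>y. indicator (Kp c \<rho>) y *\<^sub>R W c y) \<in> borel_measurable borel"
      by (rule borel_measurable_continuous_on_indicator[OF Kb])
    \<comment> \<open>Inserting the indicator changes nothing, since the weight vanishes off the
      compact set. It extends functions that are continuous only inside the chart image to Borel
      functions on the model space.\<close>
    have "wt c \<rho> = (\<lambda>u. (indicator (Kp c \<rho>) (Y u) *\<^sub>R \<rho> (chart_inv c (Y u))) *
        sgn (indicator (Kp c \<rho>) (Y u) *\<^sub>R W c (Y u)))"
    proof
      fix u
      show "wt c \<rho> u = (indicator (Kp c \<rho>) (Y u) *\<^sub>R \<rho> (chart_inv c (Y u))) *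
        sgn (indicator (Kp c \<rho>) (Y u) *\<^sub>R W c (Y u))"
      proof (cases "Y u \<in> Kp c \<rho>")
        case True
        then show ?thesis using K(2)[OF c] by (auto simp: wt_def)
      next
        case False
        then show ?thesis using supp[OF c, of u] by auto
      qed
    qed
    also have "\<dots> \<in> borel_measurable N"
      using measurable_compose[OF Y m1] measurable_compose[OF Y m2] by simp
    finally have m: "wt c \<rho> \<in> borel_measurable N" .
    \<comment> \<open>On the support, orthonormality gives
      \<open>u i = Y u \<bullet> bs ! i\<close>, so the norm bound r of the compact set bounds every
      coordinate. The weight is at most 1 in absolute value, hence dominated by the indicator of
      this box.\<close>
    let ?box = "\<Pi>\<^sub>E i\<in>{..<d}. {-r..r}"
    have "integrable N (indicator ?box :: _ \<Rightarrow> real)"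
      unfolding N_def using emeasure_box_finite by (intro integrable_real_indicator)
    then show ?thesis
    proof (rule Bochner_Integration.integrable_bound[OF _ m], intro AE_I2)
      fix u assume u: "u \<in> space N"
      show "norm (wt c \<rho> u) \<le> norm (indicator ?box u :: real)"
      proof (cases "wt c \<rho> u = 0")
        case False
        have "u i \<in> {-r..r}" if i: "i < d" for i
        proof -
          have "u i = Y u \<bullet> bs ! i"
          proof -
            have "Y u \<bullet> bs ! i = (\<Sum>j<d. u j * (if j = i then 1 else 0))"
              unfolding Y_def inner_sum_left inner_scaleR_left
              using bs(1) i unfolding d_def by (intro sum.cong) auto
            also have "\<dots> = u i" using i by (simp add: if_distrib cong: if_cong)
            finally show ?thesis by simp
          qed
          moreover have "\<bar>Y u \<bullet> bs ! i\<bar> \<le> norm (Y u) * norm (bs ! i)"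
            by (rule Cauchy_Schwarz_ineq2)
          moreover have "norm (bs ! i) = 1"
            using bs(1)[of i i] i unfolding d_def by (simp add: norm_eq_sqrt_inner)
          ultimately have "\<bar>u i\<bar> \<le> r" using r[OF supp[OF c False]] by simp
          then show ?thesis by auto
        qed
        moreover have "u \<in> extensional {..<d}"
          using u unfolding N_def by (simp add: space_PiM PiE_def)
        ultimately have "u \<in> ?box" by (auto simp: PiE_def)
        moreover have "\<bar>wt c \<rho> u\<bar> \<le> 1"
          using P1(3)[OF c] P1(5)[OF c] by (auto simp: wt_def abs_mult sgn_real_def)
        ultimately show ?thesis by simp
      qed simp
    qed
  qed
  have "symplectic_integral A \<omega> \<mu> = (\<Sum>(c, \<theta>, K)\<leftarrow>map (\<lambda>(c, \<rho>). (c, wt c \<rho>, Kp c \<rho>)) P.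
       \<integral>u. \<theta> u *\<^sub>R \<mu> (chart_inv c (Y u)) (map (chart_vec A c (chart_inv c (Y u))) bs) \<partial>N)" for \<mu>
  proof -
    have eq: "(let y = (\<Sum>i<d. u i *\<^sub>R bs ! i); x = chart_inv c y; vs = map (chart_vec A c x) bs in
         if y \<in> snd c ` fst c
         then (\<rho> x * sgn (wedge_power \<omega> (d div 2) x vs)) *\<^sub>R \<mu> x vs
         else 0)
      = wt c \<rho> u *\<^sub>R \<mu> (chart_inv c (Y u)) (map (chart_vec A c (chart_inv c (Y u))) bs)" for c \<rho> u
      by (simp add: Let_def wt_def W_def Y_def)
    have "symplectic_integral A \<omega> \<mu> = (\<Sum>(c, \<rho>)\<leftarrow>P. \<integral>u.
        (let y = (\<Sum>i<d. u i *\<^sub>R bs ! i); x = chart_inv c y; vs = map (chart_vec A c x) bs in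
         if y \<in> snd c ` fst c
         then (\<rho> x * sgn (wedge_power \<omega> (d div 2) x vs)) *\<^sub>R \<mu> x vs
         else 0) \<partial>(\<Pi>\<^sub>M i\<in>{..<d}. (lborel :: real measure)))"
      by (simp only: symplectic_integral_def Let_def bs_def d_def P_def)
    then show ?thesis
      unfolding eq N_def[symmetric] by (simp add: o_def case_prod_unfold)
  qed
  moreover have "\<forall>(c, \<theta>, K)\<in>set (map (\<lambda>(c, \<rho>). (c, wt c \<rho>, Kp c \<rho>)) P). c \<in> A \<and> compact K
      \<and> K \<subseteq> snd c ` fst c \<and> integrable N \<theta> \<and> (\<forall>u\<in>space N. \<theta> u \<noteq> 0 \<longrightarrow> Y u \<in> K)"
  proof
    fix t assume "t \<in> set (map (\<lambda>(c, \<rho>). (c, wt c \<rho>, Kp c \<rho>)) P)"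
    then obtain c \<rho> where c: "(c, \<rho>) \<in> set P" and t: "t = (c, wt c \<rho>, Kp c \<rho>)" by auto
    show "case t of (c, \<theta>, K) \<Rightarrow> c \<in> A \<and> compact K \<and> K \<subseteq> snd c ` fst c \<and> integrable N \<theta>
        \<and> (\<forall>u\<in>space N. \<theta> u \<noteq> 0 \<longrightarrow> Y u \<in> K)"
      unfolding t prod.case
      by (intro conjI ballI impI P1(1)[OF c] K[OF c] int[OF c]) (rule supp[OF c])
  qed
  ultimately show ?thesis
    using Y by blast
qed


section \<open>Forms in coordinates\<close>

lemma line_coord_add:
  assumes "line_basis e V" "u \<in> V" "v \<in> V"
  shows "line_coord e (u + v) = line_coord e u + line_coord e v"
proof -
  obtain a b where "u = a *\<^sub>C e" "v = b *\<^sub>C e" using assms by (auto simp: line_basis_def)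
  then show ?thesis
    using assms(1) by (simp add: line_basis_def line_coord_scaleC scaleC_add_left[symmetric])
qed

lemma line_coord_scaleR:
  assumes "line_basis e V" "v \<in> V"
  shows "line_coord e (r *\<^sub>R v) = r *\<^sub>R line_coord e v"
proof -
  obtain b where "v = b *\<^sub>C e" using assms by (auto simp: line_basis_def)
  then show ?thesis
    using assms(1) by (simp add: line_basis_def line_coord_scaleC scaleR_scaleC[of r "b *\<^sub>C e"] scaleC_scaleC scaleR_conv_of_real)
qed

lemma line_coord_zero: "e \<noteq> 0 \<Longrightarrow> line_coord e 0 = 0"
  using line_coord_scaleC[of e 0] by simp

text \<open>The passage from tangent vectors to model vectors and from values in a line to complex
  coefficients. \<open>line_coord\<close> is additive only on the line, hence the hypothesis on
  V.\<close>

lemma alt_form_alternating: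
  assumes A: "smooth_atlas A" and c: "c \<in> A" "x \<in> fst c" and e: "line_basis e V"
    and alt: "alt_form (tangent A x) a" and V: "\<And>vs. a vs \<in> V"
  shows "alternating (\<lambda>l. line_coord e (a (map (chart_vec A c x) l)))"
proof -
  let ?cv = "chart_vec A c x"
  note lin = linear_chart_vec[OF A c]
  have T: "tangent A x = range ?cv" by (rule tangent_eq_range[OF A c])
  \<comment> \<open>\<open>alt_form\<close> phrases linearity by updating a slot of a given list;
    \<open>?cv 0\<close> is a placeholder for that slot.\<close>
  have upd: "(map ?cv l @ ?cv 0 # map ?cv r)[length l := w] = map ?cv l @ w # map ?cv r" for l r w
    using list_update_length[of "map ?cv l"] by simp
  have sub: "set (map ?cv l @ ?cv v # map ?cv r) \<subseteq> tangent A x" for l v r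
    unfolding T by auto
  have add: "a (map ?cv l @ (u + v) # map ?cv r) = a (map ?cv l @ u # map ?cv r) + a (map ?cv l @ v # map ?cv r)"
    and scale: "a (map ?cv l @ (s *\<^sub>R u) # map ?cv r) = s *\<^sub>R a (map ?cv l @ u # map ?cv r)"
    if "u \<in> tangent A x" "v \<in> tangent A x" for l r u v s
    using alt[unfolded alt_form_def, THEN conjunct2, THEN conjunct2, rule_format,
        of "map ?cv l @ ?cv 0 # map ?cv r" "length l"] sub that unfolding upd by auto
  have "linear (\<lambda>v. line_coord e (a (map ?cv (l @ v # r))))" for l r
  proof (rule linearI)
    have tv: "?cv v \<in> tangent A x" for v unfolding T by auto
    show "line_coord e (a (map ?cv (l @ (u + v) # r))) = line_coord e (a (map ?cv (l @ u # r))) + line_coord e (a (map ?cv (l @ v # r)))" for u v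
      by (simp add: linear_add[OF lin] add[OF tv tv] line_coord_add[OF e V V])
    show "line_coord e (a (map ?cv (l @ (s *\<^sub>R v) # r))) = s *\<^sub>R line_coord e (a (map ?cv (l @ v # r)))" for s v
      by (simp add: linear_scale[OF lin] scale[OF tv tv] line_coord_scaleR[OF e V])
  qed
  moreover have "a (map ?cv (l @ v # v # r)) = 0" for l v r
    using alt[unfolded alt_form_def, THEN conjunct2, THEN conjunct1, rule_format, of "map ?cv (l @ v # v # r)"]
    unfolding T by auto
  ultimately show ?thesis
    using e unfolding alternating_def multilinear_form_def by (simp add: line_basis_def line_coord_zero)
qed

text \<open>The way back from coefficients to forms. A repeated tangent vector comes from a repeated
  model vector because \<open>chart_vec\<close> is injective.\<close>

lemma alternating_alt_form:
  assumes A: "smooth_atlas A" and c: "c \<in> A" "x \<in> fst c"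
    and off: "\<And>vs. \<not> set vs \<subseteq> tangent A x \<Longrightarrow> a vs = 0"
    and a: "\<And>l. a (map (chart_vec A c x) l) = F l *\<^sub>C e" and F: "alternating F"
  shows "alt_form (tangent A x) a"
proof -
  let ?cv = "chart_vec A c x"
  note lin = linear_chart_vec[OF A c]
  have T: "tangent A x = range ?cv" by (rule tangent_eq_range[OF A c])
  have ex: "\<exists>l. vs = map ?cv l" if "set vs \<subseteq> tangent A x" for vs
    unfolding ex_map_conv using that T by blast
  have "a vs = 0" if vs: "set vs \<subseteq> tangent A x" "\<not> distinct vs" for vs
  proof -
    obtain l where l: "vs = map ?cv l" using ex[OF vs(1)] by blast
    then have "\<not> distinct l"
      using vs(2) inj_chart_vec[OF A c] by (metis distinct_map inj_on_subset subset_UNIV)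
    then show ?thesis using alternating_not_distinct[OF F] a l by simp
  qed
  moreover have "a (vs[i := u + v]) = a (vs[i := u]) + a (vs[i := v]) \<and> a (vs[i := r *\<^sub>R u]) = r *\<^sub>R a (vs[i := u])"
    if vs: "set vs \<subseteq> tangent A x" "i < length vs" and uv: "u \<in> tangent A x" "v \<in> tangent A x" for vs i u v r
  proof -
    obtain l where l: "vs = map ?cv l" using ex[OF vs(1)] by blast
    obtain u' v' where u: "u = ?cv u'" "v = ?cv v'" using uv T by auto
    have lf: "linear (\<lambda>w. F (take i l @ w # drop (Suc i) l))"
      using F unfolding alternating_def multilinear_form_def by blast
    have upd: "a (vs[i := ?cv w]) = F (take i l @ w # drop (Suc i) l) *\<^sub>C e" for w
      using vs(2) unfolding l map_update[symmetric] a by (simp add: upd_conv_take_nth_drop)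
    show ?thesis
      unfolding u linear_add[OF lin, symmetric] linear_scale[OF lin, symmetric] upd
        linear_add[OF lf] linear_scale[OF lf]
      by (simp add: scaleC_add_left linear_scale[OF linear_scaleC_left])
  qed
  ultimately show ?thesis
    unfolding alt_form_def using off by blast
qed

lemma Omega_in_fibre: "\<alpha> \<in> Omega A E \<Longrightarrow> \<alpha> x vs \<in> fibre E x"
  unfolding Omega_def by blast

lemma Omega_alt_form: "\<alpha> \<in> Omega A E \<Longrightarrow> alt_form (tangent A x) (\<alpha> x)"
  unfolding Omega_def by blast

lemma Omega_smooth:
  assumes A: "smooth_atlas A" and \<alpha>: "\<alpha> \<in> Omega A E" and c: "c \<in> A" and U: "(U, \<phi>) \<in> frames E"
  shows "smooth_on (snd c ` (fst c \<inter> U)) (\<lambda>p. line_coord (\<phi> (chart_inv c p))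
    (\<alpha> (chart_inv c p) (map (chart_vec A c (chart_inv c p)) ws)))"
  using \<alpha> c U unfolding Omega_def
  by (intro smooth_near_smooth_on[OF A c Int_lower1, of U "\<lambda>x. line_coord (\<phi> x) (\<alpha> x (map (chart_vec A c x) ws))"])
    blast

lemma pushforward_affine:
  fixes A :: "('m::topological_space, 'e::real_inner) atlas"
    and B :: "('n::topological_space, 'f::real_inner) atlas"
  assumes A: "smooth_atlas A" and B: "smooth_atlas B"
    and c: "c \<in> A" "x \<in> fst c" and c': "c' \<in> B" and T: "bounded_linear T"
    and F: "\<And>y. y \<in> fst c \<Longrightarrow> F y \<in> fst c'" "\<And>y. y \<in> fst c \<Longrightarrow> snd c' (F y) = T (snd c y) + t"
  shows "pushforward B F x (chart_vec A c x w) = chart_vec B c' (F x) (T w)"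
proof (rule pushforward_chart_vec[OF A B c c' open_chart_image[OF A c(1)] _ order_refl])
  show "snd c x \<in> snd c ` fst c" using c(2) by blast
  show "F (chart_inv c p) \<in> fst c'" if "p \<in> snd c ` fst c" for p
    using F(1)[OF chart_inv_in[OF A c(1) that]] .
  show "snd c' (F (chart_inv c p)) = T p + t" if "p \<in> snd c ` fst c" for p
    using F(2)[OF chart_inv_in[OF A c(1) that]] chart_inv_right[OF A c(1) that] by simp
  show "smooth_on (snd c ` fst c) (\<lambda>p. T p + t)"
    by (intro smooth_on_add smooth_on_linear smooth_on_const T open_chart_image[OF A c(1)])
  show "((\<lambda>p. T p + t) has_derivative T) (at (snd c x))"
    using has_derivative_add[OF bounded_linear_imp_has_derivative[OF T] has_derivative_const] by simp
qed

lemma pushforward_fst: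
  assumes A: "smooth_atlas A" and B: "smooth_atlas B" and c: "c \<in> A" "x \<in> fst c" "d \<in> B" "y \<in> fst d"
  shows "pushforward A fst (x, y) (chart_vec (prod_atlas A B) (prod_chart c d) (x, y) w) = chart_vec A c x (fst w)"
proof -
  have "(x, y) \<in> fst (prod_chart c d)" using c by simp
  from pushforward_affine[OF smooth_atlas_prod[OF A B] A prod_chart_in[OF c(1,3)] this c(1) bounded_linear_fst,
      of fst 0 w] show ?thesis
    by (simp add: prod_chart_def split_beta mem_Times_iff)
qed

lemma pushforward_snd:
  assumes A: "smooth_atlas A" and B: "smooth_atlas B" and c: "c \<in> A" "x \<in> fst c" "d \<in> B" "y \<in> fst d"
  shows "pushforward B snd (x, y) (chart_vec (prod_atlas A B) (prod_chart c d) (x, y) w) = chart_vec B d y (snd w)"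
proof -
  have "(x, y) \<in> fst (prod_chart c d)" using c by simp
  from pushforward_affine[OF smooth_atlas_prod[OF A B] B prod_chart_in[OF c(1,3)] this c(3) bounded_linear_snd,
      of snd 0 w] show ?thesis
    by (simp add: prod_chart_def split_beta mem_Times_iff)
qed

lemma pullback_chart_vec:
  assumes A: "smooth_atlas A" and c: "c \<in> A" "x \<in> fst c"
    and push: "\<And>w. pushforward B F x (chart_vec A c x w) = chart_vec B c' (F x) (T w)"
  shows "pullback A B F \<alpha> x (map (chart_vec A c x) l) = \<alpha> (F x) (map (chart_vec B c' (F x)) (map T l))"
proof -
  have "set (map (chart_vec A c x) l) \<subseteq> tangent A x"
    unfolding tangent_eq_range[OF A c] by auto
  then show ?thesis
    by (simp add: pullback_def push o_def)
qed

lemma shuffle_sum_sum_list: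
  "shuffle_sum vs (\<lambda>a b. \<Sum>t\<leftarrow>ts. f t a b) = (\<Sum>t\<leftarrow>ts. shuffle_sum vs (f t))"
  by (induction ts) (simp_all add: shuffle_sum_zero shuffle_sum_add)

text \<open>Integrability and the exchange of sum and integral share one induction, since splitting
  the integral at each step requires both summands to be integrable.\<close>

lemma integrable_shuffle_sum:
  fixes f :: "'u \<Rightarrow> 'a list \<Rightarrow> 'a list \<Rightarrow> complex"
  assumes "\<And>a b. integrable N (\<lambda>u. f u a b)"
  shows "integrable N (\<lambda>u. shuffle_sum vs (f u)) \<and>
    shuffle_sum vs (\<lambda>a b. \<integral>u. f u a b \<partial>N) = (\<integral>u. shuffle_sum vs (f u) \<partial>N)"
  using assms
proof (induction vs arbitrary: f)
  case (Cons v vs)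
  have i2: "integrable N (\<lambda>u. (- 1) ^ length a *\<^sub>R f u a (v # b))" for a b
    using Cons.prems by simp
  have "(\<lambda>a b. (- 1) ^ length a *\<^sub>R (\<integral>u. f u a (v # b) \<partial>N)) = (\<lambda>a b. \<integral>u. (- 1) ^ length a *\<^sub>R f u a (v # b) \<partial>N)"
    by simp
  then show ?case
    using Cons.IH[of "\<lambda>u a b. f u (v # a) b", OF Cons.prems]
      Cons.IH[of "\<lambda>u a b. (- 1) ^ length a *\<^sub>R f u a (v # b)", OF i2]
    by simp
qed simp

lemma alternating_zero: "alternating (\<lambda>l. 0)"
  unfolding alternating_def multilinear_form_def by (simp add: linear_zero)

lemma alternating_add: "alternating f \<Longrightarrow> alternating g \<Longrightarrow> alternating (\<lambda>l. f l + g l)"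
  unfolding alternating_def multilinear_form_def by (simp add: linear_compose_add)

lemma alternating_scaleR: "alternating f \<Longrightarrow> alternating (\<lambda>l. r *\<^sub>R f l)"
  unfolding alternating_def multilinear_form_def by (simp add: linear_compose_scale_right)

lemma alternating_sum_list:
  "(\<And>t. t \<in> set ts \<Longrightarrow> alternating (f t)) \<Longrightarrow> alternating (\<lambda>l. \<Sum>t\<leftarrow>ts. f t l)"
  by (induction ts) (simp_all add: alternating_zero alternating_add)

lemma alternating_integral:
  fixes f :: "'u \<Rightarrow> 'a::real_vector list \<Rightarrow> complex"
  assumes "\<And>l. integrable N (\<lambda>u. f u l)" "\<And>u. u \<in> space N \<Longrightarrow> alternating (f u)"
  shows "alternating (\<lambda>l. \<integral>u. f u l \<partial>N)"
proof -
  have lin: "linear (\<lambda>v. f u (l @ v # r))" if "u \<in> space N" for u l r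
    using assms(2)[OF that] by (simp add: alternating_def multilinear_form_def)
  have "linear (\<lambda>v. \<integral>u. f u (l @ v # r) \<partial>N)" for l r
  proof (rule linearI)
    show "(\<integral>u. f u (l @ (v + w) # r) \<partial>N) = (\<integral>u. f u (l @ v # r) \<partial>N) + (\<integral>u. f u (l @ w # r) \<partial>N)" for v w
      unfolding Bochner_Integration.integral_add[OF assms(1) assms(1), symmetric]
      by (rule Bochner_Integration.integral_cong[OF refl]) (rule linear_add[OF lin])
    show "(\<integral>u. f u (l @ (s *\<^sub>R v) # r) \<partial>N) = s *\<^sub>R (\<integral>u. f u (l @ v # r) \<partial>N)" for s v
      unfolding integral_scaleR_right[symmetric]
      by (rule Bochner_Integration.integral_cong[OF refl]) (rule linear_scale[OF lin])
  qed
  moreover have "(\<integral>u. f u (l @ v # v # r) \<partial>N) = 0" for l v r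
  proof -
    have "(\<integral>u. f u (l @ v # v # r) \<partial>N) = (\<integral>u. 0 \<partial>N)"
      by (rule Bochner_Integration.integral_cong[OF refl]) (use assms(2) in \<open>simp add: alternating_def\<close>)
    then show ?thesis by simp
  qed
  ultimately show ?thesis by (simp add: alternating_def multilinear_form_def)
qed

section \<open>Frames of a bundle and of its tensor products with duals\<close>

lemma line_bundle_frame:
  assumes "is_line_bundle A L" "(U, e) \<in> frames L"
  shows "open U" "x \<in> U \<Longrightarrow> line_basis (e x) (fibre L x)"
proof -
  note L = assms(1)[unfolded is_line_bundle_def]
  have "open U \<and> (\<forall>x\<in>U. e x \<in> fibre L x \<and> e x \<noteq> 0)"
    using bspec[OF L[THEN conjunct2, THEN conjunct2, THEN conjunct1] assms(2)] by simp
  then show "open U" "x \<in> U \<Longrightarrow> line_basis (e x) (fibre L x)"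
    using line_basisI[OF L[THEN conjunct1, THEN spec]] by simp_all
qed

lemma line_bundle_frame_exists:
  assumes "is_line_bundle A L"
  shows "\<exists>U e. (U, e) \<in> frames L \<and> x \<in> U"
proof -
  have "\<Union> (fst ` frames L) = UNIV" using assms[unfolded is_line_bundle_def, THEN conjunct2, THEN conjunct1] .
  then have "x \<in> \<Union> (fst ` frames L)" by blast
  then show ?thesis by auto
qed

lemma line_bundle_basis_exists:
  assumes "is_line_bundle A L"
  shows "\<exists>e. line_basis e (fibre L x)"
  using line_bundle_frame_exists[OF assms, of x] line_bundle_frame(2)[OF assms] by blast

text \<open>Since v enters through its dual, a rescaling of v rescales the pairing inversely. This
  is what lets the basis over the middle manifold cancel.\<close>

definition pairing ::
  "('m, 'l::complex_vector) line_bundle \<Rightarrow> ('n, 'k::complex_vector) line_bundle \<Rightarrow> 'm \<Rightarrow> 'n \<Rightarrow> 'l \<Rightarrow> 'k \<Rightarrow>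
   ('l, 'k \<Rightarrow> complex) tensor" where
  "pairing L K x y u v = tensor (fibre L x) (dual_space (fibre K y)) u (dual_vec v (fibre K y))"

lemma fibre_ext_tensor_dual:
  "fibre (ext_tensor L (dual_bundle K)) (x, y) = tensor_line (fibre L x) (dual_space (fibre K y))"
  by (simp add: ext_tensor_def dual_bundle_def)

lemma frames_ext_tensor_dual:
  "frames (ext_tensor L (dual_bundle K)) = {(U \<times> V, \<lambda>(x, y). pairing L K x y (e x) (f y)) | U e V f. (U, e) \<in> frames L \<and> (V, f) \<in> frames K}"
  (is "?l = ?r")
proof (rule set_eqI, rule iffI)
  fix t assume "t \<in> ?l"
  then obtain U e V f' where t: "(U, e) \<in> frames L" "(V, f') \<in> frames (dual_bundle K)"
    "t = (U \<times> V, \<lambda>(x, y). tensor (fibre L x) (fibre (dual_bundle K) y) (e x) (f' y))"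
    unfolding ext_tensor_def line_bundle.simps by blast
  then obtain f where f: "(V, f) \<in> frames K" "f' = (\<lambda>y. dual_vec (f y) (fibre K y))"
    unfolding dual_bundle_def line_bundle.simps dual_vec_def by blast
  have "t = (U \<times> V, \<lambda>(x, y). pairing L K x y (e x) (f y))"
    unfolding t(3) f(2) pairing_def by (simp add: dual_bundle_def)
  then show "t \<in> ?r" using t(1) f(1) by blast
next
  fix t assume "t \<in> ?r"
  then obtain U e V f where t: "(U, e) \<in> frames L" "(V, f) \<in> frames K" "t = (U \<times> V, \<lambda>(x, y). pairing L K x y (e x) (f y))"
    by blast
  have "(V, \<lambda>y. dual_vec (f y) (fibre K y)) \<in> frames (dual_bundle K)"
    unfolding dual_bundle_def line_bundle.simps dual_vec_def using t(2) by blast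
  moreover have "t = (U \<times> V, \<lambda>(x, y). tensor (fibre L x) (fibre (dual_bundle K) y) (e x) (dual_vec (f y) (fibre K y)))"
    unfolding t(3) pairing_def by (simp add: dual_bundle_def)
  ultimately show "t \<in> ?l"
    unfolding ext_tensor_def line_bundle.simps
    by (intro CollectI exI[of _ U] exI[of _ e] exI[of _ V] exI[of _ "\<lambda>y. dual_vec (f y) (fibre K y)"] conjI t(1))
qed

lemma line_basis_pairing:
  "line_basis u (fibre L x) \<Longrightarrow> line_basis v (fibre K y) \<Longrightarrow>
   line_basis (pairing L K x y u v) (fibre (ext_tensor L (dual_bundle K)) (x, y))"
  unfolding fibre_ext_tensor_dual pairing_def by (intro line_basis_tensor line_basis_dual)


section \<open>The contracted exterior product in coordinates\<close>

text \<open>The integrand of \<open>composition\<close>, stated for bare atlases and bundles so that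
  its coordinate expression can be studied without symplectic data.\<close>

definition contracted_wedge ::
  "('m::topological_space, 'e::real_normed_vector) atlas \<Rightarrow> ('n::topological_space, 'f::real_normed_vector) atlas \<Rightarrow>
   ('p::topological_space, 'g::real_normed_vector) atlas \<Rightarrow>
   ('m, 'l::complex_vector) line_bundle \<Rightarrow> ('n, 'k::complex_vector) line_bundle \<Rightarrow> ('p, 'j::complex_vector) line_bundle \<Rightarrow>
   ('m \<times> 'n, ('l, 'k \<Rightarrow> complex) tensor) form \<Rightarrow> ('n \<times> 'p, ('k, 'j \<Rightarrow> complex) tensor) form \<Rightarrow>
   ('m \<times> 'n \<times> 'p, ('l, 'j \<Rightarrow> complex) tensor) form" where
  "contracted_wedge A B C L K J \<sigma> \<tau> = (\<lambda>(x, y, z) vs. contraction (fibre L x) (fibre K y) (fibre J z)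
     (wedge (\<lambda>(x, y, z). tensor (fibre (ext_tensor L (dual_bundle K)) (x, y)) (fibre (ext_tensor K (dual_bundle J)) (y, z)))
        (pullback (prod_atlas A (prod_atlas B C)) (prod_atlas A B) (\<lambda>(x, y, z). (x, y)) \<sigma>)
        (pullback (prod_atlas A (prod_atlas B C)) (prod_atlas B C) (\<lambda>(x, y, z). (y, z)) \<tau>) (x, y, z) vs))"

lemma composition_eq:
  "composition M N P \<sigma> \<tau> = fibre_integral (charts M) (charts N) (omega N) (charts P)
     (ext_tensor (line M) (dual_bundle (line P)))
     (contracted_wedge (charts M) (charts N) (charts P) (line M) (line N) (line P) \<sigma> \<tau>)"
  unfolding composition_def contracted_wedge_def prod_system_def dual_system_def Let_def by simp

lemma rwedge_chart:
  assumes "\<And>l. \<beta> p (map F l) = b l *\<^sub>C e"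
  shows "(\<alpha> \<and>\<^sub>R \<beta>) p (map F l) = shuffle_prod (\<lambda>l. complex_of_real (\<alpha> p (map F l))) b l *\<^sub>C e"
  unfolding rwedge_def wedge_eq_shuffle_sum shuffle_sum_map assms shuffle_prod_def
    linear_shuffle_sum[OF linear_scaleC_left]
  by (simp add: scaleR_scaleC scaleC_scaleC)

lemma pullback_diff_chart:
  fixes \<alpha> :: "('m::topological_space, real) form" and \<beta> :: "('n::topological_space, real) form"
  assumes A: "smooth_atlas A" and B: "smooth_atlas B" and c: "c \<in> A" "x \<in> fst c" "d \<in> B" "y \<in> fst d"
  shows "(pullback (prod_atlas A B) A fst \<alpha> + pullback (prod_atlas A B) B snd (- \<beta>)) (x, y)
      (map (chart_vec (prod_atlas A B) (prod_chart c d) (x, y)) l)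
    = \<alpha> x (map (chart_vec A c x) (map fst l)) - \<beta> y (map (chart_vec B d y) (map snd l))"
proof -
  have in1: "(x, y) \<in> fst (prod_chart c d)" using c by simp
  have "pullback (prod_atlas A B) A fst \<alpha> (x, y) (map (chart_vec (prod_atlas A B) (prod_chart c d) (x, y)) l)
      = \<alpha> (fst (x, y)) (map (chart_vec A c (fst (x, y))) (map fst l))"
    by (rule pullback_chart_vec[OF smooth_atlas_prod[OF A B] prod_chart_in[OF c(1,3)] in1])
      (simp add: pushforward_fst[OF A B c])
  moreover have "pullback (prod_atlas A B) B snd (- \<beta>) (x, y) (map (chart_vec (prod_atlas A B) (prod_chart c d) (x, y)) l)
      = (- \<beta>) (snd (x, y)) (map (chart_vec B d (snd (x, y))) (map snd l))"
    by (rule pullback_chart_vec[OF smooth_atlas_prod[OF A B] prod_chart_in[OF c(1,3)] in1])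
      (simp add: pushforward_snd[OF A B c])
  ultimately show ?thesis by simp
qed

text \<open>Linearity in the first slot. It is applied to vectors along the integrated factor, whose
  components in the two outer factors are 0.\<close>

lemma real_form_zero_arg:
  assumes A: "smooth_atlas A" and c: "c \<in> A" "x \<in> fst c" and \<omega>: "\<omega> \<in> real_forms A"
  shows "\<omega> x (map (chart_vec A c x) (0 # l)) = 0"
proof -
  let ?vs = "map (chart_vec A c x) (0 # l)"
  have T: "tangent A x = range (chart_vec A c x)" by (rule tangent_eq_range[OF A c])
  have alt: "alt_form (tangent A x) (\<omega> x)" using \<omega> unfolding real_forms_def by blast
  have u: "chart_vec A c x 0 \<in> tangent A x" and vs: "set ?vs \<subseteq> tangent A x" unfolding T by auto
  have "set ?vs \<subseteq> tangent A x \<and> 0 < length ?vs" using vs by simp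
  from alt[unfolded alt_form_def, THEN conjunct2, THEN conjunct2, THEN spec[of _ ?vs], THEN spec[of _ 0],
      THEN mp, OF this, THEN conjunct2, THEN bspec, OF u, THEN spec[of _ 0]]
  show ?thesis by (simp add: linear_0[OF linear_chart_vec[OF A c]])
qed

locale line_bundle_triple =
  fixes A :: "('m::t2_space, 'e::real_inner) atlas" and B :: "('n::t2_space, 'f::real_inner) atlas"
    and C :: "('p::t2_space, 'g::real_inner) atlas"
    and L :: "('m, 'l::complex_vector) line_bundle" and K :: "('n, 'k::complex_vector) line_bundle"
    and J :: "('p, 'j::complex_vector) line_bundle"
    and \<sigma> :: "('m \<times> 'n, ('l, 'k \<Rightarrow> complex) tensor) form" and \<tau> :: "('n \<times> 'p, ('k, 'j \<Rightarrow> complex) tensor) form"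
  assumes A: "smooth_atlas A" and B: "smooth_atlas B" and C: "smooth_atlas C"
    and L: "is_line_bundle A L" and K: "is_line_bundle B K" and J: "is_line_bundle C J"
    and \<sigma>: "\<sigma> \<in> Omega (prod_atlas A B) (ext_tensor L (dual_bundle K))"
    and \<tau>: "\<tau> \<in> Omega (prod_atlas B C) (ext_tensor K (dual_bundle J))"
begin

abbreviation "AB \<equiv> prod_atlas A B"
abbreviation "BC \<equiv> prod_atlas B C"
abbreviation "AC \<equiv> prod_atlas A C"
abbreviation "ABC \<equiv> prod_atlas A (prod_atlas B C)"

lemmas AB = smooth_atlas_prod[OF A B]
lemmas BC = smooth_atlas_prod[OF B C]
lemmas AC = smooth_atlas_prod[OF A C]
lemmas ABC = smooth_atlas_prod[OF A BC]

abbreviation frame3 where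
  "frame3 c d k x y z \<equiv> chart_vec ABC (prod_chart c (prod_chart d k)) (x, y, z)"

text \<open>The arguments e and f are vectors in the fibres at x and y, not local frames: the
  pointwise algebra allows any bases, and local frames are substituted only for smoothness.\<close>

definition \<sigma>c where "\<sigma>c c d e f x y l =
  line_coord (pairing L K x y e f) (\<sigma> (x, y) (map (chart_vec AB (prod_chart c d) (x, y)) l))"

definition \<tau>c where "\<tau>c d k f g y z l =
  line_coord (pairing K J y z f g) (\<tau> (y, z) (map (chart_vec BC (prod_chart d k) (y, z)) l))"

definition wedge_coord where "wedge_coord c d k e f g x y z =
  shuffle_prod (\<lambda>l. \<sigma>c c d e f x y (map (\<lambda>w. (fst w, fst (snd w))) l)) (\<lambda>l. \<tau>c d k f g y z (map snd l))"

definition \<zeta> where "\<zeta> = contracted_wedge A B C L K J \<sigma> \<tau>"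

lemma \<sigma>_eq:
  assumes "line_basis e (fibre L x)" "line_basis f (fibre K y)"
  shows "\<sigma> (x, y) (map (chart_vec AB (prod_chart c d) (x, y)) l) = \<sigma>c c d e f x y l *\<^sub>C pairing L K x y e f"
  unfolding \<sigma>c_def by (rule scaleC_line_coord[OF line_basis_pairing[OF assms] Omega_in_fibre[OF \<sigma>], symmetric])

lemma \<tau>_eq:
  assumes "line_basis f (fibre K y)" "line_basis g (fibre J z)"
  shows "\<tau> (y, z) (map (chart_vec BC (prod_chart d k) (y, z)) l) = \<tau>c d k f g y z l *\<^sub>C pairing K J y z f g"
  unfolding \<tau>c_def by (rule scaleC_line_coord[OF line_basis_pairing[OF assms] Omega_in_fibre[OF \<tau>], symmetric])

lemma bounded_linear_proj:
  "bounded_linear (\<lambda>w :: 'a::real_normed_vector \<times> 'b::real_normed_vector \<times> 'c::real_normed_vector. (fst w, fst (snd w)))"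
  by (intro bounded_linear_Pair bounded_linear_fst bounded_linear_compose[OF bounded_linear_fst bounded_linear_snd])

section \<open>Tangent maps of projections and slices of the triple product\<close>

context
  fixes c d k x y z
  assumes c: "c \<in> A" "x \<in> fst c" and d: "d \<in> B" "y \<in> fst d" and k: "k \<in> C" "z \<in> fst k"
begin

lemma chart3: "prod_chart c (prod_chart d k) \<in> ABC" "(x, y, z) \<in> fst (prod_chart c (prod_chart d k))"
  using c d k by (auto intro!: prod_chart_in)

lemma push_AB: "pushforward AB (\<lambda>(x, y, z). (x, y)) (x, y, z) (frame3 c d k x y z w)
    = chart_vec AB (prod_chart c d) (x, y) (fst w, fst (snd w))"
proof -
  have "pushforward AB (\<lambda>(x, y, z). (x, y)) (x, y, z) (frame3 c d k x y z w)
      = chart_vec AB (prod_chart c d) ((\<lambda>(x, y, z). (x, y)) (x, y, z)) (fst w, fst (snd w))"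
    by (rule pushforward_affine[OF ABC AB chart3 prod_chart_in[OF c(1) d(1)] bounded_linear_proj, where t = 0])
      (auto simp: prod_chart_def)
  then show ?thesis by simp
qed

lemma push_BC: "pushforward BC (\<lambda>(x, y, z). (y, z)) (x, y, z) (frame3 c d k x y z w)
    = chart_vec BC (prod_chart d k) (y, z) (snd w)"
proof -
  have "pushforward BC (\<lambda>(x, y, z). (y, z)) (x, y, z) (frame3 c d k x y z w)
      = chart_vec BC (prod_chart d k) ((\<lambda>(x, y, z). (y, z)) (x, y, z)) (snd w)"
    by (rule pushforward_affine[OF ABC BC chart3 prod_chart_in[OF d(1) k(1)] bounded_linear_snd, where t = 0])
      (auto simp: prod_chart_def)
  then show ?thesis by simp
qed

lemma push_fibre: "pushforward ABC (\<lambda>y'. (x, y', z)) y (chart_vec B d y v) = frame3 c d k x y z (0, v, 0)"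
  by (rule pushforward_affine[OF B ABC d chart3(1), where T = "\<lambda>v. (0, v, 0)" and t = "(snd c x, 0, snd k z)"])
    (use c k in \<open>auto simp: prod_chart_def intro!: bounded_linear_Pair bounded_linear_ident bounded_linear_zero\<close>)

lemma push_base: "pushforward ABC (\<lambda>(x', z'). (x', y, z')) (x, z) (chart_vec AC (prod_chart c k) (x, z) w)
    = frame3 c d k x y z (fst w, 0, snd w)"
proof -
  have "(x, z) \<in> fst (prod_chart c k)" using c k by simp
  then have "pushforward ABC (\<lambda>(x', z'). (x', y, z')) (x, z) (chart_vec AC (prod_chart c k) (x, z) w)
      = chart_vec ABC (prod_chart c (prod_chart d k)) ((\<lambda>(x', z'). (x', y, z')) (x, z)) (fst w, 0, snd w)"
    by (rule pushforward_affine[OF AC ABC prod_chart_in[OF c(1) k(1)] _ chart3(1),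
          where T = "\<lambda>w. (fst w, 0, snd w)" and t = "(0, snd d y, 0)"])
      (use d in \<open>auto simp: prod_chart_def intro!: bounded_linear_Pair bounded_linear_fst bounded_linear_snd bounded_linear_zero\<close>)
  then show ?thesis by simp
qed

text \<open>\<open>contraction\<close> has been evaluated only on multiples of one fixed tensor. All
  terms of the shuffle sum are multiples of the same \<open>?t\<close>, so they are collected into
  one scalar before contracting.\<close>

lemma \<zeta>_chart:
  assumes e: "line_basis e (fibre L x)" and f: "line_basis f (fibre K y)" and g: "line_basis g (fibre J z)"
  shows "\<zeta> (x, y, z) (map (frame3 c d k x y z) l) = wedge_coord c d k e f g x y z l *\<^sub>C pairing L J x z e g"
proof -
  let ?T = "tensor (tensor_line (fibre L x) (dual_space (fibre K y))) (tensor_line (fibre K y) (dual_space (fibre J z)))"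
  let ?t = "?T (pairing L K x y e f) (pairing K J y z f g)"
  have ef: "line_basis (pairing L K x y e f) (tensor_line (fibre L x) (dual_space (fibre K y)))"
    using line_basis_pairing[OF e f] by (simp only: fibre_ext_tensor_dual)
  have fg: "line_basis (pairing K J y z f g) (tensor_line (fibre K y) (dual_space (fibre J z)))"
    using line_basis_pairing[OF f g] by (simp only: fibre_ext_tensor_dual)
  have p1: "pullback ABC AB (\<lambda>(x, y, z). (x, y)) \<sigma> (x, y, z) (map (frame3 c d k x y z) l)
      = \<sigma>c c d e f x y (map (\<lambda>w. (fst w, fst (snd w))) l) *\<^sub>C pairing L K x y e f" for l
    using pullback_chart_vec[OF ABC chart3, of AB "\<lambda>(x, y, z). (x, y)" "prod_chart c d" "\<lambda>w. (fst w, fst (snd w))" \<sigma> l]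
      push_AB \<sigma>_eq[OF e f] by (simp del: map_map)
  have p2: "pullback ABC BC (\<lambda>(x, y, z). (y, z)) \<tau> (x, y, z) (map (frame3 c d k x y z) l)
      = \<tau>c d k f g y z (map snd l) *\<^sub>C pairing K J y z f g" for l
    using pullback_chart_vec[OF ABC chart3, of BC "\<lambda>(x, y, z). (y, z)" "prod_chart d k" snd \<tau> l]
      push_BC \<tau>_eq[OF f g] by (simp del: map_map)
  have "\<zeta> (x, y, z) (map (frame3 c d k x y z) l) = contraction (fibre L x) (fibre K y) (fibre J z)
      (shuffle_sum l (\<lambda>a b. (\<sigma>c c d e f x y (map (\<lambda>w. (fst w, fst (snd w))) a) * \<tau>c d k f g y z (map snd b)) *\<^sub>C ?t))"
    unfolding \<zeta>_def contracted_wedge_def prod.case wedge_eq_shuffle_sum shuffle_sum_map p1 p2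
      fibre_ext_tensor_dual tensor_scaleC[OF ef fg] ..
  also have "\<dots> = contraction (fibre L x) (fibre K y) (fibre J z) (wedge_coord c d k e f g x y z l *\<^sub>C ?t)"
    unfolding wedge_coord_def shuffle_prod_def linear_shuffle_sum[OF linear_scaleC_left] ..
  also have "\<dots> = wedge_coord c d k e f g x y z l *\<^sub>C pairing L J x z e g"
    unfolding pairing_def by (rule contraction_scaleC[OF e f g])
  finally show ?thesis .
qed

end

definition \<zeta>c where "\<zeta>c c d k e g x y z l =
  line_coord (pairing L J x z e g) (\<zeta> (x, y, z) (map (frame3 c d k x y z) l))"

context
  fixes c d k x y z e g
  assumes c: "c \<in> A" "x \<in> fst c" and d: "d \<in> B" "y \<in> fst d" and k: "k \<in> C" "z \<in> fst k"
    and e: "line_basis e (fibre L x)" and g: "line_basis g (fibre J z)"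
begin

text \<open>The left side does not mention f: the coefficient is the same for every basis of the
  middle fibre. So f may be chosen afresh at each point, or as a local frame when smoothness is at
  stake.\<close>

lemma \<zeta>c_eq:
  assumes "line_basis f (fibre K y)"
  shows "\<zeta>c c d k e g x y z = wedge_coord c d k e f g x y z"
  using line_basis_pairing[OF e g]
  by (intro ext) (simp add: \<zeta>c_def \<zeta>_chart[OF c d k e assms g] line_basis_def line_coord_scaleC)

lemma \<zeta>_eq: "\<zeta> (x, y, z) (map (frame3 c d k x y z) l) = \<zeta>c c d k e g x y z l *\<^sub>C pairing L J x z e g"
proof -
  obtain f where f: "line_basis f (fibre K y)" using line_bundle_basis_exists[OF K] by blast
  show ?thesis unfolding \<zeta>c_eq[OF f] by (rule \<zeta>_chart[OF c d k e f g])
qed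

lemma \<zeta>c_alternating: "alternating (\<zeta>c c d k e g x y z)"
proof -
  obtain f where f: "line_basis f (fibre K y)" using line_bundle_basis_exists[OF K] by blast
  have xy: "(x, y) \<in> fst (prod_chart c d)" and yz: "(y, z) \<in> fst (prod_chart d k)" using c d k by auto
  have "alternating (\<sigma>c c d e f x y)"
    unfolding \<sigma>c_def[abs_def]
    by (rule alt_form_alternating[OF AB prod_chart_in[OF c(1) d(1)] xy line_basis_pairing[OF e f]
          Omega_alt_form[OF \<sigma>] Omega_in_fibre[OF \<sigma>]])
  then have 1: "alternating (\<lambda>l :: ('e \<times> 'f \<times> 'g) list. \<sigma>c c d e f x y (map (\<lambda>w. (fst w, fst (snd w))) l))"
    by (rule alternating_map[OF bounded_linear.linear[OF bounded_linear_proj]])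
  have "alternating (\<tau>c d k f g y z)"
    unfolding \<tau>c_def[abs_def]
    by (rule alt_form_alternating[OF BC prod_chart_in[OF d(1) k(1)] yz line_basis_pairing[OF f g]
          Omega_alt_form[OF \<tau>] Omega_in_fibre[OF \<tau>]])
  then have 2: "alternating (\<lambda>l :: ('e \<times> 'f \<times> 'g) list. \<tau>c d k f g y z (map snd l))"
    by (rule alternating_map[OF bounded_linear.linear[OF bounded_linear_snd]])
  show ?thesis
    unfolding \<zeta>c_eq[OF f] wedge_coord_def by (rule alternating_shuffle_prod[OF 1 2])
qed

end

text \<open>Smoothness is claimed over the whole chart of N although frames of K exist only locally.
  It is a local property, and near each point a local frame of K computes the same coefficient by
  \<open>\<zeta>c_eq\<close>. The variables are grouped as ((x, z), y) to fit
  \<open>smooth_on_integral\<close>.\<close>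

lemma \<zeta>c_smooth:
  assumes c: "c \<in> A" and d: "d \<in> B" and k: "k \<in> C" and e: "(U, e) \<in> frames L" and g: "(V, g) \<in> frames J"
  shows "smooth_on ((snd c ` (fst c \<inter> U) \<times> snd k ` (fst k \<inter> V)) \<times> snd d ` fst d)
    (\<lambda>p. \<zeta>c c d k (e (chart_inv c (fst (fst p)))) (g (chart_inv k (snd (fst p)))) (chart_inv c (fst (fst p))) (chart_inv d (snd p)) (chart_inv k (snd (fst p))) l)"
    (is "smooth_on ((?X \<times> ?Z) \<times> _) ?f")
proof (rule smooth_on_local)
  fix p assume p: "p \<in> (?X \<times> ?Z) \<times> snd d ` fst d"
  obtain OE :: "('e \<times> 'f) set" and OG :: "('f \<times> 'g) set" where OE: "orthonormal_basis OE" and OG: "orthonormal_basis OG"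
    using atlas_orthonormal_basis[OF AB] atlas_orthonormal_basis[OF BC] by blast
  obtain V' f where f: "(V', f) \<in> frames K" "chart_inv d (snd p) \<in> V'" using line_bundle_frame_exists[OF K] by blast
  let ?Y = "snd d ` (fst d \<inter> V')"
  have op: "open ?X" "open ?Y" "open ?Z"
    using open_chart_image_subset[OF A c open_Int[OF open_chart_domain[OF A c] line_bundle_frame(1)[OF L e]]]
      open_chart_image_subset[OF B d open_Int[OF open_chart_domain[OF B d] line_bundle_frame(1)[OF K f(1)]]]
      open_chart_image_subset[OF C k open_Int[OF open_chart_domain[OF C k] line_bundle_frame(1)[OF J g]]]
    by simp_all
  let ?W = "(?X \<times> ?Z) \<times> ?Y"
  have W: "open ?W" by (intro open_Times op)
  have "snd p \<in> snd d ` fst d" using p by auto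
  then have "snd p \<in> ?Y"
    using chart_inv_right[OF B d] chart_inv_in[OF B d] f(2) by (metis IntI imageI)
  then have pW: "p \<in> ?W" using p by auto
  have invAB: "chart_inv (prod_chart c d) (a, b) = (chart_inv c a, chart_inv d b)"
    if "a \<in> ?X" "b \<in> ?Y" for a b
    using that by (intro chart_inv_prod[OF A B c d]) auto
  have invBC: "chart_inv (prod_chart d k) (b, q) = (chart_inv d b, chart_inv k q)"
    if "b \<in> ?Y" "q \<in> ?Z" for b q
    using that by (intro chart_inv_prod[OF B C d k]) auto
  have fr1: "(U \<times> V', \<lambda>(x, y). pairing L K x y (e x) (f y)) \<in> frames (ext_tensor L (dual_bundle K))"
    and fr2: "(V' \<times> V, \<lambda>(y, z). pairing K J y z (f y) (g z)) \<in> frames (ext_tensor K (dual_bundle J))"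
    unfolding frames_ext_tensor_dual using e f(1) g by blast+
  have s1: "smooth_on ?W (\<lambda>p. \<sigma>c c d (e (chart_inv c (fst (fst p)))) (f (chart_inv d (snd p))) (chart_inv c (fst (fst p))) (chart_inv d (snd p)) l)" for l
  proof -
    let ?h = "\<lambda>q. line_coord ((\<lambda>(x, y). pairing L K x y (e x) (f y)) (chart_inv (prod_chart c d) q))
      (\<sigma> (chart_inv (prod_chart c d) q) (map (chart_vec AB (prod_chart c d) (chart_inv (prod_chart c d) q)) l))"
    have "snd (prod_chart c d) ` (fst (prod_chart c d) \<inter> U \<times> V') = ?X \<times> ?Y"
      by (simp add: Times_Int_Times)
    then have h: "smooth_on (?X \<times> ?Y) ?h"
      using Omega_smooth[OF AB \<sigma> prod_chart_in[OF c d] fr1, of l] by simp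
    have "bounded_linear (\<lambda>p :: ('e \<times> 'g) \<times> 'f. (fst (fst p), snd p))"
      by (intro bounded_linear_Pair bounded_linear_compose[OF bounded_linear_fst bounded_linear_fst] bounded_linear_snd)
    then have "smooth_on ?W (\<lambda>p. ?h (fst (fst p), snd p))"
      by (intro smooth_on_compose[OF OE W open_Times[OF op(1,2)] _ smooth_on_linear[OF W] h]) auto
    then show ?thesis
      by (rule smooth_on_cong[OF W, rotated]) (clarsimp simp: \<sigma>c_def invAB)
  qed
  have s2: "smooth_on ?W (\<lambda>p. \<tau>c d k (f (chart_inv d (snd p))) (g (chart_inv k (snd (fst p)))) (chart_inv d (snd p)) (chart_inv k (snd (fst p))) l)" for l
  proof -
    let ?h = "\<lambda>q. line_coord ((\<lambda>(y, z). pairing K J y z (f y) (g z)) (chart_inv (prod_chart d k) q))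
      (\<tau> (chart_inv (prod_chart d k) q) (map (chart_vec BC (prod_chart d k) (chart_inv (prod_chart d k) q)) l))"
    have "snd (prod_chart d k) ` (fst (prod_chart d k) \<inter> V' \<times> V) = ?Y \<times> ?Z"
      by (simp add: Times_Int_Times)
    then have h: "smooth_on (?Y \<times> ?Z) ?h"
      using Omega_smooth[OF BC \<tau> prod_chart_in[OF d k] fr2, of l] by simp
    have "bounded_linear (\<lambda>p :: ('e \<times> 'g) \<times> 'f. (snd p, snd (fst p)))"
      by (intro bounded_linear_Pair bounded_linear_compose[OF bounded_linear_snd bounded_linear_fst] bounded_linear_snd)
    then have "smooth_on ?W (\<lambda>p. ?h (snd p, snd (fst p)))"
      by (intro smooth_on_compose[OF OG W open_Times[OF op(2,3)] _ smooth_on_linear[OF W] h]) auto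
    then show ?thesis
      by (rule smooth_on_cong[OF W, rotated]) (clarsimp simp: \<tau>c_def invBC)
  qed
  have "smooth_on ?W (\<lambda>p. wedge_coord c d k (e (chart_inv c (fst (fst p)))) (f (chart_inv d (snd p))) (g (chart_inv k (snd (fst p)))) (chart_inv c (fst (fst p))) (chart_inv d (snd p)) (chart_inv k (snd (fst p))) l)"
    unfolding wedge_coord_def shuffle_prod_def
    by (rule smooth_on_shuffle_sum[OF W], rule smooth_on_mult[OF W s1 s2])
  then have "smooth_on ?W ?f"
  proof (rule smooth_on_cong[OF W, rotated])
    fix q assume q: "q \<in> ?W"
    obtain x y z where xyz: "x \<in> fst c" "x \<in> U" "y \<in> fst d" "y \<in> V'" "z \<in> fst k" "z \<in> V" "q = ((snd c x, snd k z), snd d y)"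
      using q by auto
    show "wedge_coord c d k (e (chart_inv c (fst (fst q)))) (f (chart_inv d (snd q))) (g (chart_inv k (snd (fst q)))) (chart_inv c (fst (fst q))) (chart_inv d (snd q)) (chart_inv k (snd (fst q))) l = ?f q"
      unfolding xyz(7) fst_conv snd_conv chart_inv_left[OF A c xyz(1)] chart_inv_left[OF B d xyz(3)] chart_inv_left[OF C k xyz(5)]
      using \<zeta>c_eq[OF c xyz(1) d xyz(3) k xyz(5) line_bundle_frame(2)[OF L e xyz(2)] line_bundle_frame(2)[OF J g xyz(6)]
          line_bundle_frame(2)[OF K f(1) xyz(4)]] by simp
  qed
  then show "\<exists>W. open W \<and> p \<in> W \<and> smooth_on W ?f" using W pW by blast
qed

end


section \<open>Integration along the fibres\<close>

text \<open>The assumptions have the form supplied by \<open>symplectic_integral_expand\<close>.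
  Partition of unity, orientation and coordinate measure are thereby reduced to finitely many
  weights with compact supports.\<close>

locale fibre_integration = line_bundle_triple A B C L K J \<sigma> \<tau>
  for A :: "('m::t2_space, 'e::real_inner) atlas" and B :: "('n::t2_space, 'f::real_inner) atlas"
    and C :: "('p::t2_space, 'g::real_inner) atlas"
    and L :: "('m, 'l::complex_vector) line_bundle" and K :: "('n, 'k::complex_vector) line_bundle"
    and J :: "('p, 'j::complex_vector) line_bundle"
    and \<sigma> :: "('m \<times> 'n, ('l, 'k \<Rightarrow> complex) tensor) form" and \<tau> :: "('n \<times> 'p, ('k, 'j \<Rightarrow> complex) tensor) form" +
  fixes \<omega> :: "('n, real) form"
    and pieces :: "(('n, 'f) chart \<times> ('u \<Rightarrow> real) \<times> 'f set) list"
    and N :: "'u measure" and Y :: "'u \<Rightarrow> 'f" and bs :: "'f list"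
  assumes Y: "Y \<in> measurable N borel"
    and pieces: "\<forall>(d, \<theta>, Q)\<in>set pieces. d \<in> B \<and> compact Q \<and> Q \<subseteq> snd d ` fst d \<and> integrable N \<theta>
      \<and> (\<forall>u\<in>space N. \<theta> u \<noteq> 0 \<longrightarrow> Y u \<in> Q)"
    and expand: "\<forall>\<mu>. symplectic_integral B \<omega> \<mu> = (\<Sum>(d, \<theta>, Q)\<leftarrow>pieces.
      \<integral>u. \<theta> u *\<^sub>R \<mu> (chart_inv d (Y u)) (map (chart_vec B d (chart_inv d (Y u))) bs) \<partial>N)"
begin

lemma piece:
  assumes "(d, \<theta>, Q) \<in> set pieces"
  shows "d \<in> B" "compact Q" "Q \<subseteq> snd d ` fst d" "integrable N \<theta>" "\<forall>u\<in>space N. \<theta> u \<noteq> 0 \<longrightarrow> Y u \<in> Q"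
  using bspec[OF pieces assms] by simp_all

lemma piece_point:
  assumes "(d, \<theta>, Q) \<in> set pieces" "u \<in> space N" "\<theta> u \<noteq> 0"
  shows "chart_inv d (Y u) \<in> fst d"
  using chart_inv_in[OF B piece(1)[OF assms(1)]] piece(3,5)[OF assms(1)] assms(2,3) by blast

text \<open>The argument list of \<open>fibre_integral\<close> in model coordinates: by
  \<open>push_fibre\<close> and \<open>push_base\<close>, vectors from either factor are filled up
  with zeros.\<close>

definition ins :: "('e \<times> 'g) list \<Rightarrow> ('e \<times> 'f \<times> 'g) list" where
  "ins ws = map (\<lambda>v. (0, v, 0)) bs @ map (\<lambda>w. (fst w, 0, snd w)) ws"

definition result where "result = fibre_integral A B \<omega> C (ext_tensor L (dual_bundle J)) \<zeta>"

definition coefficient where "coefficient c k e g x z ws =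
  (\<Sum>(d, \<theta>, Q)\<leftarrow>pieces. \<integral>u. \<theta> u *\<^sub>R \<zeta>c c d k e g x (chart_inv d (Y u)) z (ins ws) \<partial>N)"

text \<open>\<open>fibre_integral\<close> uses an arbitrarily chosen vector e0 of each fibre, which
  need not vary smoothly. The change-of-basis scalar \<kappa> does not depend on the point of N, so
  it leaves the integral and turns e0 into the prescribed frame.\<close>

lemma result_chart:
  assumes c: "c \<in> A" "x \<in> fst c" and k: "k \<in> C" "z \<in> fst k"
    and e: "line_basis e (fibre L x)" and g: "line_basis g (fibre J z)"
  shows "result (x, z) (map (chart_vec AC (prod_chart c k) (x, z)) ws)
    = coefficient c k e g x z ws *\<^sub>C pairing L J x z e g"
proof -
  let ?V = "fibre (ext_tensor L (dual_bundle J)) (x, z)"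
  let ?cv = "chart_vec AC (prod_chart c k) (x, z)"
  note eg = line_basis_pairing[OF e g]
  define e0 where "e0 = (SOME e. e \<in> ?V \<and> e \<noteq> 0)"
  have e0: "line_basis e0 ?V"
    unfolding e0_def by (rule line_basis_some[OF line_basis_complex_line[OF eg]])
  define \<kappa> where "\<kappa> = line_coord e0 (pairing L J x z e g)"
  have \<kappa>: "\<kappa> *\<^sub>C e0 = pairing L J x z e g"
    unfolding \<kappa>_def by (rule scaleC_line_coord[OF e0 line_basis_self[OF eg]])
  define \<mu> where "\<mu> y vs = line_coord e0 (\<zeta> (x, y, z)
      (map (pushforward ABC (\<lambda>y'. (x, y', z)) y) vs @
       map (pushforward ABC (\<lambda>(x', z'). (x', y, z')) (x, z)) (map ?cv ws)))" for y vs
  have xz: "(x, z) \<in> fst (prod_chart c k)" using c k by simp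
  have "set (map ?cv ws) \<subseteq> tangent AC (x, z)"
    unfolding tangent_eq_range[OF AC prod_chart_in[OF c(1) k(1)] xz] by auto
  then have "result (x, z) (map ?cv ws) = symplectic_integral B \<omega> \<mu> *\<^sub>C e0"
    unfolding result_def fibre_integral_def Let_def prod.case e0_def[symmetric] \<mu>_def[abs_def] by simp
  also have "symplectic_integral B \<omega> \<mu> = (\<Sum>(d, \<theta>, Q)\<leftarrow>pieces.
      \<integral>u. \<theta> u *\<^sub>R \<mu> (chart_inv d (Y u)) (map (chart_vec B d (chart_inv d (Y u))) bs) \<partial>N)"
    using expand by blast
  also have "\<dots> = (\<Sum>(d, \<theta>, Q)\<leftarrow>pieces.
      (\<integral>u. \<theta> u *\<^sub>R \<zeta>c c d k e g x (chart_inv d (Y u)) z (ins ws) \<partial>N) * \<kappa>)"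
  proof (rule arg_cong[where f = sum_list], rule map_cong[OF refl])
    fix t assume t: "t \<in> set pieces"
    obtain d \<theta> Q where td: "t = (d, \<theta>, Q)" by (cases t)
    note p = t[unfolded td]
    have "(\<integral>u. \<theta> u *\<^sub>R \<mu> (chart_inv d (Y u)) (map (chart_vec B d (chart_inv d (Y u))) bs) \<partial>N)
        = (\<integral>u. (\<theta> u *\<^sub>R \<zeta>c c d k e g x (chart_inv d (Y u)) z (ins ws)) * \<kappa> \<partial>N)"
    proof (rule Bochner_Integration.integral_cong[OF refl])
      fix u assume u: "u \<in> space N"
      show "\<theta> u *\<^sub>R \<mu> (chart_inv d (Y u)) (map (chart_vec B d (chart_inv d (Y u))) bs)
          = (\<theta> u *\<^sub>R \<zeta>c c d k e g x (chart_inv d (Y u)) z (ins ws)) * \<kappa>"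
      proof (cases "\<theta> u = 0")
        case False
        let ?y = "chart_inv d (Y u)"
        note d = piece(1)[OF p] piece_point[OF p u False]
        have "\<mu> ?y (map (chart_vec B d ?y) bs) = line_coord e0 (\<zeta> (x, ?y, z) (map (frame3 c d k x ?y z) (ins ws)))"
          unfolding \<mu>_def ins_def
          by (simp add: o_def push_fibre[OF c d k] push_base[OF c d k])
        also have "\<dots> = line_coord e0 (\<zeta>c c d k e g x ?y z (ins ws) *\<^sub>C \<kappa> *\<^sub>C e0)"
          unfolding \<zeta>_eq[OF c d k e g] \<kappa> ..
        also have "\<dots> = \<zeta>c c d k e g x ?y z (ins ws) * \<kappa>"
          using e0 by (simp add: scaleC_scaleC line_coord_scaleC line_basis_def)
        finally show ?thesis by simp
      qed simp
    qed
    then show "(case t of (d, \<theta>, Q) \<Rightarrow> \<integral>u. \<theta> u *\<^sub>R \<mu> (chart_inv d (Y u)) (map (chart_vec B d (chart_inv d (Y u))) bs) \<partial>N)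
        = (case t of (d, \<theta>, Q) \<Rightarrow> (\<integral>u. \<theta> u *\<^sub>R \<zeta>c c d k e g x (chart_inv d (Y u)) z (ins ws) \<partial>N) * \<kappa>)"
      unfolding td prod.case integral_mult_left_zero .
  qed
  also have "\<dots> = coefficient c k e g x z ws * \<kappa>"
    unfolding coefficient_def by (simp add: sum_list_mult_const[symmetric] case_prod_unfold)
  finally show ?thesis by (simp add: scaleC_scaleC[symmetric] \<kappa>)
qed

lemma result_off_tangent: "\<not> set vs \<subseteq> tangent AC w \<Longrightarrow> result w vs = 0"
  unfolding result_def fibre_integral_def by (simp add: case_prod_unfold)

lemma coefficient_smooth:
  assumes c: "c \<in> A" and k: "k \<in> C" and e: "(U, e) \<in> frames L" and g: "(V, g) \<in> frames J"
  shows "smooth_on (snd c ` (fst c \<inter> U) \<times> snd k ` (fst k \<inter> V))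
    (\<lambda>p. coefficient c k (e (chart_inv c (fst p))) (g (chart_inv k (snd p))) (chart_inv c (fst p)) (chart_inv k (snd p)) ws)"
    (is "smooth_on ?W _")
proof -
  obtain O1 :: "('e \<times> 'g) set" where O1: "orthonormal_basis O1"
    using atlas_orthonormal_basis[OF AC] by blast
  have W: "open ?W"
    using open_chart_image_subset[OF A c open_Int[OF open_chart_domain[OF A c] line_bundle_frame(1)[OF L e]]]
      open_chart_image_subset[OF C k open_Int[OF open_chart_domain[OF C k] line_bundle_frame(1)[OF J g]]]
    by (intro open_Times) simp_all
  let ?h = "\<lambda>t p. case t of (d, \<theta>, Q) \<Rightarrow> \<integral>u. \<theta> u *\<^sub>R \<zeta>c c d k (e (chart_inv c (fst p))) (g (chart_inv k (snd p)))
      (chart_inv c (fst p)) (chart_inv d (Y u)) (chart_inv k (snd p)) (ins ws) \<partial>N"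
  have sm: "smooth_on ?W (?h t)" if t: "t \<in> set pieces" for t
  proof -
    obtain d \<theta> Q where td: "t = (d, \<theta>, Q)" by (cases t)
    note p = t[unfolded td]
    from smooth_on_integral[OF O1 W open_chart_image[OF B piece(1)[OF p]] piece(2,3,4)[OF p] Y piece(5)[OF p]
        \<zeta>c_smooth[OF c piece(1)[OF p] k e g, of "ins ws"]]
    show ?thesis unfolding td prod.case fst_conv snd_conv .
  qed
  have "smooth_on ?W (\<lambda>p. \<Sum>t\<leftarrow>ts. ?h t p)" if "set ts \<subseteq> set pieces" for ts
    using that
  proof (induction ts)
    case Nil
    show ?case using smooth_on_const[OF W] by simp
  next
    case (Cons t ts)
    then have "smooth_on ?W (?h t)" "smooth_on ?W (\<lambda>p. \<Sum>t\<leftarrow>ts. ?h t p)" using sm by simp_all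
    from smooth_on_add[OF W this] show ?case by simp
  qed
  then show ?thesis unfolding coefficient_def by simp
qed

lemma integrable_piece:
  assumes c: "c \<in> A" "x \<in> fst c" and k: "k \<in> C" "z \<in> fst k"
    and e: "(U, e) \<in> frames L" "x \<in> U" and g: "(V, g) \<in> frames J" "z \<in> V"
    and p: "(d, \<theta>, Q) \<in> set pieces"
  shows "integrable N (\<lambda>u. \<theta> u *\<^sub>R \<zeta>c c d k (e x) (g z) x (chart_inv d (Y u)) z l)"
proof (rule integrable_supported[OF piece(2)[OF p] _ piece(4)[OF p] Y piece(5)[OF p]])
  have x: "chart_inv c (snd c x) = x" "chart_inv k (snd k z) = z"
    using chart_inv_left[OF A c] chart_inv_left[OF C k] .
  have "(\<lambda>b. ((snd c x, snd k z), b)) ` Q \<subseteq> (snd c ` (fst c \<inter> U) \<times> snd k ` (fst k \<inter> V)) \<times> snd d ` fst d"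
    using c k e(2) g(2) piece(3)[OF p] by auto
  from continuous_on_compose2[OF smooth_on_continuous_on[OF \<zeta>c_smooth[OF c(1) piece(1)[OF p] k(1) e(1) g(1), of l]]
      continuous_on_Pair[OF continuous_on_const continuous_on_id] this]
  show "continuous_on Q (\<lambda>b. \<zeta>c c d k (e x) (g z) x (chart_inv d b) z l)"
    unfolding fst_conv snd_conv x .
qed

text \<open>Prepending the fixed vectors along N and embedding the remaining ones linearly both
  preserve alternation, and weighted integrals and finite sums inherit it.\<close>

lemma coefficient_alternating:
  assumes c: "c \<in> A" "x \<in> fst c" and k: "k \<in> C" "z \<in> fst k"
    and e: "(U, e) \<in> frames L" "x \<in> U" and g: "(V, g) \<in> frames J" "z \<in> V"
  shows "alternating (coefficient c k (e x) (g z) x z)"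
  unfolding coefficient_def[abs_def]
proof (rule alternating_sum_list)
  fix t assume t: "t \<in> set pieces"
  obtain d \<theta> Q where td: "t = (d, \<theta>, Q)" by (cases t)
  note p = t[unfolded td]
  have lin: "linear (\<lambda>w :: 'e \<times> 'g. (fst w, 0 :: 'f, snd w))"
    by (rule linearI) simp_all
  show "alternating (\<lambda>ws. case t of (d, \<theta>, Q) \<Rightarrow> \<integral>u. \<theta> u *\<^sub>R \<zeta>c c d k (e x) (g z) x (chart_inv d (Y u)) z (ins ws) \<partial>N)"
    unfolding td prod.case
  proof (rule alternating_integral)
    show "integrable N (\<lambda>u. \<theta> u *\<^sub>R \<zeta>c c d k (e x) (g z) x (chart_inv d (Y u)) z (ins ws))" for ws
      by (rule integrable_piece[OF c k e g p])
    fix u assume u: "u \<in> space N"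
    show "alternating (\<lambda>ws. \<theta> u *\<^sub>R \<zeta>c c d k (e x) (g z) x (chart_inv d (Y u)) z (ins ws))"
    proof (cases "\<theta> u = 0")
      case False
      have "alternating (\<zeta>c c d k (e x) (g z) x (chart_inv d (Y u)) z)"
        by (rule \<zeta>c_alternating[OF c piece(1)[OF p] piece_point[OF p u False] k
              line_bundle_frame(2)[OF L e] line_bundle_frame(2)[OF J g]])
      from alternating_scaleR[OF alternating_map[OF lin alternating_append[OF this]]]
      show ?thesis unfolding ins_def .
    qed (simp add: alternating_zero)
  qed
qed

lemma result_Omega: "result \<in> Omega AC (ext_tensor L (dual_bundle J))"
proof -
  let ?E = "ext_tensor L (dual_bundle J)"
  have pt: "alt_form (tangent AC (x, z)) (result (x, z)) \<and> (\<forall>vs. result (x, z) vs \<in> fibre ?E (x, z))" for x z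
  proof -
    obtain c k where c: "c \<in> A" "x \<in> fst c" and k: "k \<in> C" "z \<in> fst k"
      using chart_exists[OF A] chart_exists[OF C] by meson
    obtain U e where e: "(U, e) \<in> frames L" "x \<in> U" using line_bundle_frame_exists[OF L] by blast
    obtain V g where g: "(V, g) \<in> frames J" "z \<in> V" using line_bundle_frame_exists[OF J] by blast
    note eb = line_bundle_frame(2)[OF L e] and gb = line_bundle_frame(2)[OF J g]
    note eg = line_basis_pairing[OF eb gb]
    have xz: "(x, z) \<in> fst (prod_chart c k)" using c k by simp
    note res = result_chart[OF c k eb gb]
    have "alt_form (tangent AC (x, z)) (result (x, z))"
      by (rule alternating_alt_form[OF AC prod_chart_in[OF c(1) k(1)] xz result_off_tangent res
            coefficient_alternating[OF c k e g]])
    moreover have "result (x, z) vs \<in> fibre ?E (x, z)" for vs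
    proof (cases "set vs \<subseteq> tangent AC (x, z)")
      case True
      then have "\<exists>ws. vs = map (chart_vec AC (prod_chart c k) (x, z)) ws"
        unfolding ex_map_conv tangent_eq_range[OF AC prod_chart_in[OF c(1) k(1)] xz] by blast
      then show ?thesis using res line_basis_scaleC_in[OF eg] by auto
    next
      case False
      \<comment> \<open>The normalising value 0 lies in the fibre as the zero multiple of the
        frame.\<close>
      then show ?thesis using result_off_tangent line_basis_scaleC_in[OF eg, of 0] by simp
    qed
    ultimately show ?thesis by blast
  qed
  have "smooth_near AC w (\<lambda>y. line_coord (\<phi> y) (result y (map (chart_vec AC cc y) ws)))"
    if cc: "cc \<in> AC" and F: "(F, \<phi>) \<in> frames ?E" and w: "w \<in> fst cc \<inter> F" for cc F \<phi> ws w
  proof -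
    obtain c k where ck: "cc = prod_chart c k" "c \<in> A" "k \<in> C" using cc unfolding prod_atlas_eq by blast
    obtain U e V g where fr: "F = U \<times> V" "\<phi> = (\<lambda>(x, y). pairing L J x y (e x) (g y))" "(U, e) \<in> frames L" "(V, g) \<in> frames J"
      using F unfolding frames_ext_tensor_dual by blast
    let ?W = "snd c ` (fst c \<inter> U) \<times> snd k ` (fst k \<inter> V)"
    have W: "open ?W"
      using open_chart_image_subset[OF A ck(2) open_Int[OF open_chart_domain[OF A ck(2)] line_bundle_frame(1)[OF L fr(3)]]]
        open_chart_image_subset[OF C ck(3) open_Int[OF open_chart_domain[OF C ck(3)] line_bundle_frame(1)[OF J fr(4)]]]
      by (intro open_Times) simp_all
    show ?thesis
    proof (rule smooth_nearI[OF AC cc _ W])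
      show "w \<in> fst cc" using w by simp
      show "snd cc w \<in> ?W" using w by (auto simp: ck(1) fr(1))
      show "?W \<subseteq> snd cc ` fst cc" unfolding ck(1) fst_prod_chart prod_chart_image by blast
      show "smooth_on ?W (\<lambda>p. line_coord (\<phi> (chart_inv cc p)) (result (chart_inv cc p) (map (chart_vec AC cc (chart_inv cc p)) ws)))"
      \<comment> \<open>By \<open>frames_ext_tensor_dual\<close> the given frame is a
        \<open>pairing\<close> of frames of the factors; with respect to it the line coordinate of
        the result is \<open>coefficient\<close>.\<close>
      proof (rule smooth_on_cong[OF W _ coefficient_smooth[OF ck(2,3) fr(3,4), of ws]])
        fix p assume "p \<in> ?W"
        then obtain x z where xz: "x \<in> fst c" "x \<in> U" "z \<in> fst k" "z \<in> V" "p = (snd c x, snd k z)" by auto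
        note eb = line_bundle_frame(2)[OF L fr(3) xz(2)] and gb = line_bundle_frame(2)[OF J fr(4) xz(4)]
        have inv: "chart_inv cc p = (x, z)" "chart_inv c (fst p) = x" "chart_inv k (snd p) = z"
          using chart_inv_prod[OF A C ck(2,3), of "snd c x" "snd k z"] xz
            chart_inv_left[OF A ck(2) xz(1)] chart_inv_left[OF C ck(3) xz(3)] by (auto simp: ck(1))
        show "coefficient c k (e (chart_inv c (fst p))) (g (chart_inv k (snd p))) (chart_inv c (fst p)) (chart_inv k (snd p)) ws
            = line_coord (\<phi> (chart_inv cc p)) (result (chart_inv cc p) (map (chart_vec AC cc (chart_inv cc p)) ws))"
          unfolding inv unfolding ck(1) fr(2) prod.case result_chart[OF ck(2) xz(1) ck(3) xz(3) eb gb]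
          using line_basis_pairing[OF eb gb] by (simp add: line_basis_def line_coord_scaleC)
      qed
    qed
  qed
  then show ?thesis unfolding Omega_def using pt by auto
qed

end


section \<open>The kernel of the symplectic form\<close>

text \<open>Only lists of length 2 contribute, and there the parity sign is 1.\<close>

lemma grade_of_degree_2:
  assumes "of_degree 2 \<alpha>" "of_degree 2 \<beta>"
  shows "grade (\<lambda>l. complex_of_real (\<alpha> x (map F l) - \<beta> y (map G l))) = (\<lambda>l. complex_of_real (\<alpha> x (map F l) - \<beta> y (map G l)))"
proof
  fix l
  show "grade (\<lambda>l. complex_of_real (\<alpha> x (map F l) - \<beta> y (map G l))) l = complex_of_real (\<alpha> x (map F l) - \<beta> y (map G l))"
    using assms by (cases "length l = 2") (simp_all add: grade_def of_degree_def)
qed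

text \<open>The kernel equation for line-valued forms becomes a scalar one since the generator e is
  nonzero. In this shape both kernel hypotheses enter the computation.\<close>

lemma shuffle_prod_kernel_chart:
  assumes A: "smooth_atlas A" and B: "smooth_atlas B" and c: "c \<in> A" "x \<in> fst c" "d \<in> B" "y \<in> fst d"
    and \<beta>: "\<And>l. \<xi> (x, y) (map (chart_vec (prod_atlas A B) (prod_chart c d) (x, y)) l) = b l *\<^sub>C e" and e: "e \<noteq> 0"
    and zero: "(pullback (prod_atlas A B) A fst \<alpha> + pullback (prod_atlas A B) B snd (- \<alpha>')) \<and>\<^sub>R \<xi> = 0"
  shows "shuffle_prod (\<lambda>l. complex_of_real (\<alpha> x (map (chart_vec A c x) (map fst l)) - \<alpha>' y (map (chart_vec B d y) (map snd l)))) b l = 0"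
proof -
  have "shuffle_prod (\<lambda>l. complex_of_real (\<alpha> x (map (chart_vec A c x) (map fst l)) - \<alpha>' y (map (chart_vec B d y) (map snd l)))) b l *\<^sub>C e = 0"
    using rwedge_chart[where \<alpha> = "pullback (prod_atlas A B) A fst \<alpha> + pullback (prod_atlas A B) B snd (- \<alpha>')"
        and \<beta> = \<xi> and p = "(x, y)", OF \<beta>, of l]
    unfolding zero pullback_diff_chart[OF A B c] by simp
  then show ?thesis using e by simp
qed

context fibre_integration
begin

lemma result_kernel:
  fixes \<omega>\<^sub>M :: "('m, real) form" and \<omega>\<^sub>P :: "('p, real) form"
  assumes M: "\<omega>\<^sub>M \<in> real_forms A" "of_degree 2 \<omega>\<^sub>M" and N: "\<omega> \<in> real_forms B" "of_degree 2 \<omega>"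
    and P: "\<omega>\<^sub>P \<in> real_forms C" "of_degree 2 \<omega>\<^sub>P"
    and \<sigma>0: "(pullback AB A fst \<omega>\<^sub>M + pullback AB B snd (- \<omega>)) \<and>\<^sub>R \<sigma> = 0"
    and \<tau>0: "(pullback BC B fst \<omega> + pullback BC C snd (- \<omega>\<^sub>P)) \<and>\<^sub>R \<tau> = 0"
  shows "(pullback AC A fst \<omega>\<^sub>M + pullback AC C snd (- \<omega>\<^sub>P)) \<and>\<^sub>R result = 0"
proof -
  let ?\<Omega> = "pullback AC A fst \<omega>\<^sub>M + pullback AC C snd (- \<omega>\<^sub>P)"
  have "(?\<Omega> \<and>\<^sub>R result) (x, z) vs = 0" for x z vs
  proof (cases "set vs \<subseteq> tangent AC (x, z)")
    case False
    \<comment> \<open>A non-tangent entry ends up in a or in b, and the corresponding factor is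
      normalised to 0 there.\<close>
    have "?\<Omega> (x, z) a *\<^sub>R result (x, z) b = 0" if "set a \<union> set b = set vs" for a b
      using False that result_off_tangent[of b "(x, z)"]
      by (cases "set a \<subseteq> tangent AC (x, z)") (auto simp: pullback_def)
    then have "shuffle_sum vs (\<lambda>a b. ?\<Omega> (x, z) a *\<^sub>R result (x, z) b) = shuffle_sum vs (\<lambda>a b. 0)"
      by (rule shuffle_sum_cong)
    then show ?thesis unfolding rwedge_def wedge_eq_shuffle_sum by (simp add: shuffle_sum_zero)
  next
    case True
    obtain c k where c: "c \<in> A" "x \<in> fst c" and k: "k \<in> C" "z \<in> fst k"
      using chart_exists[OF A] chart_exists[OF C] by meson
    obtain U e where e: "(U, e) \<in> frames L" "x \<in> U" using line_bundle_frame_exists[OF L] by blast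
    obtain V g where g: "(V, g) \<in> frames J" "z \<in> V" using line_bundle_frame_exists[OF J] by blast
    note eb = line_bundle_frame(2)[OF L e] and gb = line_bundle_frame(2)[OF J g]
    have xz: "(x, z) \<in> fst (prod_chart c k)" using c k by simp
    have "\<exists>ws. vs = map (chart_vec AC (prod_chart c k) (x, z)) ws"
      using True unfolding ex_map_conv tangent_eq_range[OF AC prod_chart_in[OF c(1) k(1)] xz] by blast
    then obtain ws where ws: "vs = map (chart_vec AC (prod_chart c k) (x, z)) ws" by blast
    let ?o = "\<lambda>l. complex_of_real (\<omega>\<^sub>M x (map (chart_vec A c x) (map fst l)) - \<omega>\<^sub>P z (map (chart_vec C k z) (map snd l)))"
    let ?Z = "\<lambda>d u l. \<zeta>c c d k (e x) (g z) x (chart_inv d (Y u)) z (ins l)"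
    \<comment> \<open>The kernel identity under the integral, at a single point y of N and with the
      basis vectors of N already inserted.\<close>
    have pointwise: "shuffle_prod ?o (\<lambda>l. \<zeta>c c d k (e x) (g z) x y z (ins l)) ws = 0"
      if d: "d \<in> B" "y \<in> fst d" for d y
    proof -
      obtain f where fb: "line_basis f (fibre K y)" using line_bundle_basis_exists[OF K] by blast
      let ?M = "\<lambda>l :: ('e \<times> 'f \<times> 'g) list. \<omega>\<^sub>M x (map (chart_vec A c x) (map fst l))"
      let ?N = "\<lambda>l :: ('e \<times> 'f \<times> 'g) list. \<omega> y (map (chart_vec B d y) (map (\<lambda>w. fst (snd w)) l))"
      let ?P = "\<lambda>l :: ('e \<times> 'f \<times> 'g) list. \<omega>\<^sub>P z (map (chart_vec C k z) (map (\<lambda>w. snd (snd w)) l))"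
      let ?S = "\<lambda>l. \<sigma>c c d (e x) f x y (map (\<lambda>w. (fst w, fst (snd w))) l)"
      let ?T = "\<lambda>l. \<tau>c d k f (g z) y z (map snd l)"
      let ?MN = "\<lambda>l. complex_of_real (?M l - ?N l)" and ?NP = "\<lambda>l. complex_of_real (?N l - ?P l)"
        and ?MP = "\<lambda>l. complex_of_real (?M l - ?P l)"
      have S0: "shuffle_prod ?MN ?S = (\<lambda>l. 0)"
      proof
        fix l :: "('e \<times> 'f \<times> 'g) list"
        have "shuffle_prod (\<lambda>l. complex_of_real (\<omega>\<^sub>M x (map (chart_vec A c x) (map fst l))
            - \<omega> y (map (chart_vec B d y) (map snd l)))) (\<sigma>c c d (e x) f x y) (map (\<lambda>w. (fst w, fst (snd w))) l) = 0"
          by (rule shuffle_prod_kernel_chart[OF A B c d \<sigma>_eq[OF eb fb] _ \<sigma>0])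
            (use line_basis_pairing[OF eb fb] in \<open>simp add: line_basis_def\<close>)
        then show "shuffle_prod ?MN ?S l = 0" by (simp add: shuffle_prod_map o_def)
      qed
      have T0: "shuffle_prod ?NP ?T = (\<lambda>l. 0)"
      proof
        fix l :: "('e \<times> 'f \<times> 'g) list"
        have "shuffle_prod (\<lambda>l. complex_of_real (\<omega> y (map (chart_vec B d y) (map fst l))
            - \<omega>\<^sub>P z (map (chart_vec C k z) (map snd l)))) (\<tau>c d k f (g z) y z) (map snd l) = 0"
          by (rule shuffle_prod_kernel_chart[OF B C d k \<tau>_eq[OF fb gb] _ \<tau>0])
            (use line_basis_pairing[OF fb gb] in \<open>simp add: line_basis_def\<close>)
        then show "shuffle_prod ?NP ?T l = 0" by (simp add: shuffle_prod_map o_def)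
      qed
      have NP: "grade ?NP = ?NP"
        using grade_of_degree_2[OF N(2) P(2), of y "\<lambda>w :: 'e \<times> 'f \<times> 'g. chart_vec B d y (fst (snd w))" z
            "\<lambda>w. chart_vec C k z (snd (snd w))"] by (simp add: o_def)
      have MP: "grade ?MP = ?MP"
        using grade_of_degree_2[OF M(2) P(2), of x "\<lambda>w :: 'e \<times> 'f \<times> 'g. chart_vec A c x (fst w)" z
            "\<lambda>w. chart_vec C k z (snd (snd w))"] by (simp add: o_def)
      \<comment> \<open>The middle form cancels because N is dualised in one product system and not
        in the other.\<close>
      have sum: "?MP = ?MN + ?NP" by (rule ext) simp
      have "shuffle_prod ?MP (shuffle_prod ?S ?T) l = 0" for l
      proof -
        have "shuffle_prod ?MP (shuffle_prod ?S ?T) l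
            = shuffle_prod (shuffle_prod ?MN ?S) ?T l + shuffle_prod (shuffle_prod ?NP ?S) ?T l"
          unfolding sum shuffle_prod_add_left shuffle_prod_assoc ..
        \<comment> \<open>\<open>?NP\<close> annihilates \<open>?T\<close> but is separated from it
          by \<open>?S\<close>; being even, it passes \<open>?S\<close> without a sign.\<close>
        also have "shuffle_prod (shuffle_prod ?NP ?S) ?T l = shuffle_prod ?S (shuffle_prod ?NP ?T) l"
          unfolding shuffle_prod_commute[OF NP, of ?S] shuffle_prod_assoc ..
        finally show ?thesis unfolding S0 T0 by (simp add: shuffle_prod_zero_left shuffle_prod_zero_right)
      qed
      then have W0: "shuffle_prod ?MP (\<zeta>c c d k (e x) (g z) x y z) l = 0" for l
        unfolding \<zeta>c_eq[OF c d k eb gb fb] wedge_coord_def .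
      have interior: "?MP (v # l) = 0" if v: "v \<in> set (map (\<lambda>v. (0, v, 0)) bs)" for v l
      proof -
        have "fst v = 0" "snd (snd v) = 0" using v by auto
        then show ?thesis
          using real_form_zero_arg[OF A c M(1), of "map fst l"]
            real_form_zero_arg[OF C k P(1), of "map (\<lambda>w. snd (snd w)) l"] by simp
      qed
      have "shuffle_prod ?MP (\<zeta>c c d k (e x) (g z) x y z) (map (\<lambda>v. (0, v, 0)) bs @ map (\<lambda>w. (fst w, 0, snd w)) ws)
          = shuffle_prod ?MP (\<lambda>l. \<zeta>c c d k (e x) (g z) x y z (map (\<lambda>v. (0, v, 0)) bs @ l)) (map (\<lambda>w. (fst w, 0, snd w)) ws)"
        by (rule shuffle_prod_interior_zero[OF MP]) (rule interior)
      then show ?thesis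
        unfolding W0 ins_def by (simp add: shuffle_prod_map o_def)
    qed
    have res: "result (x, z) (map (chart_vec AC (prod_chart c k) (x, z)) l)
        = coefficient c k (e x) (g z) x z l *\<^sub>C pairing L J x z (e x) (g z)" for l
      by (rule result_chart[OF c k eb gb])
    \<comment> \<open>The coefficients \<open>?o a\<close> do not depend on u, so they move under
      the integrals and each piece becomes a shuffle sum of integrals.\<close>
    have "shuffle_prod ?o (coefficient c k (e x) (g z) x z) ws
        = (\<Sum>t\<leftarrow>pieces. shuffle_sum ws (\<lambda>a b. case t of (d, \<theta>, Q) \<Rightarrow> \<integral>u. \<theta> u *\<^sub>R (?o a * ?Z d u b) \<partial>N))"
      unfolding shuffle_prod_def coefficient_def shuffle_sum_sum_list[symmetric] sum_list_const_mult[symmetric]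
      by (simp add: case_prod_unfold mult_scaleR_right[symmetric] del: mult_scaleR_right)
    also have "\<dots> = (\<Sum>t\<leftarrow>pieces. 0)"
    proof (rule arg_cong[where f = sum_list], rule map_cong[OF refl])
      fix t assume t: "t \<in> set pieces"
      obtain d \<theta> Q where td: "t = (d, \<theta>, Q)" by (cases t)
      note p = t[unfolded td]
      have int: "integrable N (\<lambda>u. \<theta> u *\<^sub>R (?o a * ?Z d u b))" for a b
        using integrable_mult_right[OF integrable_piece[OF c k e g p, of "ins b"], of "?o a"] by simp
      have lin: "linear ((*\<^sub>R) r :: complex \<Rightarrow> complex)" for r
        by (rule linearI) (simp_all add: scaleR_add_right)
      have "shuffle_sum ws (\<lambda>a b. \<integral>u. \<theta> u *\<^sub>R (?o a * ?Z d u b) \<partial>N)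
          = (\<integral>u. shuffle_sum ws (\<lambda>a b. \<theta> u *\<^sub>R (?o a * ?Z d u b)) \<partial>N)"
        by (rule conjunct2[OF integrable_shuffle_sum]) (rule int)
      also have "\<dots> = (\<integral>u. 0 \<partial>N)"
      proof (rule Bochner_Integration.integral_cong[OF refl])
        fix u assume u: "u \<in> space N"
        have "shuffle_sum ws (\<lambda>a b. \<theta> u *\<^sub>R (?o a * ?Z d u b)) = \<theta> u *\<^sub>R shuffle_prod ?o (?Z d u) ws"
          unfolding shuffle_prod_def linear_shuffle_sum[OF lin] ..
        \<comment> \<open>Where the weight is nonzero, \<open>piece_point\<close> puts the point
          inside the chart and \<open>pointwise\<close> applies; elsewhere the factor 0
          suffices.\<close>
        also have "\<dots> = 0"
          using pointwise[OF piece(1)[OF p] piece_point[OF p u]] by (cases "\<theta> u = 0") auto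
        finally show "shuffle_sum ws (\<lambda>a b. \<theta> u *\<^sub>R (?o a * ?Z d u b)) = 0" .
      qed
      finally show "shuffle_sum ws (\<lambda>a b. case t of (d, \<theta>, Q) \<Rightarrow> \<integral>u. \<theta> u *\<^sub>R (?o a * ?Z d u b) \<partial>N) = 0"
        unfolding td prod.case by simp
    qed
    finally have "shuffle_prod ?o (coefficient c k (e x) (g z) x z) ws = 0" by simp
    then show ?thesis
      unfolding ws rwedge_chart[where \<alpha> = ?\<Omega> and \<beta> = result and p = "(x, z)", OF res] pullback_diff_chart[OF A C c k] by simp
  qed
  then show ?thesis by (auto simp: fun_eq_iff)
qed

end

theorem corollary4p6:
  fixes M :: "('m::t2_space, 'e::real_inner, 'l::complex_vector) prequantum"
    and N :: "('n::t2_space, 'f::real_inner, 'k::complex_vector) prequantum"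
    and P :: "('p::t2_space, 'g::real_inner, 'j::complex_vector) prequantum"
    and \<sigma> :: "('m \<times> 'n, ('l, 'k \<Rightarrow> complex) tensor) form"
    and \<tau> :: "('n \<times> 'p, ('k, 'j \<Rightarrow> complex) tensor) form"
  assumes "prequantum_system M" and "prequantum_system N" and "prequantum_system P"
    and "\<sigma> \<in> Gamma_forms (prod_system M (dual_system N))"
    and "\<tau> \<in> Gamma_forms (prod_system N (dual_system P))"
  shows "composition M N P \<sigma> \<tau> \<in> Gamma_forms (prod_system M (dual_system P))"
proof -
  have M: "smooth_atlas (charts M)" "is_line_bundle (charts M) (line M)"
      "omega M \<in> real_forms (charts M)" "of_degree 2 (omega M)"
    and N: "compact (UNIV :: 'n set)" "smooth_atlas (charts N)" "is_line_bundle (charts N) (line N)"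
      "omega N \<in> real_forms (charts N)" "of_degree 2 (omega N)"
    and P: "smooth_atlas (charts P)" "is_line_bundle (charts P) (line P)"
      "omega P \<in> real_forms (charts P)" "of_degree 2 (omega P)"
    using assms(1-3) unfolding prequantum_system_def symplectic_def by simp_all
  have s: "\<sigma> \<in> Omega (prod_atlas (charts M) (charts N)) (ext_tensor (line M) (dual_bundle (line N)))"
      "(pullback (prod_atlas (charts M) (charts N)) (charts M) fst (omega M)
        + pullback (prod_atlas (charts M) (charts N)) (charts N) snd (- omega N)) \<and>\<^sub>R \<sigma> = 0"
    using assms(4) unfolding Gamma_forms_def prod_system_def dual_system_def by simp_all
  have t: "\<tau> \<in> Omega (prod_atlas (charts N) (charts P)) (ext_tensor (line N) (dual_bundle (line P)))"
      "(pullback (prod_atlas (charts N) (charts P)) (charts N) fst (omega N)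
        + pullback (prod_atlas (charts N) (charts P)) (charts P) snd (- omega P)) \<and>\<^sub>R \<tau> = 0"
    using assms(5) unfolding Gamma_forms_def prod_system_def dual_system_def by simp_all
  obtain pieces :: "(('n, 'f) chart \<times> ((nat \<Rightarrow> real) \<Rightarrow> real) \<times> 'f set) list"
    and \<nu> :: "(nat \<Rightarrow> real) measure" and Y bs where
    pieces: "Y \<in> measurable \<nu> borel"
    "\<forall>(c, \<theta>, Q)\<in>set pieces. c \<in> charts N \<and> compact Q \<and> Q \<subseteq> snd c ` fst c \<and> integrable \<nu> \<theta> \<and>
       (\<forall>u\<in>space \<nu>. \<theta> u \<noteq> 0 \<longrightarrow> Y u \<in> Q)"
    "\<forall>\<mu>. symplectic_integral (charts N) (omega N) \<mu> = (\<Sum>(c, \<theta>, Q)\<leftarrow>pieces.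
       \<integral>u. \<theta> u *\<^sub>R \<mu> (chart_inv c (Y u)) (map (chart_vec (charts N) c (chart_inv c (Y u))) bs) \<partial>\<nu>)"
    using symplectic_integral_expand[OF N(2,1,4)] by (elim exE conjE) (rule that)
  interpret fibre_integration "charts M" "charts N" "charts P" "line M" "line N" "line P" \<sigma> \<tau>
    "omega N" pieces \<nu> Y bs
    by unfold_locales (rule M N P s t pieces)+
  have "composition M N P \<sigma> \<tau> = result"
    unfolding result_def \<zeta>_def composition_eq ..
  then show ?thesis
    using result_Omega result_kernel[OF M(3,4) N(4,5) P(3,4) s(2) t(2)]
    unfolding Gamma_forms_def prod_system_def dual_system_def by simp
qed

end
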